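(* Let $f\colon\mathbb T\to\mathbb R$ and $h\colon\mathbb T^2\to\mathbb R$ be Lipschitz, let $p$ be a probability density on $[0,1]$, extended $1$-periodically to $\mathbb R$, and let $c>0$ be such that $p(x)>c$ for all $x\in[0,1]$. Assume $$\kappa:=(1-c)\left(\operatorname{Lip}(f)+\operatorname{Lip}_1(h)+\operatorname{Lip}_2(h)\right)<\frac{\sqrt3}{2}.$$ Let $$\mathcal P_N(\mu)(dx)=\int_{\mathbb T^N}\prod_{j=1}^N p\Big(x_j-f(u_j)-\frac1N\sum_{k=1}^N h(u_j,u_k)\Big)dx_j\,d\mu(u),\qquad \mu\in\mathcal M_1(\mathbb T^N),$$ and let the self-consistent transfer operator be $$\mathcal P(\nu)(dx)=\int_{\mathbb T}p\Big(x-f(u)-\int_{\mathbb T} h(u,v)\,d\nu(v)\Big)dx\,d\nu(u),\qquad\nu\in\mathcal M_1(\mathbb T).$$ Then: 1. $\mathcal P$ is a one-step contraction in $W^1_1$: for all $\mu_1,\mu_2\in\mathcal M_1(\mathbb T)$, $$W^1_1(\mathcal P(\mu_1),\mathcal P(\mu_2))\le\kappa\,W^1_1(\mu_1,\mu_2).$$ In particular, $\mathcal P$ admits a unique fixed point $\rho\in\mathcal M_1(\mathbb T)$. 2. Let $\bar C:=\frac{(1-c)\operatorname{Lip}_2(h)}{1-\kappa}$. Then, for all $N\ge2$, $$\mathcal P_N B_{\bar C,N}(\rho)\subset B_{\bar C,N}(\rho),$$ where $B_{C,N}(q)=\{\mu\in\mathcal M_1(\mathbb T^N): W^1_N(\mu,q^{\otimes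 N})\le CN^{-1/2}\}$. In particular, for all $N\ge2$, the unique invariant sub-Gaussian probability measure $\rho_N$ of $\mathcal P_N$ belongs to $B_{\bar C,N}(\rho)$, i.e. $$W^1_N(\rho_N,\rho^{\otimes N})\le\bar C N^{-1/2}.$$
   Context: $\mathbb T=\mathbb R/\mathbb Z$ with the arc-length distance $d$ (so $d(x,y)=\min_{m\in\mathbb Z}|x-y-m|$), and $\mathcal M_1(X)$ is the set of Borel probability measures on $X$. $\operatorname{Lip}(f)$ is the Lipschitz constant of $f$ with respect to $d$. $\operatorname{Lip}_1(h)=\sup_{u_1\ne u_1',\,u_2}\frac{|h(u_1,u_2)-h(u_1',u_2)|}{d(u_1,u_1')}$, and $\operatorname{Lip}_2(h)$ is defined analogously in the second variable. $\mathcal P_N$ is the transfer operator of the Markov chain $x_i^{n+1}=f(x_i^n)+\frac1N\sum_{j=1}^N h(x_i^n,x_j^n)+\omega_i^n \bmod 1$, $i=1,\dots,N$, where the $\omega_i^n$ are i.i.d. with density $p$. For $g\colon\mathbb T^N\to\mathbb R$ and $1\le i\le N$, $$\operatorname{Lip}_i(g)=\sup_{x_{-i}\in\mathbb T^{N-1}}\sup_{x_i\ne x_i'}\frac{|g(x_i,x_{-i})-g(x_i',x_{-i})|}{d(x_i,x_i')},$$ where $x_{-i}$ is the vector of the coordinates other than the $i$-th; and $\operatorname{Lip}^N(g)=\sum_{i=1}^N\operatorname{Lip}_i(g)$. The $N$-dimensional Dobrushin-Wasserstein distance on $\mathcal M_1(\mathbb T^N)$ is $$W^1_N(\mu_1,\mu_2)=\sup_{g\colon\mathbb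 T^N\to\mathbb R,\ \operatorname{Lip}^N(g)\le1}\int g\,d(\mu_1-\mu_2).$$ A probability measure $\mu$ on $\mathbb T^N$ is sub-Gaussian if, for every Lipschitz observable $g\colon\mathbb T^N\to\mathbb R$ and every $\lambda\in\mathbb R$, $\mathbb E_\mu[e^{\lambda(g-\mathbb E_\mu[g])}]\le\exp\big(\frac{\lambda^2}{2}\sum_{i=1}^N\operatorname{Lip}_i(g)^2\big)$. Under the stated hypotheses, for every $N\ge2$ the operator $\mathcal P_N$ has a unique fixed point $\rho_N$ in $\mathcal M_1(\mathbb T^N)$, and $\rho_N$ is sub-Gaussian. *)

theory Defs
  imports "HOL-Probability.Probability"
begin

section \<open>The circle as a metric space\<close>

quotient_type circle = real / "\<lambda>x y :: real. x - y \<in> \<int>"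
proof (rule equivpI)
  show "reflp (\<lambda>x y :: real. x - y \<in> \<int>)"
    by (simp add: reflp_def)
  show "symp (\<lambda>x y :: real. x - y \<in> \<int>)"
    by (rule sympI) (metis Ints_minus minus_diff_eq)
  show "transp (\<lambda>x y :: real. x - y \<in> \<int>)"
  proof (rule transpI)
    fix x y z :: real
    assume "x - y \<in> \<int>" "y - z \<in> \<int>"
    then have "(x - y) + (y - z) \<in> \<int>"
      by (rule Ints_add)
    then show "x - z \<in> \<int>"
      by simp
  qed
qed

lift_definition to_circle :: "real \<Rightarrow> circle" is "\<lambda>x. x" .

text \<open>The representative of a point of the circle that lies in \<open>[0, 1)\<close>.\<close>

lift_definition circle_coord :: "circle \<Rightarrow> real" is frac
proof -
  fix x y :: real
  assume "x - y \<in> \<int>"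
  then obtain k where "x - y = of_int k"
    by (rule Ints_cases)
  then have "x = y + of_int k"
    by simp
  then show "frac x = frac y"
    by (simp add: frac_def)
qed

lemma Inf_dist_int: "(INF m::int. \<bar>z - of_int m\<bar>) = \<bar>z - of_int (round z)\<bar>" for z :: real
  by (intro cInf_eq_minimum) (auto intro: round_diff_minimal)

instantiation circle :: metric_space
begin

lift_definition dist_circle :: "circle \<Rightarrow> circle \<Rightarrow> real"
  is "\<lambda>x y. INF m::int. \<bar>x - y - of_int m\<bar>"
proof -
  fix x x' y y' :: real
  assume "x - x' \<in> \<int>" "y - y' \<in> \<int>"
  then have "(x - x') - (y - y') \<in> \<int>"
    by (rule Ints_diff)
  then obtain k where "(x - x') - (y - y') = of_int k"
    by (rule Ints_cases)
  then have k: "x - y = x' - y' + of_int k"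
    by simp
  then have "round (x - y) = round (x' - y') + k"
    using floor_add_int[of "x' - y' + 1 / 2" k] by (simp add: round_def add_ac)
  with k show "(INF m::int. \<bar>x - y - of_int m\<bar>) = (INF m::int. \<bar>x' - y' - of_int m\<bar>)"
    by (simp add: Inf_dist_int)
qed

definition uniformity_circle :: "(circle \<times> circle) filter"
  where "uniformity_circle = (INF e\<in>{0 <..}. principal {(x, y). dist x y < e})"

definition open_circle :: "circle set \<Rightarrow> bool"
  where "open_circle U \<longleftrightarrow> (\<forall>x\<in>U. eventually (\<lambda>(x', y). x' = x \<longrightarrow> y \<in> U) uniformity)"

instance
proof
  show "dist x y = 0 \<longleftrightarrow> x = y" for x y :: circle
  proof transfer
    fix x y :: real
    show "(INF m::int. \<bar>x - y - of_int m\<bar>) = 0 \<longleftrightarrow> x - y \<in> \<int>"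
    proof
      assume "(INF m::int. \<bar>x - y - of_int m\<bar>) = 0"
      then have "x - y = of_int (round (x - y))"
        by (simp add: Inf_dist_int)
      then show "x - y \<in> \<int>"
        by (metis Ints_of_int)
    next
      assume "x - y \<in> \<int>"
      then obtain k where "x - y = of_int k"
        by (rule Ints_cases)
      then show "(INF m::int. \<bar>x - y - of_int m\<bar>) = 0"
        by (simp add: Inf_dist_int)
    qed
  qed
  show "dist x y \<le> dist x z + dist y z" for x y z :: circle
  proof transfer
    fix x y z :: real
    have "\<bar>x - y - of_int (round (x - y))\<bar> \<le> \<bar>x - y - of_int (round (x - z) - round (y - z))\<bar>"
      by (rule round_diff_minimal)
    also have "\<dots> \<le> \<bar>x - z - of_int (round (x - z))\<bar> + \<bar>y - z - of_int (round (y - z))\<bar>"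
      by simp
    finally show "(INF m::int. \<bar>x - y - of_int m\<bar>)
        \<le> (INF m::int. \<bar>x - z - of_int m\<bar>) + (INF m::int. \<bar>y - z - of_int m\<bar>)"
      unfolding Inf_dist_int .
  qed
qed (fact uniformity_circle_def open_circle_def)+

end

text \<open>Lebesgue measure \<open>dx\<close> on the circle.\<close>

definition circle_lebesgue :: "circle measure"
  where "circle_lebesgue = distr (restrict_space lborel {0..<1}) borel to_circle"

section \<open>The torus\<close>

text \<open>Points of the \<open>N\<close>-torus are extensional functions on \<open>{..<N}\<close>. Since the circle is
  second countable, the product \<open>\<sigma>\<close>-algebra used here is the Borel \<open>\<sigma>\<close>-algebra of the torus.\<close>

definition torus :: "nat \<Rightarrow> (nat \<Rightarrow> circle) measure"
  where "torus N = (\<Pi>\<^sub>M i\<in>{..<N}. borel)"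

abbreviation torus_points :: "nat \<Rightarrow> (nat \<Rightarrow> circle) set"
  where "torus_points N \<equiv> (\<Pi>\<^sub>E i\<in>{..<N}. UNIV)"

definition torus_lebesgue :: "nat \<Rightarrow> (nat \<Rightarrow> circle) measure"
  where "torus_lebesgue N = (\<Pi>\<^sub>M i\<in>{..<N}. circle_lebesgue)"

abbreviation prob_measures :: "'a measure \<Rightarrow> 'a measure set"
  where "prob_measures M \<equiv> space (prob_algebra M)"

section \<open>Lipschitz constants\<close>

text \<open>All Lipschitz constants take values in \<open>[0, \<infinity>]\<close>, so that a bound on one of them
  entails that the function is Lipschitz.\<close>

definition Lip :: "(circle \<Rightarrow> real) \<Rightarrow> ennreal"
  where "Lip f = (SUP (x, y)\<in>{(x, y). x \<noteq> y}. ennreal (\<bar>f x - f y\<bar> / dist x y))"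

definition Lip1 :: "(circle \<times> circle \<Rightarrow> real) \<Rightarrow> ennreal"
  where "Lip1 h = (SUP (x, x', y)\<in>{(x, x', y). x \<noteq> x'}.
    ennreal (\<bar>h (x, y) - h (x', y)\<bar> / dist x x'))"

definition Lip2 :: "(circle \<times> circle \<Rightarrow> real) \<Rightarrow> ennreal"
  where "Lip2 h = (SUP (x, y, y')\<in>{(x, y, y'). y \<noteq> y'}.
    ennreal (\<bar>h (x, y) - h (x, y')\<bar> / dist y y'))"

definition Lip_coord :: "nat \<Rightarrow> nat \<Rightarrow> ((nat \<Rightarrow> circle) \<Rightarrow> real) \<Rightarrow> ennreal"
  where "Lip_coord N i g = (SUP x\<in>torus_points N. SUP (a, b)\<in>{(a, b). a \<noteq> b}.
    ennreal (\<bar>g (x(i := a)) - g (x(i := b))\<bar> / dist a b))"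

definition Lip_sum :: "nat \<Rightarrow> ((nat \<Rightarrow> circle) \<Rightarrow> real) \<Rightarrow> ennreal"
  where "Lip_sum N g = (\<Sum>i<N. Lip_coord N i g)"

text \<open>Lipschitz continuity for the \<open>\<ell>\<^sup>1\<close>-metric of the torus; any other metric
  \<open>\<ell>\<^sup>q\<close> gives the same class of functions.\<close>

definition torus_lipschitz :: "nat \<Rightarrow> ((nat \<Rightarrow> circle) \<Rightarrow> real) \<Rightarrow> bool"
  where "torus_lipschitz N g \<longleftrightarrow> (\<exists>L. \<forall>x\<in>torus_points N. \<forall>y\<in>torus_points N.
    \<bar>g x - g y\<bar> \<le> L * (\<Sum>i<N. dist (x i) (y i)))"

section \<open>Dobrushin--Wasserstein distances and sub-Gaussian measures\<close>

definition wasserstein :: "nat \<Rightarrow> (nat \<Rightarrow> circle) measure \<Rightarrow> (nat \<Rightarrow> circle) measure \<Rightarrow> real"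
  where "wasserstein N \<mu>\<^sub>1 \<mu>\<^sub>2 =
    (SUP g\<in>{g. Lip_sum N g \<le> 1}. (\<integral>x. g x \<partial>\<mu>\<^sub>1) - (\<integral>x. g x \<partial>\<mu>\<^sub>2))"

text \<open>The case \<open>N = 1\<close>, with the one-dimensional torus identified with the circle.\<close>

definition wasserstein1 :: "circle measure \<Rightarrow> circle measure \<Rightarrow> real"
  where "wasserstein1 \<nu>\<^sub>1 \<nu>\<^sub>2 =
    (SUP g\<in>{g. Lip g \<le> 1}. (\<integral>x. g x \<partial>\<nu>\<^sub>1) - (\<integral>x. g x \<partial>\<nu>\<^sub>2))"

abbreviation tensor_power :: "nat \<Rightarrow> circle measure \<Rightarrow> (nat \<Rightarrow> circle) measure"
  where "tensor_power N \<nu> \<equiv> (\<Pi>\<^sub>M i\<in>{..<N}. \<nu>)"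

definition wasserstein_ball :: "real \<Rightarrow> nat \<Rightarrow> circle measure \<Rightarrow> (nat \<Rightarrow> circle) measure set"
  where "wasserstein_ball C N q =
    {\<mu> \<in> prob_measures (torus N). wasserstein N \<mu> (tensor_power N q) \<le> C / sqrt (real N)}"

definition sub_gaussian :: "nat \<Rightarrow> (nat \<Rightarrow> circle) measure \<Rightarrow> bool"
  where "sub_gaussian N \<mu> \<longleftrightarrow> (\<forall>g (l::real). torus_lipschitz N g \<longrightarrow>
    (\<integral>x. exp (l * (g x - (\<integral>y. g y \<partial>\<mu>))) \<partial>\<mu>)
      \<le> exp (l\<^sup>2 / 2 * (\<Sum>i<N. (enn2real (Lip_coord N i g))\<^sup>2)))"

section \<open>Transfer operators\<close>

definition prob_density_on_unit :: "(real \<Rightarrow> real) \<Rightarrow> bool"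
  where "prob_density_on_unit p \<longleftrightarrow>
    set_borel_measurable lborel {0..1} p \<and> (\<forall>x\<in>{0..1}. 0 \<le> p x) \<and>
    (\<integral>\<^sup>+x\<in>{0..1}. ennreal (p x) \<partial>lborel) = 1"

text \<open>The \<open>1\<close>-periodic extension only uses the values on \<open>[0, 1)\<close>; so the value of a
  density at the end point \<open>1\<close> plays no role.\<close>

definition periodic_ext :: "(real \<Rightarrow> real) \<Rightarrow> real \<Rightarrow> real"
  where "periodic_ext p x = p (frac x)"

definition transfer_N ::
  "(circle \<Rightarrow> real) \<Rightarrow> (circle \<times> circle \<Rightarrow> real) \<Rightarrow> (real \<Rightarrow> real) \<Rightarrow> nat \<Rightarrow>
    (nat \<Rightarrow> circle) measure \<Rightarrow> (nat \<Rightarrow> circle) measure"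
  where "transfer_N f h p N \<mu> = density (torus_lebesgue N) (\<lambda>x.
    \<integral>\<^sup>+u. (\<Prod>j<N. ennreal (periodic_ext p
      (circle_coord (x j) - f (u j) - (1 / real N) * (\<Sum>k<N. h (u j, u k))))) \<partial>\<mu>)"

definition self_consistent_transfer ::
  "(circle \<Rightarrow> real) \<Rightarrow> (circle \<times> circle \<Rightarrow> real) \<Rightarrow> (real \<Rightarrow> real) \<Rightarrow>
    circle measure \<Rightarrow> circle measure"
  where "self_consistent_transfer f h p \<nu> = density circle_lebesgue (\<lambda>x.
    \<integral>\<^sup>+u. ennreal (periodic_ext p (circle_coord x - f u - (\<integral>v. h (u, v) \<partial>\<nu>))) \<partial>\<nu>)"

section \<open>Consistency of the two distances\<close>

lemma continuous_if_Lip_le_1: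
  assumes "Lip g \<le> 1"
  shows "continuous_on UNIV g"
proof -
  have "\<bar>g x - g y\<bar> \<le> dist x y" for x y
  proof (cases "x = y")
    case False
    then have "ennreal (\<bar>g x - g y\<bar> / dist x y) \<le> Lip g"
      unfolding Lip_def by (intro SUP_upper2[of "(x, y)"]) auto
    with assms have "ennreal (\<bar>g x - g y\<bar> / dist x y) \<le> 1"
      by (rule order_trans[rotated])
    with False show ?thesis
      by (simp add: divide_le_eq_1 ennreal_le_1)
  qed simp
  then have "1-lipschitz_on UNIV g"
    by (intro lipschitz_onI) (auto simp: dist_real_def)
  then show ?thesis
    by (rule lipschitz_on_continuous_on)
qed

lemma Lip_sum_1: "Lip_sum 1 g = Lip (\<lambda>a. g (\<lambda>i\<in>{..<1}. a))"
proof -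
  have upd: "x(0 := a) = (\<lambda>i\<in>{..<1}. a)" if "x \<in> torus_points 1" for x and a :: circle
    using that by (auto simp: fun_eq_iff PiE_def extensional_def)
  have ne: "torus_points 1 \<noteq> {}"
    by (simp add: PiE_eq_empty_iff)
  have "Lip_sum 1 g = (SUP x\<in>torus_points 1. SUP (a, b)\<in>{(a, b). a \<noteq> b}.
      ennreal (\<bar>g (\<lambda>i\<in>{..<1}. a) - g (\<lambda>i\<in>{..<1}. b)\<bar> / dist a b))"
    unfolding Lip_sum_def Lip_coord_def by (auto simp: upd intro!: SUP_cong)
  then show ?thesis
    using ne by (simp add: Lip_def)
qed

lemma wasserstein_1:
  assumes [measurable_cong]: "sets \<nu>\<^sub>1 = sets borel" "sets \<nu>\<^sub>2 = sets borel"
  shows "wasserstein 1 (distr \<nu>\<^sub>1 (torus 1) (\<lambda>a. \<lambda>i\<in>{..<1}. a))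
      (distr \<nu>\<^sub>2 (torus 1) (\<lambda>a. \<lambda>i\<in>{..<1}. a)) = wasserstein1 \<nu>\<^sub>1 \<nu>\<^sub>2"
proof -
  define e :: "circle \<Rightarrow> nat \<Rightarrow> circle" where "e = (\<lambda>a. \<lambda>i\<in>{..<1}. a)"
  have Lip_sum: "Lip_sum 1 g = Lip (\<lambda>a. g (e a))" for g
    unfolding Lip_sum_1 e_def ..
  have e_meas: "e \<in> borel \<rightarrow>\<^sub>M torus 1"
    unfolding e_def torus_def by measurable
  have e_0: "e (x 0) = x" if "x \<in> space (torus 1)" for x
    using that by (auto simp: e_def torus_def space_PiM PiE_def extensional_def fun_eq_iff)
  have int: "(\<integral>x. g x \<partial>distr \<nu> (torus 1) e) = (\<integral>a. g (e a) \<partial>\<nu>)"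
    if "Lip (\<lambda>a. g (e a)) \<le> 1" and nu: "sets \<nu> = sets borel" for g :: "_ \<Rightarrow> real" and \<nu>
  proof (rule integral_distr)
    show "e \<in> \<nu> \<rightarrow>\<^sub>M torus 1"
      using e_meas measurable_cong_sets[OF nu refl] by blast
    have "(\<lambda>a. g (e a)) \<in> borel_measurable borel"
      using continuous_if_Lip_le_1[OF that(1)] by (rule borel_measurable_continuous_onI)
    moreover have "(\<lambda>x. x 0) \<in> torus 1 \<rightarrow>\<^sub>M borel"
      unfolding torus_def by measurable
    ultimately have "(\<lambda>x. g (e (x 0))) \<in> borel_measurable (torus 1)"
      by (rule measurable_compose[rotated])
    then show "g \<in> borel_measurable (torus 1)"
      by (subst (asm) measurable_cong[where g = g]) (auto simp: e_0)
  qed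
  let ?D = "\<lambda>g. (\<integral>a. g a \<partial>\<nu>\<^sub>1) - (\<integral>a. g a \<partial>\<nu>\<^sub>2)"
  have "wasserstein 1 (distr \<nu>\<^sub>1 (torus 1) e) (distr \<nu>\<^sub>2 (torus 1) e)
      = (SUP g\<in>{g. Lip (\<lambda>a. g (e a)) \<le> 1}. ?D (\<lambda>a. g (e a)))"
    unfolding wasserstein_def Lip_sum
    by (rule arg_cong[where f = Sup], rule image_cong) (simp_all add: int assms del: One_nat_def)
  also have "\<dots> = (SUP g\<in>{g. Lip g \<le> 1}. ?D g)"
  proof (rule arg_cong[where f = Sup], safe)
    fix g :: "(nat \<Rightarrow> circle) \<Rightarrow> real"
    assume "Lip (\<lambda>a. g (e a)) \<le> 1"
    then show "?D (\<lambda>a. g (e a)) \<in> ?D ` {g. Lip g \<le> 1}"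
      by (intro image_eqI[of _ _ "\<lambda>a. g (e a)"]) auto
  next
    fix g
    assume "Lip g \<le> 1"
    then show "?D g \<in> (\<lambda>g. ?D (\<lambda>a. g (e a))) ` {g. Lip (\<lambda>a. g (e a)) \<le> 1}"
      by (intro image_eqI[of _ _ "\<lambda>x. g (x 0)"]) (auto simp: e_def)
  qed
  finally show ?thesis
    unfolding wasserstein1_def e_def .
qed

end

theory Submission
  imports Defs
begin

text \<open>
  Since \<open>p > c\<close>, the noise is a mixture of the uniform law (weight \<open>c\<close>), which forgets the drift, and a
  remainder of mass \<open>1 - c\<close>; hence expectations of \<open>L\<close>-Lipschitz functions are \<open>(1 - c) L\<close>-Lipschitz in
  the drift, coordinate by coordinate for products. Composing with the drift gives the factor \<open>\<kappa>\<close>, and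
  the fixed point \<open>\<rho>\<close> is a limit of iterates, which converge along a subsequence by Helly's theorem.
  The product density of the particle system is at least \<open>c\<^sup>N\<close>, so its fixed point is
  an explicit Doeblin series. Conditionally on the previous state the coordinates are independent, so
  Hoeffding's lemma bounds the exponential moment by that of the transferred observable, whose squared Lipschitz
  constants shrink by \<open>\<kappa>\<^sup>2\<close>; iterating gives the constant \<open>1 / (4 (1 - \<kappa>\<^sup>2))\<close>, which is at most \<open>1\<close>
  because \<open>\<kappa>\<^sup>2 \<le> 3 / 4\<close>. Finally \<open>\<rho>\<^sup>\<otimes>\<^sup>N\<close> is the image of itself under the product kernel with drift
  \<open>f(u\<^sub>j) + \<integral>h(u\<^sub>j, v) d\<rho>(v)\<close>, and under \<open>\<rho>\<^sup>\<otimes>\<^sup>N\<close> this differs from the particle drift by a sum of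
  uncorrelated terms of size \<open>O(N\<^sup>-\<^sup>1)\<close>.
\<close>

section \<open>The circle and coordinatewise Lipschitz functions\<close>

text \<open>The two operators need different existence arguments. \<open>P\<^sub>N\<close> acts
  linearly on measures, so a lower bound on its kernel settles existence and uniqueness, although
  the bound c^N gives nothing uniform in N. \<open>P\<close> is nonlinear, because its drift
  contains the measure it is applied to; there the contraction makes the iterates Cauchy and
  compactness supplies a limit measure. That \<kappa> does not depend on N comes from the scaling of
  the coupling: moving one particle changes its own drift by at most a + b1 times the displacement,
  and each of the N drifts by a further b2 / N. Lipschitz constants are thus multiplied by 1 - c
  times a symmetric matrix, (a + b1) Id plus b2 / N times the all-ones matrix, whose norm is a + b1
  + b2 both in l1 (Wasserstein distance) and in l2 (exponential moments). \<open>Cbar\<close> is the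
  fixed point of the affine map r -> \<kappa> r + (1 - c) Lip2(h), which bounds one step of the
  distance to the product measure in units of N^(-1/2).\<close>

lemma to_circle_eq_iff: "to_circle x = to_circle y \<longleftrightarrow> x - y \<in> \<int>"
  by transfer simp

lemma to_circle_coord [simp]: "to_circle (circle_coord a) = a"
proof transfer
  show "frac a - a \<in> \<int>" for a :: real
    by (simp add: frac_def)
qed

lemma circle_coord_to_circle [simp]: "circle_coord (to_circle x) = frac x"
  by transfer simp

lemma circle_coord_bounds: "0 \<le> circle_coord a" "circle_coord a < 1"
  by (transfer, simp add: frac_lt_1)+

lemma dist_to_circle: "dist (to_circle x) (to_circle y) = \<bar>x - y - of_int (round (x - y))\<bar>"
  by (simp add: dist_circle.abs_eq to_circle.abs_eq Inf_dist_int)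

lemma dist_to_circle_le: "dist (to_circle x) (to_circle y) \<le> \<bar>x - y\<bar>"
  using round_diff_minimal[of "x - y" 0] by (simp add: dist_to_circle)

text \<open>Rounding moves a real by at most 1/2, so the diameter is 1/2; the bound 1 lets a
  Lipschitz constant double as a bound on the oscillation.\<close>

lemma dist_circle_le: "dist a b \<le> (1 :: real)" for a b :: circle
proof -
  have "dist (to_circle (circle_coord a)) (to_circle (circle_coord b)) \<le> 1 / 2"
    unfolding dist_to_circle using of_int_round_abs_le[of "circle_coord a - circle_coord b"]
    by (simp add: abs_minus_commute)
  then show ?thesis
    by simp
qed

lemma continuous_to_circle [continuous_intros]: "continuous_on A to_circle"
  by (rule lipschitz_on_continuous_on[where L = 1], rule lipschitz_onI)
    (auto simp: dist_real_def dist_to_circle_le)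

lemma measurable_to_circle [measurable]: "to_circle \<in> borel_measurable borel"
  by (intro borel_measurable_continuous_onI continuous_to_circle)

lemma measurable_circle_coord [measurable]: "circle_coord \<in> borel_measurable borel"
proof (rule borel_measurableI_le)
  fix t :: real
  have "{a. circle_coord a \<le> t} \<in> sets borel"
  proof (cases "t < 1")
    case True
    have "{a. circle_coord a \<le> t} = to_circle ` {0..t}"
    proof safe
      fix a assume "circle_coord a \<le> t"
      then show "a \<in> to_circle ` {0..t}"
        by (intro image_eqI[of _ _ "circle_coord a"]) (auto simp: circle_coord_bounds)
    next
      fix x assume "x \<in> {0..t}"
      with True show "circle_coord (to_circle x) \<le> t"
        by (simp add: frac_eq[THEN iffD2])
    qed
    moreover have "compact (to_circle ` {0..t})"
      by (intro compact_continuous_image continuous_to_circle) auto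
    ultimately show ?thesis
      by (simp add: borel_closed compact_imp_closed)
  next
    case False
    then have "circle_coord a \<le> t" for a
      using circle_coord_bounds(2)[of a] by simp
    then have "{a. circle_coord a \<le> t} = UNIV"
      by auto
    then show ?thesis
      by simp
  qed
  then show "{a \<in> space borel. circle_coord a \<le> t} \<in> sets borel"
    by simp
qed

text \<open>The family \<open>L\<close> consists of arbitrary upper bounds rather than least
  constants, because transferring an observable only yields bounds. The value space is a general
  metric space: the notion is applied to observables on the torus and also to functions of a real
  vector of drifts.\<close>

definition coord_lipschitz ::
    "'i set \<Rightarrow> ('i \<Rightarrow> real) \<Rightarrow> (('i \<Rightarrow> 'a::metric_space) \<Rightarrow> real) \<Rightarrow> bool"
  where "coord_lipschitz I L g \<longleftrightarrow> (\<forall>i\<in>I. 0 \<le> L i \<and>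
    (\<forall>x\<in>\<Pi>\<^sub>E i\<in>I. UNIV. \<forall>a b. \<bar>g (x(i := a)) - g (x(i := b))\<bar> \<le> L i * dist a b))"

lemma coord_lipschitzD:
  assumes "coord_lipschitz I L g" "i \<in> I"
  shows "0 \<le> L i" "x \<in> (\<Pi>\<^sub>E i\<in>I. UNIV) \<Longrightarrow> \<bar>g (x(i := a)) - g (x(i := b))\<bar> \<le> L i * dist a b"
  using assms unfolding coord_lipschitz_def by auto

text \<open>Walk from x to y by changing one coordinate at a time; \<open>override_on x y J\<close>
  is the intermediate point that has already received the coordinates in J from y.\<close>

lemma coord_lipschitz_sum:
  assumes g: "coord_lipschitz I L g" and I: "finite I"
    and x: "x \<in> (\<Pi>\<^sub>E i\<in>I. UNIV)" and y: "y \<in> (\<Pi>\<^sub>E i\<in>I. UNIV)"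
  shows "\<bar>g x - g y\<bar> \<le> (\<Sum>i\<in>I. L i * dist (x i) (y i))"
proof -
  have mem: "override_on x y J \<in> (\<Pi>\<^sub>E i\<in>I. UNIV)" for J
    using x y by (auto simp: PiE_def extensional_def override_on_def)
  have "\<bar>g x - g (override_on x y J)\<bar> \<le> (\<Sum>i\<in>J. L i * dist (x i) (y i))" if "J \<subseteq> I" for J
    using finite_subset[OF that I] that
  proof (induction J)
    case (insert j J)
    let ?u = "override_on x y J"
    have "override_on x y (insert j J) = ?u(j := y j)" "?u = ?u(j := x j)"
      using insert by (auto simp: fun_eq_iff override_on_def)
    then have "\<bar>g ?u - g (override_on x y (insert j J))\<bar> \<le> L j * dist (x j) (y j)"
      using coord_lipschitzD(2)[OF g _ mem, of j J "x j" "y j"] insert.prems by simp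
    with insert show ?case
      by simp
  qed simp
  moreover have "override_on x y I = y"
    using x y by (auto simp: override_on_def PiE_def extensional_def fun_eq_iff)
  ultimately show ?thesis
    by (metis order.refl)
qed

lemma coord_lipschitz_osc:
  fixes g :: "('i \<Rightarrow> circle) \<Rightarrow> real"
  assumes "coord_lipschitz I L g" "finite I" "x \<in> (\<Pi>\<^sub>E i\<in>I. UNIV)" "y \<in> (\<Pi>\<^sub>E i\<in>I. UNIV)"
  shows "\<bar>g x - g y\<bar> \<le> sum L I"
proof -
  have "(\<Sum>i\<in>I. L i * dist (x i) (y i)) \<le> sum L I"
    using coord_lipschitzD(1)[OF assms(1)] by (intro sum_mono) (simp add: mult_left_le dist_circle_le)
  with coord_lipschitz_sum[OF assms] show ?thesis
    by simp
qed

lemma to_circle_floor_tendsto: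
  "(\<lambda>n. to_circle (\<lfloor>real n * circle_coord a\<rfloor> / real n)) \<longlonglongrightarrow> a"
proof (rule metric_tendsto_imp_tendsto[where f = "\<lambda>n. 1 / real n" and a = 0])
  show "(\<lambda>n. 1 / real n) \<longlonglongrightarrow> 0"
    by (rule lim_1_over_n)
  show "\<forall>\<^sub>F n in sequentially.
      dist (to_circle (\<lfloor>real n * circle_coord a\<rfloor> / real n)) a \<le> dist (1 / real n) 0"
    using eventually_gt_at_top[of 0]
  proof eventually_elim
    case (elim n)
    have "dist (to_circle (\<lfloor>real n * circle_coord a\<rfloor> / real n)) (to_circle (circle_coord a))
        \<le> \<bar>\<lfloor>real n * circle_coord a\<rfloor> / real n - circle_coord a\<bar>"
      by (rule dist_to_circle_le)
    also have "\<dots> = \<bar>\<lfloor>real n * circle_coord a\<rfloor> - real n * circle_coord a\<bar> / real n"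
      using elim by (simp add: abs_if field_simps)
    also have "\<dots> \<le> 1 / real n"
      by (intro divide_right_mono) linarith+
    finally show ?case
      by simp
  qed
qed

text \<open>The Wasserstein distances range over all Lipschitz functions, with measurability not
  part of the definition, so it has to be derived for the product sigma-algebra. Rounding every
  coordinate down to a grid of mesh 1/n gives measurable functions that converge pointwise to
  g.\<close>

lemma measurable_coord_lipschitz:
  fixes g :: "('i \<Rightarrow> circle) \<Rightarrow> real"
  assumes g: "coord_lipschitz I L g" and I: "finite I"
  shows "g \<in> borel_measurable (\<Pi>\<^sub>M i\<in>I. borel)"
proof (rule borel_measurable_LIMSEQ_real)
  define r where "r n x = (\<lambda>i\<in>I. to_circle (\<lfloor>real n * circle_coord (x i)\<rfloor> / real n))"
    for n and x :: "'i \<Rightarrow> circle"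
  show "(\<lambda>n. g (r n x)) \<longlonglongrightarrow> g x" if "x \<in> space (\<Pi>\<^sub>M i\<in>I. borel)" for x
  proof -
    have x: "x \<in> (\<Pi>\<^sub>E i\<in>I. UNIV)"
      using that by (simp add: space_PiM)
    have "(\<lambda>n. \<Sum>i\<in>I. L i * dist (r n x i) (x i)) \<longlonglongrightarrow> (\<Sum>i\<in>I. L i * 0)"
    proof (intro tendsto_sum tendsto_mult tendsto_const)
      fix i assume "i \<in> I"
      then have "(\<lambda>n. r n x i) \<longlonglongrightarrow> x i"
        using to_circle_floor_tendsto[of "x i"] by (simp add: r_def)
      then show "(\<lambda>n. dist (r n x i) (x i)) \<longlonglongrightarrow> 0"
        by (subst (asm) tendsto_dist_iff)
    qed
    moreover have "dist (g (r n x)) (g x) \<le> (\<Sum>i\<in>I. L i * dist (r n x i) (x i))" for n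
      unfolding dist_real_def by (rule coord_lipschitz_sum[OF g I _ x]) (simp add: r_def)
    ultimately have "(\<lambda>n. dist (g (r n x)) (g x)) \<longlonglongrightarrow> 0"
      by - (rule Lim_null_comparison[OF always_eventually], auto)
    then show ?thesis
      by (subst tendsto_dist_iff)
  qed
  show "(\<lambda>x. g (r n x)) \<in> borel_measurable (\<Pi>\<^sub>M i\<in>I. borel)" for n
  proof -
    \<comment> \<open>As a function of finitely many integers g needs no regularity: a finite
      product of countable discrete spaces is discrete.\<close>
    have "(\<lambda>k. g (\<lambda>i\<in>I. to_circle (of_int (k i) / real n))) \<in>
        borel_measurable (\<Pi>\<^sub>M i\<in>I. count_space (UNIV :: int set))"
      using I by (subst count_space_PiM_finite) auto
    moreover have "(\<lambda>x. \<lambda>i\<in>I. \<lfloor>real n * circle_coord (x i)\<rfloor>) \<in>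
        (\<Pi>\<^sub>M i\<in>I. borel) \<rightarrow>\<^sub>M (\<Pi>\<^sub>M i\<in>I. count_space UNIV)"
      by measurable
    ultimately have "(\<lambda>x. g (\<lambda>i\<in>I. to_circle (of_int ((\<lambda>i\<in>I. \<lfloor>real n * circle_coord (x i)\<rfloor>) i) / real n)))
       \<in> borel_measurable (\<Pi>\<^sub>M i\<in>I. borel)"
      by (rule measurable_compose[rotated])
    also have "(\<lambda>x. (\<lambda>i\<in>I. to_circle (of_int ((\<lambda>i\<in>I. \<lfloor>real n * circle_coord (x i)\<rfloor>) i) / real n)))
        = r n"
      by (auto simp: fun_eq_iff r_def restrict_def)
    finally show ?thesis by simp
  qed
qed

section \<open>Density kernels, product measures and Hoeffding's inequality\<close>

lemma PiM_density:
  assumes I: "finite I"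
    and M: "product_sigma_finite M"
    and f: "\<And>i. f i \<in> borel_measurable (M i)"
    and D: "\<And>i. sigma_finite_measure (density (M i) (f i))"
  shows "(\<Pi>\<^sub>M i\<in>I. density (M i) (f i)) = density (\<Pi>\<^sub>M i\<in>I. M i) (\<lambda>x. \<Prod>i\<in>I. f i (x i))"
proof -
  interpret M: product_sigma_finite M by fact
  interpret D: product_sigma_finite "\<lambda>i. density (M i) (f i)"
    using D by (rule product_sigma_finite.intro)
  note f [measurable]
  have prod_meas [measurable]: "(\<lambda>x. \<Prod>i\<in>I. f i (x i)) \<in> borel_measurable (\<Pi>\<^sub>M i\<in>I. M i)"
    by (intro borel_measurable_prod_ennreal) measurable
  show ?thesis
  proof (rule D.PiM_eqI[symmetric, OF I])
    show "sets (density (\<Pi>\<^sub>M i\<in>I. M i) (\<lambda>x. \<Prod>i\<in>I. f i (x i))) = sets (\<Pi>\<^sub>M i\<in>I. density (M i) (f i))"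
      by (simp cong: sets_PiM_cong)
    fix A assume "\<And>i. i \<in> I \<Longrightarrow> A i \<in> sets (density (M i) (f i))"
    then have A: "A i \<in> sets (M i)" if "i \<in> I" for i
      using that by simp
    have "emeasure (density (\<Pi>\<^sub>M i\<in>I. M i) (\<lambda>x. \<Prod>i\<in>I. f i (x i))) (Pi\<^sub>E I A)
        = (\<integral>\<^sup>+x. (\<Prod>i\<in>I. f i (x i)) * indicator (Pi\<^sub>E I A) x \<partial>\<Pi>\<^sub>M i\<in>I. M i)"
      using A I by (intro emeasure_density) auto
    also have "\<dots> = (\<integral>\<^sup>+x. (\<Prod>i\<in>I. f i (x i) * indicator (A i) (x i)) \<partial>\<Pi>\<^sub>M i\<in>I. M i)"
    proof (rule nn_integral_cong)
      fix x assume "x \<in> space (\<Pi>\<^sub>M i\<in>I. M i)"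
      then have "indicator (Pi\<^sub>E I A) x = (\<Prod>i\<in>I. indicator (A i) (x i) :: ennreal)"
        using I by (auto simp: indicator_def space_PiM PiE_iff prod.neutral prod_zero_iff)
      then show "(\<Prod>i\<in>I. f i (x i)) * indicator (Pi\<^sub>E I A) x = (\<Prod>i\<in>I. f i (x i) * indicator (A i) (x i))"
        by (simp add: prod.distrib)
    qed
    also have "\<dots> = (\<Prod>i\<in>I. \<integral>\<^sup>+x. f i x * indicator (A i) x \<partial>M i)"
      using I A by (intro M.product_nn_integral_prod) auto
    also have "\<dots> = (\<Prod>i\<in>I. emeasure (density (M i) (f i)) (A i))"
      using A by (intro prod.cong) (auto simp: emeasure_density)
    finally show "emeasure (density (\<Pi>\<^sub>M i\<in>I. M i) (\<lambda>x. \<Prod>i\<in>I. f i (x i))) (Pi\<^sub>E I A)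
        = (\<Prod>i\<in>I. emeasure (density (M i) (f i)) (A i))" .
  qed
qed

section \<open>Bounded integrands and Markov kernels with densities\<close>

lemma integrable_bounded:
  fixes f :: "'a \<Rightarrow> real"
  assumes "finite_measure M" "f \<in> borel_measurable M" "\<And>x. x \<in> space M \<Longrightarrow> \<bar>f x\<bar> \<le> B"
  shows "integrable M f"
  using assms by (intro finite_measure.integrable_const_bound[where B = B]) auto

lemma abs_integral_le_bound:
  fixes f :: "'a \<Rightarrow> real"
  assumes M: "prob_space M" and f: "f \<in> borel_measurable M" "\<And>x. x \<in> space M \<Longrightarrow> \<bar>f x\<bar> \<le> B"
  shows "\<bar>\<integral>x. f x \<partial>M\<bar> \<le> B"
proof -
  interpret prob_space M by fact
  have "\<bar>\<integral>x. f x \<partial>M\<bar> \<le> (\<integral>x. B \<partial>M)"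
    using f integrable_bounded[OF finite_measure_axioms f]
    by (intro order.trans[OF integral_abs_bound] integral_mono) (auto intro: integrable_abs)
  then show ?thesis
    by (simp add: prob_space)
qed

text \<open>A Markov kernel from S with densities relative to one fixed probability measure M. It
  serves three times: for \<open>P\<close> with its drift frozen, for \<open>P\<^sub>N\<close>, and
  for the product kernel that fixes the tensor power.\<close>

locale density_kernel = reference: prob_space M for M :: "'b measure" +
  fixes S :: "'a measure" and k :: "'a \<Rightarrow> 'b \<Rightarrow> ennreal"
  assumes kernel_measurable [measurable]: "case_prod k \<in> borel_measurable (S \<Otimes>\<^sub>M M)"
    and kernel_mass: "u \<in> space S \<Longrightarrow> (\<integral>\<^sup>+x. k u x \<partial>M) = 1"
begin

definition push :: "'a measure \<Rightarrow> 'b measure"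
  where "push \<mu> = density M (\<lambda>x. \<integral>\<^sup>+u. k u x \<partial>\<mu>)"

lemma prob_space_kernel:
  assumes "u \<in> space S"
  shows "prob_space (density M (k u))"
proof
  have "k u \<in> borel_measurable M"
    using measurable_compose[OF measurable_Pair1'[OF assms] kernel_measurable] by simp
  then show "emeasure (density M (k u)) (space (density M (k u))) = 1"
    by (subst emeasure_density)
      (auto simp: kernel_mass[OF assms, symmetric] intro!: nn_integral_cong)
qed

lemma kernel_in_subprob_algebra: "(\<lambda>u. density M (k u)) \<in> S \<rightarrow>\<^sub>M subprob_algebra M"
proof (rule measurable_subprob_algebra)
  show "subprob_space (density M (k u))" if "u \<in> space S" for u
    using prob_space_kernel[OF that] by (rule prob_space_imp_subprob_space)
  fix A assume A [measurable]: "A \<in> sets M"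
  have "(\<lambda>u. \<integral>\<^sup>+x. k u x * indicator A x \<partial>M) \<in> borel_measurable S"
    by measurable
  moreover have "k u \<in> borel_measurable M" if "u \<in> space S" for u
    using measurable_compose[OF measurable_Pair1'[OF that] kernel_measurable] by simp
  ultimately show "(\<lambda>u. emeasure (density M (k u)) A) \<in> borel_measurable S"
    by (subst measurable_cong[where g = "\<lambda>u. \<integral>\<^sup>+x. k u x * indicator A x \<partial>M"])
      (auto simp: emeasure_density)
qed simp

context
  fixes \<mu>
  assumes \<mu>: "\<mu> \<in> space (prob_algebra S)"
begin

lemma nn_integral_push:
  assumes [measurable]: "F \<in> borel_measurable M"
  shows "(\<integral>\<^sup>+x. F x \<partial>push \<mu>) = (\<integral>\<^sup>+u. \<integral>\<^sup>+x. k u x * F x \<partial>M \<partial>\<mu>)"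
proof -
  interpret prob_space \<mu>
    using \<mu> by (simp add: space_prob_algebra)
  have [measurable_cong]: "sets \<mu> = sets S"
    using \<mu> by (simp add: space_prob_algebra)
  interpret pair_sigma_finite \<mu> M ..
  have k2: "(\<lambda>u. k u x) \<in> borel_measurable \<mu>" if "x \<in> space M" for x
    using that by measurable
  have "(\<integral>\<^sup>+x. F x \<partial>push \<mu>) = (\<integral>\<^sup>+x. (\<integral>\<^sup>+u. k u x \<partial>\<mu>) * F x \<partial>M)"
    unfolding push_def by (subst nn_integral_density) auto
  also have "\<dots> = (\<integral>\<^sup>+x. \<integral>\<^sup>+u. k u x * F x \<partial>\<mu> \<partial>M)"
    using k2 by (intro nn_integral_cong) (simp add: nn_integral_multc)
  also have "\<dots> = (\<integral>\<^sup>+u. \<integral>\<^sup>+x. k u x * F x \<partial>M \<partial>\<mu>)"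
    by (rule Fubini') measurable
  finally show ?thesis .
qed

text \<open>The definition of \<open>push\<close> integrates the densities, as the transfer
  operators do; the monadic form gives access to the disintegration formula for real-valued
  integrands, where the Tonelli argument of \<open>nn_integral_push\<close> does not apply
  directly.\<close>

lemma push_eq_bind: "push \<mu> = \<mu> \<bind> (\<lambda>u. density M (k u))"
proof (rule measure_eqI)
  have sets_mu: "sets \<mu> = sets S"
    using \<mu> by (simp add: space_prob_algebra)
  have ker: "(\<lambda>u. density M (k u)) \<in> \<mu> \<rightarrow>\<^sub>M subprob_algebra M"
    using kernel_in_subprob_algebra sets_mu by (simp cong: measurable_cong_sets)
  have ne: "space \<mu> \<noteq> {}"
    using \<mu> prob_space.not_empty by (auto simp: space_prob_algebra)
  show "sets (push \<mu>) = sets (\<mu> \<bind> (\<lambda>u. density M (k u)))"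
    using ne by (simp add: push_def sets_bind[OF sets_kernel[OF ker]])
  fix A assume "A \<in> sets (push \<mu>)"
  then have A [measurable]: "A \<in> sets M"
    by (simp add: push_def)
  have "emeasure (push \<mu>) A = (\<integral>\<^sup>+x. indicator A x \<partial>push \<mu>)"
    by (subst nn_integral_indicator) (auto simp: push_def A)
  also have "\<dots> = (\<integral>\<^sup>+u. \<integral>\<^sup>+x. k u x * indicator A x \<partial>M \<partial>\<mu>)"
    by (rule nn_integral_push) measurable
  also have "\<dots> = (\<integral>\<^sup>+u. emeasure (density M (k u)) A \<partial>\<mu>)"
  proof (rule nn_integral_cong)
    fix u assume "u \<in> space \<mu>"
    then have u: "u \<in> space S"
      using sets_eq_imp_space_eq[OF sets_mu] by simp
    have "k u \<in> borel_measurable M"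
      using measurable_compose[OF measurable_Pair1'[OF u] kernel_measurable] by simp
    then show "(\<integral>\<^sup>+x. k u x * indicator A x \<partial>M) = emeasure (density M (k u)) A"
      by (simp add: emeasure_density)
  qed
  also have "\<dots> = emeasure (\<mu> \<bind> (\<lambda>u. density M (k u))) A"
    by (rule emeasure_bind[symmetric, OF ne ker A])
  finally show "emeasure (push \<mu>) A = emeasure (\<mu> \<bind> (\<lambda>u. density M (k u))) A" .
qed

lemma push_in_prob_algebra: "push \<mu> \<in> space (prob_algebra M)"
proof -
  have sets_mu: "sets \<mu> = sets S" and "prob_space \<mu>"
    using \<mu> by (simp_all add: space_prob_algebra)
  interpret prob_space \<mu> by fact
  have "emeasure (push \<mu>) (space M) = (\<integral>\<^sup>+x. 1 \<partial>push \<mu>)"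
    by (simp add: push_def)
  also have "\<dots> = (\<integral>\<^sup>+u. \<integral>\<^sup>+x. k u x * 1 \<partial>M \<partial>\<mu>)"
    by (rule nn_integral_push) measurable
  also have "\<dots> = (\<integral>\<^sup>+u. 1 \<partial>\<mu>)"
    by (intro nn_integral_cong) (simp add: kernel_mass sets_eq_imp_space_eq[OF sets_mu])
  also have "\<dots> = 1"
    by (simp add: emeasure_space_1)
  finally have "prob_space (push \<mu>)"
    by (intro prob_spaceI) (simp add: push_def)
  then show ?thesis
    by (simp add: space_prob_algebra push_def)
qed

lemma integral_push:
  fixes g :: "'b \<Rightarrow> real"
  assumes g: "g \<in> borel_measurable M" and bd: "\<And>x. x \<in> space M \<Longrightarrow> \<bar>g x\<bar> \<le> B"
  shows "(\<integral>x. g x \<partial>push \<mu>) = (\<integral>u. \<integral>x. g x \<partial>density M (k u) \<partial>\<mu>)"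
    and "(\<lambda>u. \<integral>x. g x \<partial>density M (k u)) \<in> borel_measurable S"
proof -
  have sets_mu: "sets \<mu> = sets S" and "prob_space \<mu>"
    using \<mu> by (simp_all add: space_prob_algebra)
  interpret prob_space \<mu> by fact
  have ker: "(\<lambda>u. density M (k u)) \<in> \<mu> \<rightarrow>\<^sub>M subprob_algebra M"
    using kernel_in_subprob_algebra sets_mu by (simp cong: measurable_cong_sets)
  have "AE u in \<mu>. emeasure (density M (k u)) (space (density M (k u))) \<le> ennreal 1"
    using prob_space.emeasure_space_1[OF prob_space_kernel] sets_eq_imp_space_eq[OF sets_mu]
    by (intro AE_I2) simp
  from integral_bind[OF g bd ker finite_measure_axioms this]
  show "(\<integral>x. g x \<partial>push \<mu>) = (\<integral>u. \<integral>x. g x \<partial>density M (k u) \<partial>\<mu>)"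
    by (simp add: push_eq_bind)
  show "(\<lambda>u. \<integral>x. g x \<partial>density M (k u)) \<in> borel_measurable S"
    using measurable_compose[OF kernel_in_subprob_algebra integral_measurable_subprob_algebra[OF g]]
    by simp
qed

end

end

section \<open>Independent coordinates and exponential moments\<close>

text \<open>Resampling coordinate i independently leaves the expectation unchanged. After
  resampling, the integrand no longer sees the old coordinate i, so both sides reduce to the same
  integral over the remaining coordinates.\<close>

lemma (in product_prob_space) integral_PiM_coordinate:
  fixes F :: "('i \<Rightarrow> 'a) \<Rightarrow> real"
  assumes J: "finite J" "i \<in> J" and F [measurable]: "F \<in> borel_measurable (PiM J M)"
    and bd: "\<And>x. x \<in> space (PiM J M) \<Longrightarrow> \<bar>F x\<bar> \<le> B"
  shows "(\<integral>x. F x \<partial>PiM J M) = (\<integral>x. \<integral>y. F (x(i := y)) \<partial>M i \<partial>PiM J M)"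
    and "(\<lambda>x. \<integral>y. F (x(i := y)) \<partial>M i) \<in> borel_measurable (PiM J M)"
proof -
  let ?G = "\<lambda>x. \<integral>y. F (x(i := y)) \<partial>M i"
  interpret Q: prob_space "PiM J M"
    by (intro prob_space_PiM prob_space)
  have upd: "x(i := y) \<in> space (PiM J M)" if "x \<in> space (PiM J M)" "y \<in> space (M i)" for x y
    using that J by (auto simp: space_PiM PiE_iff extensional_def)
  have "(\<lambda>(x, y). F (x(i := y))) \<in> borel_measurable (PiM J M \<Otimes>\<^sub>M M i)"
    using J F by (auto simp: case_prod_beta' intro!: measurable_compose[OF measurable_fun_upd[where J = J] F])
  then show G [measurable]: "?G \<in> borel_measurable (PiM J M)"
    by (intro sigma_finite_measure.borel_measurable_lebesgue_integral)
      (auto simp: prob_space_imp_sigma_finite prob_space)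
  have G_bd: "\<bar>?G x\<bar> \<le> B" if "x \<in> space (PiM J M)" for x
  proof (rule abs_integral_le_bound[OF prob_space])
    show "(\<lambda>y. F (x(i := y))) \<in> borel_measurable (M i)"
      using that J by (intro measurable_compose[OF measurable_fun_upd F]) auto
  qed (use bd upd that in auto)
  have J': "insert i (J - {i}) = J" "finite (J - {i})" "i \<notin> J - {i}"
    using J by auto
  have "(\<integral>x. ?G x \<partial>PiM J M) = (\<integral>x. \<integral>z. ?G (x(i := z)) \<partial>M i \<partial>PiM (J - {i}) M)"
    using product_integral_insert[OF J'(2,3), of ?G] integrable_bounded[OF Q.finite_measure_axioms G G_bd] J'(1)
    by simp
  also have "\<dots> = (\<integral>x. ?G x \<partial>PiM (J - {i}) M)"
    by (simp add: prob_space.prob_space[OF prob_space])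
  also have "\<dots> = (\<integral>x. F x \<partial>PiM J M)"
    using product_integral_insert[OF J'(2,3), of F] integrable_bounded[OF Q.finite_measure_axioms F bd] J'(1)
    by simp
  finally show "(\<integral>x. F x \<partial>PiM J M) = (\<integral>x. ?G x \<partial>PiM J M)"
    by simp
qed


text \<open>Hoeffding's lemma, phrased by oscillation instead of a given interval. It is available
  for positive parameters, and a negative one is handled by passing from f to -f.\<close>

lemma bounded_oscillation_mgf:
  fixes f :: "'a \<Rightarrow> real"
  assumes M: "prob_space M" and f: "f \<in> borel_measurable M"
    and osc: "\<And>x y. x \<in> space M \<Longrightarrow> y \<in> space M \<Longrightarrow> \<bar>f x - f y\<bar> \<le> L"
  shows "(\<integral>x. exp (l * (f x - (\<integral>y. f y \<partial>M))) \<partial>M) \<le> exp (l\<^sup>2 / 8 * L\<^sup>2)"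
proof -
  interpret prob_space M by fact
  obtain x0 where x0: "x0 \<in> space M"
    using not_empty by blast
  have pos: "(\<integral>x. exp (r * (g x - (\<integral>y. g y \<partial>M))) \<partial>M) \<le> exp (r\<^sup>2 / 8 * L\<^sup>2)"
    if r: "0 < r" and g: "g \<in> borel_measurable M"
      and osc_g: "\<And>x y. x \<in> space M \<Longrightarrow> y \<in> space M \<Longrightarrow> \<bar>g x - g y\<bar> \<le> L"
    for r and g :: "'a \<Rightarrow> real"
  proof -
    \<comment> \<open>The exact range has length at most L. The interval of radius L around
      \<open>g x0\<close> would have length 2 L and cost a factor 4 in the exponent.\<close>
    define a b where "a = (INF x\<in>space M. g x)" and "b = (SUP x\<in>space M. g x)"
    have lower: "g x0 - L \<le> g x" and upper: "g x \<le> g x0 + L" if "x \<in> space M" for x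
      using osc_g[OF x0 that] by auto
    have bdd: "bdd_below (g ` space M)" "bdd_above (g ` space M)"
      using lower upper by (auto intro!: bdd_belowI2 bdd_aboveI2)
    have range: "a \<le> g x" "g x \<le> b" if "x \<in> space M" for x
      using that bdd by (auto simp: a_def b_def intro: cINF_lower cSUP_upper)
    have "b \<le> g x + L" if "x \<in> space M" for x
      unfolding b_def using not_empty osc_g that by (intro cSUP_least) fastforce+
    then have "b - L \<le> a"
      unfolding a_def using not_empty by (intro cINF_greatest) (auto simp: algebra_simps)
    moreover have "a \<le> b"
      using range[OF x0] by simp
    ultimately have ba: "(b - a)\<^sup>2 \<le> L\<^sup>2"
      by (intro power_mono) auto
    interpret interval_bounded_random_variable M g a b
      by unfold_locales (use g range in auto)
    have "(\<integral>\<^sup>+x. exp (r * (g x - expectation g)) \<partial>M) \<le> ennreal (exp (r\<^sup>2 * (b - a)\<^sup>2 / 8))"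
      by (rule Hoeffdings_lemma_nn_integral[OF r])
    then have "(\<integral>x. exp (r * (g x - expectation g)) \<partial>M) \<le> exp (r\<^sup>2 * (b - a)\<^sup>2 / 8)"
      using g by (subst integral_eq_nn_integral) (auto intro!: enn2real_leI)
    also have "\<dots> \<le> exp (r\<^sup>2 / 8 * L\<^sup>2)"
      using ba by (simp add: mult_left_mono)
    finally show ?thesis .
  qed
  consider "l = 0" | "0 < l" | "0 < - l"
    by linarith
  then show ?thesis
  proof cases
    case 2
    then show ?thesis
      by (intro pos f osc)
  next
    case 3
    have "(\<integral>x. exp (- l * (- f x - (\<integral>y. - f y \<partial>M))) \<partial>M) \<le> exp ((- l)\<^sup>2 / 8 * L\<^sup>2)"
      using f osc by (intro pos[OF 3]) (auto simp: abs_minus_commute)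
    then show ?thesis
      by (simp add: algebra_simps)
  qed (simp add: prob_space)
qed

text \<open>The exponential moment form of McDiarmid's inequality. Integrating out coordinate i
  leaves the conditional mean G, which inherits the difference bounds in the other coordinates; the
  deviation of g from G is controlled by the one-variable bound with constant L i.\<close>

lemma (in product_prob_space) bounded_differences_mgf:
  fixes g :: "('i \<Rightarrow> 'a) \<Rightarrow> real"
  assumes "finite J" "g \<in> borel_measurable (PiM J M)"
    and "\<And>x. x \<in> space (PiM J M) \<Longrightarrow> \<bar>g x\<bar> \<le> B"
    and "\<And>i x y y'. i \<in> J \<Longrightarrow> x \<in> space (PiM J M) \<Longrightarrow> y \<in> space (M i) \<Longrightarrow> y' \<in> space (M i) \<Longrightarrow>
      \<bar>g (x(i := y)) - g (x(i := y'))\<bar> \<le> L i"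
  shows "(\<integral>x. exp (l * (g x - (\<integral>y. g y \<partial>PiM J M))) \<partial>PiM J M) \<le> exp (l\<^sup>2 / 8 * (\<Sum>i\<in>J. (L i)\<^sup>2))"
  using assms
proof (induction J arbitrary: g rule: finite_induct)
  case empty
  then show ?case
    by (simp add: PiM_empty lebesgue_integral_count_space_finite)
next
  case (insert i J)
  note g [measurable] = \<open>g \<in> borel_measurable (PiM (insert i J) M)\<close> and g_bd = insert.prems(2) and osc = insert.prems(3)
  interpret Q: prob_space "PiM J M"
    by (intro prob_space_PiM prob_space)
  interpret Q': prob_space "PiM (insert i J) M"
    by (intro prob_space_PiM prob_space)
  have upd: "x(i := y) \<in> space (PiM (insert i J) M)" if "x \<in> space (PiM J M)" "y \<in> space (M i)" for x y
    using that by (auto simp: space_PiM PiE_iff extensional_def)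
  define G where "G x = (\<integral>y. g (x(i := y)) \<partial>M i)" for x
  define m where "m = (\<integral>x. g x \<partial>PiM (insert i J) M)"
  have g_i [measurable]: "(\<lambda>y. g (x(i := y))) \<in> borel_measurable (M i)" if "x \<in> space (PiM J M)" for x
    using that insert.hyps by (intro measurable_compose[OF measurable_component_update g])
  have g_i_int: "integrable (M i) (\<lambda>y. g (x(i := y)))" if "x \<in> space (PiM J M)" for x
    using that by (intro integrable_bounded[OF _ g_i, of _ B] g_bd upd) (auto simp: prob_space.finite_measure prob_space)
  have "(\<lambda>(x, y). g (x(i := y))) \<in> borel_measurable (PiM J M \<Otimes>\<^sub>M M i)"
    using measurable_compose[OF measurable_add_dim g] by (simp add: case_prod_beta')
  then have G_meas [measurable]: "G \<in> borel_measurable (PiM J M)"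
    unfolding G_def by (intro sigma_finite_measure.borel_measurable_lebesgue_integral)
      (auto simp: prob_space_imp_sigma_finite prob_space)
  have G_bd: "\<bar>G x\<bar> \<le> B" if "x \<in> space (PiM J M)" for x
    unfolding G_def by (rule abs_integral_le_bound[OF prob_space g_i[OF that]]) (intro g_bd upd that)
  have G_osc: "\<bar>G (x(j := y)) - G (x(j := y'))\<bar> \<le> L j"
    if "j \<in> J" "x \<in> space (PiM J M)" "y \<in> space (M j)" "y' \<in> space (M j)" for j x y y'
  proof -
    have x: "x(j := z) \<in> space (PiM J M)" if "z \<in> space (M j)" for z
      using \<open>x \<in> _\<close> \<open>j \<in> J\<close> that by (auto simp: space_PiM PiE_iff extensional_def)
    have "j \<noteq> i"
      using that insert.hyps by auto
    have "G (x(j := y)) - G (x(j := y')) = (\<integral>z. g (x(j := y, i := z)) - g (x(j := y', i := z)) \<partial>M i)"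
      unfolding G_def using that by (intro Bochner_Integration.integral_diff[symmetric] g_i_int x)
    also have "\<bar>\<dots>\<bar> \<le> L j"
    proof (rule abs_integral_le_bound[OF prob_space])
      show "(\<lambda>z. g (x(j := y, i := z)) - g (x(j := y', i := z))) \<in> borel_measurable (M i)"
        using that by (intro borel_measurable_diff g_i x)
      show "\<bar>g (x(j := y, i := z)) - g (x(j := y', i := z))\<bar> \<le> L j" if "z \<in> space (M i)" for z
        unfolding fun_upd_twist[OF \<open>j \<noteq> i\<close>]
        using that \<open>j \<in> J\<close> \<open>x \<in> _\<close> \<open>y \<in> _\<close> \<open>y' \<in> _\<close> by (intro osc upd) auto
    qed
    finally show ?thesis .
  qed
  have m: "m = (\<integral>x. G x \<partial>PiM J M)"
    unfolding m_def G_def using insert.hyps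
    by (intro product_integral_insert integrable_bounded[OF Q'.finite_measure_axioms g g_bd])
  have exp_bd: "\<bar>exp (l * (z - m))\<bar> \<le> exp (\<bar>l\<bar> * (B + \<bar>m\<bar>))" if "\<bar>z\<bar> \<le> B" for z
  proof -
    have "l * (z - m) \<le> \<bar>l\<bar> * \<bar>z - m\<bar>"
      by (simp add: abs_mult[symmetric])
    also have "\<dots> \<le> \<bar>l\<bar> * (B + \<bar>m\<bar>)"
      using that by (intro mult_left_mono) auto
    finally show ?thesis by simp
  qed
  have "(\<integral>x. exp (l * (g x - m)) \<partial>PiM (insert i J) M)
      = (\<integral>x. \<integral>y. exp (l * (g (x(i := y)) - m)) \<partial>M i \<partial>PiM J M)"
    using insert.hyps g_bd exp_bd
    by (intro product_integral_insert integrable_bounded[OF Q'.finite_measure_axioms]) auto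
  \<comment> \<open>The exponent is split at the conditional mean, so that the inner integral is
    centred.\<close>
  also have "\<dots> = (\<integral>x. exp (l * (G x - m)) * (\<integral>y. exp (l * (g (x(i := y)) - G x)) \<partial>M i) \<partial>PiM J M)"
    by (simp add: exp_add[symmetric] algebra_simps flip: integral_mult_right_zero)
  also have "\<dots> \<le> (\<integral>x. exp (l * (G x - m)) * exp (l\<^sup>2 / 8 * (L i)\<^sup>2) \<partial>PiM J M)"
  proof (rule integral_mono')
    show "integrable (PiM J M) (\<lambda>x. exp (l * (G x - m)) * exp (l\<^sup>2 / 8 * (L i)\<^sup>2))"
      using G_bd exp_bd
      by (intro integrable_mult_left integrable_bounded[OF Q.finite_measure_axioms]) auto
    show "exp (l * (G x - m)) * (\<integral>y. exp (l * (g (x(i := y)) - G x)) \<partial>M i)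
        \<le> exp (l * (G x - m)) * exp (l\<^sup>2 / 8 * (L i)\<^sup>2)" if x: "x \<in> space (PiM J M)" for x
    proof (rule mult_left_mono)
      show "(\<integral>y. exp (l * (g (x(i := y)) - G x)) \<partial>M i) \<le> exp (l\<^sup>2 / 8 * (L i)\<^sup>2)"
        unfolding G_def
      proof (rule bounded_oscillation_mgf[OF prob_space g_i[OF x]])
        \<comment> \<open>Here x lies in the smaller product. A base point of the full product is
          \<open>x(i := y)\<close>, whose coordinate i is overwritten anyway.\<close>
        show "\<bar>g (x(i := y)) - g (x(i := y'))\<bar> \<le> L i" if "y \<in> space (M i)" "y' \<in> space (M i)" for y y'
          using osc[OF _ upd[OF x that(1)] that] by (simp only: fun_upd_upd insertI1 True_implies_equals)
      qed
    qed simp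
  qed simp
  also have "\<dots> = exp (l\<^sup>2 / 8 * (L i)\<^sup>2) * (\<integral>x. exp (l * (G x - (\<integral>x. G x \<partial>PiM J M))) \<partial>PiM J M)"
    by (simp add: m mult.commute)
  also have "\<dots> \<le> exp (l\<^sup>2 / 8 * (L i)\<^sup>2) * exp (l\<^sup>2 / 8 * (\<Sum>i\<in>J. (L i)\<^sup>2))"
    using insert.IH[OF G_meas G_bd G_osc] by simp
  also have "\<dots> = exp (l\<^sup>2 / 8 * (\<Sum>i\<in>insert i J. (L i)\<^sup>2))"
    using insert.hyps by (simp add: exp_add[symmetric] algebra_simps add_divide_distrib)
  finally show ?case
    by (simp add: m_def)
qed

section \<open>Invariant measures of kernels bounded below\<close>

text \<open>Write k = \<epsilon> + s with s nonnegative: at each step the chain restarts from M with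
  probability \<epsilon> and otherwise moves by s. Decomposing according to the time since the last
  restart gives the invariant density as a series with terms of mass \<epsilon> (1 - \<epsilon>)^n.
  Every invariant density dominates this series and has the same total mass, which gives
  uniqueness.\<close>

lemma doeblin_fixed_point:
  fixes \<epsilon> :: ennreal
  assumes k: "density_kernel M M k" and \<epsilon>: "0 < \<epsilon>"
    and minor: "\<And>u x. u \<in> space M \<Longrightarrow> x \<in> space M \<Longrightarrow> \<epsilon> \<le> k u x"
  shows "\<exists>!\<mu>. \<mu> \<in> space (prob_algebra M) \<and> density_kernel.push M k \<mu> = \<mu>"
proof -
  interpret density_kernel M M k by fact
  interpret MM: pair_sigma_finite M M ..
  obtain u0 where u0: "u0 \<in> space M"
    using reference.not_empty by blast
  have "(\<integral>\<^sup>+x. \<epsilon> \<partial>M) \<le> (\<integral>\<^sup>+x. k u0 x \<partial>M)"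
    using minor u0 by (intro nn_integral_mono)
  then have \<epsilon>_le: "\<epsilon> \<le> 1"
    using kernel_mass[OF u0] by (simp add: reference.emeasure_space_1)
  then obtain e where e: "\<epsilon> = ennreal e" "0 < e" "e \<le> 1"
    using \<epsilon> by (cases \<epsilon>) (auto simp: ennreal_le_1 top_unique)
  define s where "s u x = k u x - \<epsilon>" for u x
  have s_meas [measurable]: "case_prod s \<in> borel_measurable (M \<Otimes>\<^sub>M M)"
    unfolding s_def by measurable
  have k_eq: "k u x = \<epsilon> + s u x" if "u \<in> space M" "x \<in> space M" for u x
    using minor[OF that] by (simp add: s_def add.commute[of \<epsilon>] diff_add_cancel_ennreal)
  have s_mass: "(\<integral>\<^sup>+x. s u x \<partial>M) = 1 - \<epsilon>" if u: "u \<in> space M" for u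
    unfolding s_def
    using measurable_compose[OF measurable_Pair1'[OF u] kernel_measurable] e(1) minor u
    by (subst nn_integral_diff) (auto simp: kernel_mass reference.emeasure_space_1 intro: AE_I2)
  \<comment> \<open>\<open>d n\<close> is the part of the invariant density whose last restart
    happened n steps ago.\<close>
  define d where "d = rec_nat (\<lambda>_. \<epsilon>) (\<lambda>_ f x. \<integral>\<^sup>+u. s u x * f u \<partial>M)"
  have d_0: "d 0 = (\<lambda>_. \<epsilon>)" and d_Suc: "d (Suc n) = (\<lambda>x. \<integral>\<^sup>+u. s u x * d n u \<partial>M)" for n
    by (simp_all add: d_def)
  have d_meas [measurable]: "d n \<in> borel_measurable M" for n
    by (induction n) (simp_all add: d_0 d_Suc)
  have d_mass: "(\<integral>\<^sup>+x. d n x \<partial>M) = ennreal (e * (1 - e) ^ n)" for n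
  proof (induction n)
    case (Suc n)
    have "(\<integral>\<^sup>+x. d (Suc n) x \<partial>M) = (\<integral>\<^sup>+u. \<integral>\<^sup>+x. s u x * d n u \<partial>M \<partial>M)"
      unfolding d_Suc by (rule MM.Fubini') measurable
    also have "\<dots> = (\<integral>\<^sup>+u. (1 - \<epsilon>) * d n u \<partial>M)"
    proof (rule nn_integral_cong)
      fix u assume u: "u \<in> space M"
      have "s u \<in> borel_measurable M"
        using measurable_compose[OF measurable_Pair1'[OF u] s_meas] by simp
      then show "(\<integral>\<^sup>+x. s u x * d n u \<partial>M) = (1 - \<epsilon>) * d n u"
        by (simp add: nn_integral_multc s_mass[OF u])
    qed
    also have "\<dots> = ennreal (1 - e) * ennreal (e * (1 - e) ^ n)"
      using e by (simp add: nn_integral_cmult Suc.IH ennreal_minus flip: ennreal_1)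
    also have "\<dots> = ennreal (e * (1 - e) ^ Suc n)"
      using e by (subst ennreal_mult[symmetric]) (auto simp: algebra_simps)
    finally show ?case .
  qed (simp add: d_0 e reference.emeasure_space_1)
  define D where "D x = (\<Sum>n. d n x)" for x
  have D_meas [measurable]: "D \<in> borel_measurable M"
    unfolding D_def by measurable
  have D_mass: "(\<integral>\<^sup>+x. D x \<partial>M) = 1"
  proof -
    have "(\<lambda>n. e * (1 - e) ^ n) sums (e * (1 / (1 - (1 - e))))"
      using e by (intro sums_mult geometric_sums) auto
    then have geo: "(\<lambda>n. e * (1 - e) ^ n) sums 1"
      using e by simp
    have "(\<integral>\<^sup>+x. D x \<partial>M) = (\<Sum>n. ennreal (e * (1 - e) ^ n))"
      unfolding D_def by (subst nn_integral_suminf) (auto simp: d_mass)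
    also have "\<dots> = ennreal (\<Sum>n. e * (1 - e) ^ n)"
      using e geo by (intro suminf_ennreal2) (auto dest: sums_summable)
    finally show ?thesis
      using geo by (simp add: sums_iff)
  qed
  have s_D: "(\<integral>\<^sup>+u. s u x * D u \<partial>M) = (\<Sum>n. d (Suc n) x)" if "x \<in> space M" for x
  proof -
    have [measurable]: "(\<lambda>u. s u x) \<in> borel_measurable M"
      using measurable_compose[OF measurable_Pair2'[OF that] s_meas] by simp
    have "(\<integral>\<^sup>+u. s u x * D u \<partial>M) = (\<integral>\<^sup>+u. (\<Sum>n. s u x * d n u) \<partial>M)"
      unfolding D_def by simp
    also have "\<dots> = (\<Sum>n. \<integral>\<^sup>+u. s u x * d n u \<partial>M)"
      by (intro nn_integral_suminf) measurable
    finally show ?thesis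
      by (simp add: d_Suc)
  qed
  \<comment> \<open>Dropping the first term of the series is the invariance equation: the restart
    contributes \<epsilon>, and one move by s shifts the remaining terms.\<close>
  have D_split: "D x = \<epsilon> + (\<Sum>n. d (Suc n) x)" for x
    using sums_Suc[OF summable_sums[OF summableI, of "\<lambda>n. d (Suc n) x"]]
    by (simp add: D_def sums_iff d_0 add.commute)
  show ?thesis
  proof (rule ex1I[of _ "density M D"], intro conjI)
    interpret D: prob_space "density M D"
      by (rule prob_spaceI) (simp add: emeasure_density D_mass cong: nn_integral_cong_simp)
    show "density M D \<in> space (prob_algebra M)"
      using D.prob_space_axioms by (simp add: space_prob_algebra)
    show "push (density M D) = density M D"
      unfolding push_def
    proof (rule density_cong)
      show "(\<lambda>x. \<integral>\<^sup>+u. k u x \<partial>density M D) \<in> borel_measurable M"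
        by measurable
      show "AE x in M. (\<integral>\<^sup>+u. k u x \<partial>density M D) = D x"
      proof (rule AE_I2)
        fix x assume x: "x \<in> space M"
        have [measurable]: "(\<lambda>u. s u x) \<in> borel_measurable M" "(\<lambda>u. k u x) \<in> borel_measurable M"
          using measurable_compose[OF measurable_Pair2'[OF x] s_meas]
            measurable_compose[OF measurable_Pair2'[OF x] kernel_measurable] by simp_all
        have "(\<integral>\<^sup>+u. k u x \<partial>density M D) = (\<integral>\<^sup>+u. \<epsilon> * D u + s u x * D u \<partial>M)"
          using x by (subst nn_integral_density) (auto simp: k_eq distrib_left mult.commute intro!: nn_integral_cong)
        also have "\<dots> = \<epsilon> + (\<integral>\<^sup>+u. s u x * D u \<partial>M)"
          by (simp add: nn_integral_add nn_integral_cmult D_mass)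
        finally show "(\<integral>\<^sup>+u. k u x \<partial>density M D) = D x"
          unfolding D_split[of x] by (simp add: s_D x)
      qed
    qed measurable
  next
    fix \<mu> assume "\<mu> \<in> space (prob_algebra M) \<and> push \<mu> = \<mu>"
    then have \<mu>: "prob_space \<mu>" "sets \<mu> = sets M" and push: "push \<mu> = \<mu>"
      by (auto simp: space_prob_algebra)
    interpret \<mu>: prob_space \<mu> by fact
    note [measurable_cong] = \<mu>(2)
    \<comment> \<open>The image of any measure under the kernel has a density, so an invariant
      measure has one too, and comparing densities suffices.\<close>
    define E where "E x = (\<integral>\<^sup>+u. k u x \<partial>\<mu>)" for x
    have E_meas [measurable]: "E \<in> borel_measurable M"
      unfolding E_def by measurable
    have \<mu>_E: "\<mu> = density M E"
      using push by (simp add: push_def E_def[abs_def])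
    have E_mass: "(\<integral>\<^sup>+x. E x \<partial>M) = 1"
      using \<mu>.emeasure_space_1 by (subst (asm) (1 2) \<mu>_E) (simp add: emeasure_density cong: nn_integral_cong_simp)
    have E_eq: "E x = \<epsilon> + (\<integral>\<^sup>+u. s u x * E u \<partial>M)" if x: "x \<in> space M" for x
    proof -
      have [measurable]: "(\<lambda>u. s u x) \<in> borel_measurable M" "(\<lambda>u. k u x) \<in> borel_measurable M"
        using measurable_compose[OF measurable_Pair2'[OF x] s_meas]
          measurable_compose[OF measurable_Pair2'[OF x] kernel_measurable] by simp_all
      have "E x = (\<integral>\<^sup>+u. \<epsilon> * E u + s u x * E u \<partial>M)"
        unfolding E_def[of x] using x
        by (subst \<mu>_E, subst nn_integral_density)
          (auto simp: k_eq distrib_left mult.commute intro!: nn_integral_cong)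
      then show ?thesis
        by (simp add: nn_integral_add nn_integral_cmult E_mass)
    qed
    \<comment> \<open>Iterating the equation for E produces the terms of the series and a
      nonnegative remainder.\<close>
    have partial: "(\<Sum>j<n. d j x) \<le> E x" if "x \<in> space M" for n x
      using that
    proof (induction n arbitrary: x)
      case (Suc n)
      have [measurable]: "(\<lambda>u. s u x) \<in> borel_measurable M"
        using measurable_compose[OF measurable_Pair2'[OF Suc.prems] s_meas] by simp
      have "(\<Sum>j<Suc n. d j x) = \<epsilon> + (\<Sum>j<n. d (Suc j) x)"
        by (simp only: sum.lessThan_Suc_shift d_0)
      also have "\<dots> = \<epsilon> + (\<integral>\<^sup>+u. s u x * (\<Sum>j<n. d j u) \<partial>M)"
        by (simp add: d_Suc nn_integral_sum sum_distrib_left)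
      also have "\<dots> \<le> E x"
        unfolding E_eq[OF Suc.prems]
        by (intro add_left_mono nn_integral_mono mult_left_mono Suc.IH) auto
      finally show ?case .
    qed simp
    have D_le: "D x \<le> E x" if "x \<in> space M" for x
      using partial[OF that] unfolding D_def by (simp add: suminf_eq_SUP SUP_least)
    \<comment> \<open>Both densities have mass 1, which turns the pointwise inequality into equality
      almost everywhere.\<close>
    have "(\<integral>\<^sup>+x. E x - D x \<partial>M) = 0"
      using D_le by (subst nn_integral_diff) (auto simp: D_mass E_mass intro: AE_I2)
    then have "AE x in M. E x - D x = 0"
      by (subst (asm) nn_integral_0_iff_AE) auto
    moreover have "AE x in M. D x < \<infinity>"
      using nn_integral_PInf_AE[of D M] by (auto simp: D_mass less_top)
    ultimately have "AE x in M. E x = D x"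
      using AE_space
    proof eventually_elim
      case (elim x)
      then show ?case
        using D_le[of x] by (metis diff_eq_0_iff_ennreal infinity_ennreal_def order.antisym order.strict_implies_not_eq diff_gt_0_iff_gt_ennreal not_le less_le)
    qed
    then show "\<mu> = density M D"
      unfolding \<mu>_E by (intro density_cong) auto
  qed
qed

section \<open>The law of a noisy point\<close>

lemma sets_circle_lebesgue [simp, measurable_cong]: "sets circle_lebesgue = sets borel"
  by (simp add: circle_lebesgue_def)

lemma space_circle_lebesgue [simp]: "space circle_lebesgue = UNIV"
  by (simp add: circle_lebesgue_def)

lemma prob_space_unit_interval: "prob_space (restrict_space lborel {0..<1 :: real})"
  by (intro prob_space_restrict_space) auto

text \<open>With t the fractional part of z, the shifted interval [t, 1 + t) is cut at 1 and the
  piece beyond 1 is moved back by one period.\<close>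

lemma nn_integral_periodic_shift:
  fixes F :: "real \<Rightarrow> ennreal"
  assumes F [measurable]: "F \<in> borel_measurable borel" and per: "\<And>x m. F (x + of_int m) = F x"
  shows "(\<integral>\<^sup>+x\<in>{0..<1}. F (x + z) \<partial>lborel) = (\<integral>\<^sup>+x\<in>{0..<1}. F x \<partial>lborel)"
proof -
  obtain t where t: "t = frac z" "0 \<le> t" "t < 1"
    by (simp add: frac_lt_1)
  have "F (x + z) = F (t + x)" for x
    using per[of "t + x" "\<lfloor>z\<rfloor>"] by (simp add: t(1) frac_def algebra_simps)
  then have "(\<integral>\<^sup>+x\<in>{0..<1}. F (x + z) \<partial>lborel)
      = (\<integral>\<^sup>+x. F (t + x) * indicator {t..<1 + t} (t + x) \<partial>lborel)"
    by (intro nn_integral_cong) (auto simp: indicator_def)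
  also have "\<dots> = (\<integral>\<^sup>+x. F x * indicator {t..<1 + t} x \<partial>lborel)"
    by (subst nn_integral_real_affine[where c = 1 and t = "t"]) auto
  also have "\<dots> = (\<integral>\<^sup>+x. F x * indicator {t..<1} x + F x * indicator {1..<1 + t} x \<partial>lborel)"
    using t(2,3) by (intro nn_integral_cong) (auto simp: indicator_def)
  also have "\<dots> = (\<integral>\<^sup>+x. F x * indicator {t..<1} x \<partial>lborel)
      + (\<integral>\<^sup>+x. F x * indicator {1..<1 + t} x \<partial>lborel)"
    by (intro nn_integral_add) auto
  also have "(\<integral>\<^sup>+x. F x * indicator {1..<1 + t} x \<partial>lborel)
      = (\<integral>\<^sup>+x. F (1 + x) * indicator {1..<1 + t} (1 + x) \<partial>lborel)"
    by (subst nn_integral_real_affine[where c = 1 and t = 1]) auto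
  also have "\<dots> = (\<integral>\<^sup>+x. F x * indicator {0..<t} x \<partial>lborel)"
    using per[of _ 1] by (intro nn_integral_cong) (auto simp: indicator_def add.commute)
  also have "(\<integral>\<^sup>+x. F x * indicator {t..<1} x \<partial>lborel) + \<dots>
      = (\<integral>\<^sup>+x. F x * indicator {t..<1} x + F x * indicator {0..<t} x \<partial>lborel)"
    by (intro nn_integral_add[symmetric]) auto
  also have "\<dots> = (\<integral>\<^sup>+x\<in>{0..<1}. F x \<partial>lborel)"
    using t(2,3) by (intro nn_integral_cong) (auto simp: indicator_def)
  finally show ?thesis .
qed

lemma nn_integral_circle_lebesgue:
  assumes "F \<in> borel_measurable borel"
  shows "(\<integral>\<^sup>+a. F a \<partial>circle_lebesgue) = (\<integral>\<^sup>+x\<in>{0..<1}. F (to_circle x) \<partial>lborel)"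
proof -
  have "to_circle \<in> restrict_space lborel {0..<1} \<rightarrow>\<^sub>M borel"
    by (intro measurable_restrict_space1) simp
  then show ?thesis
    unfolding circle_lebesgue_def using assms
    by (subst nn_integral_distr) (auto simp: nn_integral_restrict_space)
qed

lemma to_circle_add_of_int: "to_circle (x + of_int m) = to_circle x"
  by (simp add: to_circle_eq_iff)

lemma measurable_frac [measurable]: "(frac :: real \<Rightarrow> real) \<in> borel_measurable borel"
  unfolding frac_def by measurable

lemma periodic_ext_add_of_int [simp]: "periodic_ext p (x + of_int m) = periodic_ext p x"
  by (simp add: periodic_ext_def frac_def)

lemma measurable_periodic_ext:
  assumes "prob_density_on_unit p"
  shows "periodic_ext p \<in> borel_measurable borel"
proof -
  have "(\<lambda>x. indicator {0..1} x *\<^sub>R p x) \<in> borel_measurable borel"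
    using assms by (simp add: prob_density_on_unit_def set_borel_measurable_def)
  then have "(\<lambda>x. indicator {0..1} (frac x) *\<^sub>R p (frac x)) \<in> borel_measurable borel"
    by (rule measurable_compose[OF measurable_frac])
  also have "(\<lambda>x. indicator {0..1} (frac x) *\<^sub>R p (frac x)) = periodic_ext p"
    by (auto simp: fun_eq_iff periodic_ext_def indicator_def frac_lt_1 less_imp_le)
  finally show ?thesis .
qed

locale noise =
  fixes p :: "real \<Rightarrow> real" and c :: real
  assumes density: "prob_density_on_unit p" and c_pos: "0 < c" and c_less: "x \<in> {0..1} \<Longrightarrow> c < p x"
begin

lemma measurable_p [measurable]: "periodic_ext p \<in> borel_measurable borel"
  by (rule measurable_periodic_ext[OF density])

lemma p_gt: "c < periodic_ext p x"
  using frac_lt_1[of x] by (simp add: periodic_ext_def c_less)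

lemma p_nonneg: "0 \<le> periodic_ext p x"
  using p_gt[of x] c_pos by simp

lemma nn_integral_p: "(\<integral>\<^sup>+x\<in>{0..<1}. ennreal (periodic_ext p x) \<partial>lborel) = 1"
proof -
  have "AE x in lborel. x \<noteq> (1::real)"
    by (rule AE_lborel_singleton)
  then have "(\<integral>\<^sup>+x\<in>{0..<1}. ennreal (periodic_ext p x) \<partial>lborel) = (\<integral>\<^sup>+x\<in>{0..1}. ennreal (p x) \<partial>lborel)"
    by (intro nn_integral_cong_AE) (auto simp: periodic_ext_def indicator_def frac_eq)
  then show ?thesis
    using density by (simp add: prob_density_on_unit_def)
qed

definition noise_measure :: "real measure"
  where "noise_measure = density (restrict_space lborel {0..<1}) (\<lambda>x. ennreal (periodic_ext p x))"

lemma measurable_p_restrict: "periodic_ext p \<in> borel_measurable (restrict_space lborel A)"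
  by (intro measurable_restrict_space1) simp

lemma c_le_1: "c \<le> 1"
proof -
  have "ennreal c = (\<integral>\<^sup>+x\<in>{0..<1::real}. ennreal c \<partial>lborel)"
    by (subst nn_integral_cmult_indicator) auto
  also have "\<dots> \<le> (\<integral>\<^sup>+x\<in>{0..<1}. ennreal (periodic_ext p x) \<partial>lborel)"
    using p_gt by (intro nn_integral_mono mult_right_mono ennreal_leI) (auto intro: less_imp_le)
  also have "\<dots> = 1"
    by (rule nn_integral_p)
  finally show ?thesis
    by simp
qed

lemma measurable_noise_measure:
  fixes g :: "real \<Rightarrow> 'a::topological_space"
  assumes "g \<in> borel_measurable borel"
  shows "g \<in> borel_measurable noise_measure"
  using assms by (simp add: noise_measure_def measurable_restrict_space1)

text \<open>The distribution on the circle of z plus noise, in the density form in which the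
  transfer operators are written.\<close>

definition law :: "real \<Rightarrow> circle measure"
  where "law z = density circle_lebesgue (\<lambda>x. ennreal (periodic_ext p (circle_coord x - z)))"

lemma sets_law [simp, measurable_cong]: "sets (law z) = sets borel"
  by (simp add: law_def)

lemma space_law [simp]: "space (law z) = UNIV"
  by (simp add: law_def)

text \<open>Translation invariance of the uniform law: this is why the uniform component of the
  noise forgets the drift.\<close>

lemma circle_lebesgue_eq_distr:
  "circle_lebesgue = distr (restrict_space lborel {0..<1}) borel (\<lambda>x. to_circle (x + z))"
proof (rule measure_eqI)
  fix A assume "A \<in> sets circle_lebesgue"
  then have A [measurable]: "A \<in> sets borel"
    by simp
  have m: "(\<lambda>x. to_circle (x + z)) \<in> restrict_space lborel {0..<1} \<rightarrow>\<^sub>M borel"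
    by (intro measurable_restrict_space1) measurable
  have "emeasure circle_lebesgue A = (\<integral>\<^sup>+x\<in>{0..<1}. indicator A (to_circle x) \<partial>lborel)"
    using nn_integral_circle_lebesgue[of "indicator A"] by simp
  also have "\<dots> = (\<integral>\<^sup>+x\<in>{0..<1}. indicator A (to_circle (x + z)) \<partial>lborel)"
    by (rule nn_integral_periodic_shift[symmetric]) (auto simp: to_circle_add_of_int)
  also have "\<dots> = (\<integral>\<^sup>+a. indicator A a \<partial>distr (restrict_space lborel {0..<1}) borel (\<lambda>x. to_circle (x + z)))"
    by (subst nn_integral_distr[OF m]) (auto simp: nn_integral_restrict_space)
  finally show "emeasure circle_lebesgue A = emeasure (distr (restrict_space lborel {0..<1}) borel (\<lambda>x. to_circle (x + z))) A"
    by simp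
qed simp

text \<open>All laws are translates of one and the same noise. This couples the laws for different z
  through a common noise variable, under which the two outcomes are at distance at most the
  difference of the drifts.\<close>

lemma law_eq_distr: "law z = distr noise_measure borel (\<lambda>x. to_circle (x + z))"
proof (rule measure_eqI)
  fix A assume "A \<in> sets (law z)"
  then have A [measurable]: "A \<in> sets borel"
    by simp
  have m: "(\<lambda>x. to_circle (x + z)) \<in> noise_measure \<rightarrow>\<^sub>M borel"
    by (intro measurable_noise_measure) measurable
  have per: "periodic_ext p (frac x - z) = periodic_ext p (x - z)" for x
    using periodic_ext_add_of_int[of p "frac x - z" "\<lfloor>x\<rfloor>"] by (simp add: frac_def)
  have "emeasure (law z) A
      = (\<integral>\<^sup>+a. ennreal (periodic_ext p (circle_coord a - z)) * indicator A a \<partial>circle_lebesgue)"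
    unfolding law_def by (intro emeasure_density) auto
  also have "\<dots> = (\<integral>\<^sup>+x\<in>{0..<1}. ennreal (periodic_ext p (x - z)) * indicator A (to_circle x) \<partial>lborel)"
    by (subst nn_integral_circle_lebesgue) (auto simp: per)
  also have "\<dots> = (\<integral>\<^sup>+x\<in>{0..<1}. ennreal (periodic_ext p (x + z - z)) * indicator A (to_circle (x + z)) \<partial>lborel)"
    using periodic_ext_add_of_int[of p "_ - z"]
    by (intro nn_integral_periodic_shift[symmetric]) (auto simp: to_circle_add_of_int algebra_simps)
  also have "\<dots> = (\<integral>\<^sup>+a. indicator A a \<partial>distr noise_measure borel (\<lambda>x. to_circle (x + z)))"
    unfolding noise_measure_def
    by (subst nn_integral_distr[OF m[unfolded noise_measure_def]], simp, subst nn_integral_density)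
      (auto simp: nn_integral_restrict_space measurable_restrict_space1 intro!: nn_integral_cong)
  finally show "emeasure (law z) A = emeasure (distr noise_measure borel (\<lambda>x. to_circle (x + z))) A"
    by simp
qed simp

lemma prob_space_noise: "prob_space noise_measure"
proof (rule prob_spaceI)
  have "emeasure noise_measure (space noise_measure) = (\<integral>\<^sup>+x. 1 \<partial>noise_measure)"
    by simp
  also have "\<dots> = (\<integral>\<^sup>+x. ennreal (periodic_ext p x) \<partial>restrict_space lborel {0..<1})"
    unfolding noise_measure_def using measurable_p_restrict by (subst nn_integral_density) auto
  also have "\<dots> = 1"
    by (simp add: nn_integral_restrict_space nn_integral_p)
  finally show "emeasure noise_measure (space noise_measure) = 1" .
qed

lemma prob_space_law: "prob_space (law z)"
  unfolding law_eq_distr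
  by (intro prob_space.prob_space_distr prob_space_noise)
    (auto intro!: measurable_noise_measure)

lemma prob_space_circle_lebesgue: "prob_space circle_lebesgue"
  unfolding circle_lebesgue_def
  by (intro prob_space.prob_space_distr prob_space_unit_interval measurable_restrict_space1) simp

text \<open>Only the part of the noise that exceeds the uniform component \<open>c\<close> transports the dependence on \<open>z\<close>.\<close>

lemma integral_law_lipschitz:
  fixes g :: "circle \<Rightarrow> real"
  assumes g: "\<And>a b. \<bar>g a - g b\<bar> \<le> L * dist a b"
  shows "\<bar>(\<integral>a. g a \<partial>law z) - (\<integral>a. g a \<partial>law z')\<bar> \<le> (1 - c) * L * \<bar>z - z'\<bar>"
proof -
  let ?U = "restrict_space lborel {0..<1 :: real}"
  interpret U: prob_space ?U
    by (rule prob_space_unit_interval)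
  \<comment> \<open>The two distinct points 0 and 1/2 force the constant to be nonnegative.\<close>
  have L: "0 \<le> L"
    using order.trans[OF abs_ge_zero g[of "to_circle 0" "to_circle (1 / 2)"]]
    by (auto simp: zero_le_mult_iff dist_to_circle round_def)
  then have "L-lipschitz_on UNIV g"
    using g by (intro lipschitz_onI) (auto simp: dist_real_def)
  then have g_meas [measurable]: "g \<in> borel_measurable borel"
    by (intro borel_measurable_continuous_onI lipschitz_on_continuous_on)
  have u_meas [measurable]: "(\<lambda>x. g (to_circle (x + z))) \<in> borel_measurable ?U" for z
    by (intro measurable_restrict_space1) measurable
  have p_meas [measurable]: "periodic_ext p \<in> borel_measurable ?U"
    by (rule measurable_p_restrict)
  have g_bd: "\<bar>g a\<bar> \<le> \<bar>g (to_circle 0)\<bar> + L" for a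
    using g[of a "to_circle 0"] mult_left_le[OF dist_circle_le L, of a "to_circle 0"] by linarith
  have p_int: "integrable ?U (periodic_ext p)"
    using p_nonneg by (intro integrableI_nonneg) (auto simp: nn_integral_restrict_space nn_integral_p)
  have p_1: "(\<integral>x. periodic_ext p x \<partial>?U) = 1"
    using p_nonneg by (subst integral_eq_nn_integral) (auto simp: nn_integral_restrict_space nn_integral_p)
  have u_int: "integrable ?U (\<lambda>x. g (to_circle (x + z)))" for z
    using g_bd by (intro integrable_bounded[OF U.finite_measure_axioms]) auto
  have pu_int: "integrable ?U (\<lambda>x. periodic_ext p x * g (to_circle (x + z)))" for z
    using g_bd by (intro Bochner_Integration.integrable_bound[OF
        integrable_mult_left[OF p_int, of "\<bar>g (to_circle 0)\<bar> + L"]])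
      (auto simp: abs_mult intro!: AE_I2 mult_left_mono intro: order.trans[OF _ abs_ge_self])
  have law: "(\<integral>a. g a \<partial>law z) = (\<integral>x. periodic_ext p x * g (to_circle (x + z)) \<partial>?U)" for z
  proof -
    have "(\<integral>a. g a \<partial>law z) = (\<integral>x. g (to_circle (x + z)) \<partial>noise_measure)"
      unfolding law_eq_distr by (rule integral_distr) (auto intro!: measurable_noise_measure)
    then show ?thesis
      unfolding noise_measure_def using p_nonneg by (subst (asm) integral_real_density) auto
  qed
  \<comment> \<open>Since the uniform integral does not depend on the shift, c times it may be
    subtracted from both terms. This replaces the density p by p - c, which is nonnegative and has
    mass 1 - c.\<close>
  have "(\<integral>x. g (to_circle (x + z)) \<partial>?U) = (\<integral>a. g a \<partial>circle_lebesgue)" for z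
    by (subst circle_lebesgue_eq_distr[of z], subst integral_distr) (auto intro!: measurable_restrict_space1)
  then have "(\<integral>a. g a \<partial>law z) - (\<integral>a. g a \<partial>law z')
      = (\<integral>x. periodic_ext p x * g (to_circle (x + z)) \<partial>?U) - (\<integral>x. periodic_ext p x * g (to_circle (x + z')) \<partial>?U)
        - (c * (\<integral>x. g (to_circle (x + z)) \<partial>?U) - c * (\<integral>x. g (to_circle (x + z')) \<partial>?U))"
    by (simp add: law)
  also have "\<dots> = (\<integral>x. (periodic_ext p x - c) * (g (to_circle (x + z)) - g (to_circle (x + z'))) \<partial>?U)"
    using u_int pu_int by (simp add: left_diff_distrib right_diff_distrib)
  also have "\<bar>\<dots>\<bar> \<le> (\<integral>x. (periodic_ext p x - c) * (L * \<bar>z - z'\<bar>) \<partial>?U)"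
  proof (rule integral_abs_bound_integral)
    show "integrable ?U (\<lambda>x. (periodic_ext p x - c) * (g (to_circle (x + z)) - g (to_circle (x + z'))))"
      using u_int pu_int by (simp add: left_diff_distrib right_diff_distrib)
    show "integrable ?U (\<lambda>x. (periodic_ext p x - c) * (L * \<bar>z - z'\<bar>))"
      using p_int by simp
    show "\<bar>(periodic_ext p x - c) * (g (to_circle (x + z)) - g (to_circle (x + z')))\<bar>
        \<le> (periodic_ext p x - c) * (L * \<bar>z - z'\<bar>)" for x
    proof -
      have "\<bar>g (to_circle (x + z)) - g (to_circle (x + z'))\<bar> \<le> L * \<bar>z - z'\<bar>"
        using g[of "to_circle (x + z)" "to_circle (x + z')"]
          mult_left_mono[OF dist_to_circle_le[of "x + z" "x + z'"] L] by simp
      then show ?thesis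
        using p_gt[of x] by (simp add: abs_mult mult_left_mono)
    qed
  qed
  also have "\<dots> = (1 - c) * L * \<bar>z - z'\<bar>"
    using p_int U.prob_space by (simp add: p_1)
  finally show ?thesis .
qed

lemma product_prob_space_law: "product_prob_space (\<lambda>i. law (z i))"
  by (intro product_prob_spaceI prob_space_law)

text \<open>Only factor i of the product depends on z i. Integrating that coordinate first reduces
  the difference to an average, over the other coordinates, of the one-dimensional estimate.\<close>

lemma coord_lipschitz_integral_law:
  fixes g :: "('i \<Rightarrow> circle) \<Rightarrow> real"
  assumes g: "coord_lipschitz I L g" and I: "finite I"
  shows "coord_lipschitz I (\<lambda>i. (1 - c) * L i) (\<lambda>z. \<integral>x. g x \<partial>(\<Pi>\<^sub>M i\<in>I. law (z i)))"
  unfolding coord_lipschitz_def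
proof (intro ballI conjI allI)
  show "0 \<le> (1 - c) * L i" if "i \<in> I" for i
    using coord_lipschitzD(1)[OF g that] c_le_1 by simp
  fix i z a b
  assume i: "i \<in> I"
  let ?J = "I - {i}"
  have I': "insert i ?J = I" "finite ?J" "i \<notin> ?J"
    using I i by auto
  obtain x0 where x0: "x0 \<in> (\<Pi>\<^sub>E i\<in>I. UNIV :: circle set)"
    by (meson PiE_eq_empty_iff UNIV_not_empty ex_in_conv)
  have g_bd: "\<bar>g x\<bar> \<le> \<bar>g x0\<bar> + sum L I" if "x \<in> (\<Pi>\<^sub>E i\<in>I. UNIV)" for x
    using coord_lipschitz_osc[OF g I that x0] by linarith
  have g_meas: "g \<in> borel_measurable (\<Pi>\<^sub>M i\<in>I. law (y i))" for y
    using measurable_coord_lipschitz[OF g I] by (simp cong: measurable_cong_sets sets_PiM_cong)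
  let ?G = "\<lambda>a x. \<integral>y. g (x(i := y)) \<partial>law a"
  have upd: "x(i := y) \<in> (\<Pi>\<^sub>E i\<in>I. UNIV)" if "x \<in> (\<Pi>\<^sub>E i\<in>?J. UNIV)" for x y
    using that i by (auto simp: PiE_def extensional_def)
  have split: "(\<integral>x. g x \<partial>(\<Pi>\<^sub>M j\<in>I. law ((z(i := a)) j))) = (\<integral>x. ?G a x \<partial>(\<Pi>\<^sub>M j\<in>?J. law (z j)))"
    and G_meas: "?G a \<in> borel_measurable (\<Pi>\<^sub>M j\<in>?J. law (z j))"
    and G_bd: "x \<in> space (\<Pi>\<^sub>M j\<in>?J. law (z j)) \<Longrightarrow> \<bar>?G a x\<bar> \<le> \<bar>g x0\<bar> + sum L I" for a x
  proof -
    interpret product_prob_space "\<lambda>j. law ((z(i := a)) j)"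
      by (rule product_prob_space_law)
    have fin: "finite_measure (\<Pi>\<^sub>M j\<in>I. law ((z(i := a)) j))"
      by (intro prob_space.finite_measure prob_space_PiM prob_space_law)
    have eq: "(\<Pi>\<^sub>M j\<in>?J. law ((z(i := a)) j)) = (\<Pi>\<^sub>M j\<in>?J. law (z j))"
      by (intro PiM_cong) auto
    have "(\<integral>x. g x \<partial>(\<Pi>\<^sub>M j\<in>insert i ?J. law ((z(i := a)) j)))
        = (\<integral>x. \<integral>y. g (x(i := y)) \<partial>law ((z(i := a)) i) \<partial>(\<Pi>\<^sub>M j\<in>?J. law ((z(i := a)) j)))"
    proof (rule product_integral_insert[OF I'(2,3)])
      show "integrable (\<Pi>\<^sub>M j\<in>insert i ?J. law ((z(i := a)) j)) g"
        unfolding I'(1) by (rule integrable_bounded[OF fin g_meas]) (use g_bd in \<open>auto simp: space_PiM\<close>)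
    qed
    then show "(\<integral>x. g x \<partial>(\<Pi>\<^sub>M j\<in>I. law ((z(i := a)) j))) = (\<integral>x. ?G a x \<partial>(\<Pi>\<^sub>M j\<in>?J. law (z j)))"
      unfolding I' eq by simp
    have "(\<lambda>(x, y). g (x(i := y))) \<in> borel_measurable ((\<Pi>\<^sub>M j\<in>?J. law ((z(i := a)) j)) \<Otimes>\<^sub>M law ((z(i := a)) i))"
      using measurable_compose[OF measurable_add_dim[of i ?J "\<lambda>j. law ((z(i := a)) j)"], of g] g_meas I'
      by (simp add: case_prod_beta')
    then show "?G a \<in> borel_measurable (\<Pi>\<^sub>M j\<in>?J. law (z j))"
      unfolding eq by (intro sigma_finite_measure.borel_measurable_lebesgue_integral)
        (auto simp: prob_space_imp_sigma_finite prob_space_law)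
    show "\<bar>?G a x\<bar> \<le> \<bar>g x0\<bar> + sum L I" if x: "x \<in> space (\<Pi>\<^sub>M j\<in>?J. law (z j))"
    proof (rule abs_integral_le_bound[OF prob_space_law])
      show "(\<lambda>y. g (x(i := y))) \<in> borel_measurable (law a)"
        using measurable_compose[OF measurable_component_update[of x ?J "\<lambda>j. law ((z(i := a)) j)" i], of g] g_meas I' x eq
        by simp
    qed (use x in \<open>auto simp: space_PiM intro!: g_bd upd\<close>)
  qed
  interpret R: prob_space "\<Pi>\<^sub>M j\<in>?J. law (z j)"
    by (intro prob_space_PiM prob_space_law)
  have "(\<integral>x. g x \<partial>(\<Pi>\<^sub>M j\<in>I. law ((z(i := a)) j))) - (\<integral>x. g x \<partial>(\<Pi>\<^sub>M j\<in>I. law ((z(i := b)) j)))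
      = (\<integral>x. ?G a x - ?G b x \<partial>(\<Pi>\<^sub>M j\<in>?J. law (z j)))"
    unfolding split
    by (intro Bochner_Integration.integral_diff[symmetric]
        integrable_bounded[OF R.finite_measure_axioms G_meas G_bd])
  also have "\<bar>\<dots>\<bar> \<le> (1 - c) * L i * dist a b"
  proof (rule abs_integral_le_bound[OF R.prob_space_axioms])
    fix x assume "x \<in> space (\<Pi>\<^sub>M j\<in>?J. law (z j))"
    then have x: "x \<in> (\<Pi>\<^sub>E i\<in>?J. UNIV)"
      by (simp add: space_PiM)
    have "\<bar>g (x(i := y)) - g (x(i := y'))\<bar> \<le> L i * dist y y'" for y y'
      using coord_lipschitzD(2)[OF g i upd[OF x, of y], of y y'] by simp
    then show "\<bar>?G a x - ?G b x\<bar> \<le> (1 - c) * L i * dist a b"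
      unfolding dist_real_def by (rule integral_law_lipschitz)
  qed (intro borel_measurable_diff G_meas)
  finally show "\<bar>(\<integral>x. g x \<partial>(\<Pi>\<^sub>M j\<in>I. law ((z(i := a)) j))) - (\<integral>x. g x \<partial>(\<Pi>\<^sub>M j\<in>I. law ((z(i := b)) j)))\<bar>
      \<le> (1 - c) * L i * dist a b" .
qed

end

section \<open>The Wasserstein distance on the circle\<close>

text \<open>The bound C keeps the supremum finite. This matters because \<open>enn2real\<close> maps
  infinity to 0, and the conclusion would then fail for any positive quotient.\<close>

lemma le_enn2real_SUP:
  assumes "\<And>i. i \<in> I \<Longrightarrow> q i \<le> C" and i: "i \<in> I"
  shows "q i \<le> enn2real (SUP i\<in>I. ennreal (q i))"
proof -
  have "(SUP i\<in>I. ennreal (q i)) \<le> ennreal C"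
    using assms(1) by (intro SUP_least ennreal_leI)
  then have "(SUP i\<in>I. ennreal (q i)) < \<top>"
    by (rule order.strict_trans1) simp
  then have "ennreal (q i) \<le> ennreal (enn2real (SUP i\<in>I. ennreal (q i)))"
    using SUP_upper[OF i, of "\<lambda>i. ennreal (q i)"] by simp
  then show ?thesis
    by (simp add: ennreal_le_iff2)
      (metis enn2real_nonneg order.trans)
qed

lemma Lip_le_iff: "0 \<le> L \<Longrightarrow> Lip g \<le> ennreal L \<longleftrightarrow> (\<forall>a b. \<bar>g a - g b\<bar> \<le> L * dist a b)"
  unfolding Lip_def SUP_le_iff
  by (auto simp: ennreal_le_iff pos_divide_le_eq) (metis dist_self abs_zero diff_self mult_zero_right order.refl)

lemma lipschitz_Lip:
  assumes "L-lipschitz_on UNIV f"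
  shows "\<bar>f x - f y\<bar> \<le> enn2real (Lip f) * dist x y"
proof (cases "x = y")
  case False
  have "\<bar>f x - f y\<bar> / dist x y \<le> enn2real (Lip f)"
  proof -
    let ?q = "\<lambda>(x, y). \<bar>f x - f y\<bar> / dist x y"
    have "Lip f = (SUP z\<in>{(x, y). x \<noteq> y}. ennreal (?q z))"
      by (simp add: Lip_def case_prod_beta)
    moreover have "?q (x, y) \<le> enn2real (SUP z\<in>{(x, y). x \<noteq> y}. ennreal (?q z))"
      using lipschitz_onD[OF assms] False
      by (intro le_enn2real_SUP[of _ _ L]) (auto simp: pos_divide_le_eq dist_real_def)
    ultimately show ?thesis
      by simp
  qed
  with False show ?thesis
    by (simp add: pos_divide_le_eq)
qed simp

lemma lipschitz_Lip1:
  assumes "L-lipschitz_on UNIV h"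
  shows "\<bar>h (x, y) - h (x', y)\<bar> \<le> enn2real (Lip1 h) * dist x x'"
proof (cases "x = x'")
  case False
  have "\<bar>h (x, y) - h (x', y)\<bar> / dist x x' \<le> enn2real (Lip1 h)"
  proof -
    let ?q = "\<lambda>(x, x', y). \<bar>h (x, y) - h (x', y)\<bar> / dist x x'"
    let ?A = "{(x, x', y). x \<noteq> x'}"
    have "Lip1 h = (SUP z\<in>?A. ennreal (?q z))"
      by (simp add: Lip1_def case_prod_beta)
    moreover have "?q (x, x', y) \<le> enn2real (SUP z\<in>?A. ennreal (?q z))"
    proof (rule le_enn2real_SUP[of _ _ L])
      show "?q z \<le> L" if "z \<in> ?A" for z
        using that lipschitz_onD[OF assms, of "(_, _)" "(_, _)"]
        by (auto simp: pos_divide_le_eq dist_real_def dist_Pair_Pair) (metis (no_types) abs_of_nonneg dist_self power_zero_numeral add_0 add_0_right real_sqrt_abs zero_le_dist)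
    qed (use False in simp)
    ultimately show ?thesis
      by simp
  qed
  with False show ?thesis
    by (simp add: pos_divide_le_eq)
qed simp

lemma lipschitz_Lip2:
  assumes "L-lipschitz_on UNIV h"
  shows "\<bar>h (x, y) - h (x, y')\<bar> \<le> enn2real (Lip2 h) * dist y y'"
proof (cases "y = y'")
  case False
  have "\<bar>h (x, y) - h (x, y')\<bar> / dist y y' \<le> enn2real (Lip2 h)"
  proof -
    let ?q = "\<lambda>(x, y, y'). \<bar>h (x, y) - h (x, y')\<bar> / dist y y'"
    let ?A = "{(x, y, y'). y \<noteq> y'}"
    have "Lip2 h = (SUP z\<in>?A. ennreal (?q z))"
      by (simp add: Lip2_def case_prod_beta)
    moreover have "?q (x, y, y') \<le> enn2real (SUP z\<in>?A. ennreal (?q z))"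
    proof (rule le_enn2real_SUP[of _ _ L])
      show "?q z \<le> L" if "z \<in> ?A" for z
        using that lipschitz_onD[OF assms, of "(_, _)" "(_, _)"]
        by (auto simp: pos_divide_le_eq dist_real_def dist_Pair_Pair) (metis (no_types) abs_of_nonneg dist_self power_zero_numeral add_0 add_0_right real_sqrt_abs zero_le_dist)
    qed (use False in simp)
    ultimately show ?thesis
      by simp
  qed
  with False show ?thesis
    by (simp add: pos_divide_le_eq)
qed simp

lemma measurable_if_lipschitz:
  fixes g :: "circle \<Rightarrow> real"
  assumes "\<And>a b. \<bar>g a - g b\<bar> \<le> L * dist a b"
  shows "g \<in> borel_measurable borel"
proof -
  \<comment> \<open>The constant carries no sign condition; a negative one makes g constant, so its
    absolute value is a Lipschitz constant in every case.\<close>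
  have "g a = g b" if "L < 0" for a b
    using assms[of a b] that mult_nonpos_nonneg[of L "dist a b"] by auto
  then have "\<bar>g a - g b\<bar> \<le> \<bar>L\<bar> * dist a b" for a b
    using assms[of a b] by (cases "L < 0") (metis abs_ge_zero abs_zero diff_self mult_nonneg_nonneg zero_le_dist, auto)
  then have "\<bar>L\<bar>-lipschitz_on UNIV g"
    by (intro lipschitz_onI) (auto simp: dist_real_def)
  then show ?thesis
    by (intro borel_measurable_continuous_onI lipschitz_on_continuous_on)
qed

text \<open>Average g x - g y over x and then over y. The result bounds the suprema defining the
  Wasserstein distances, which are taken in the reals and would be meaningless if unbounded.\<close>

lemma abs_integral_diff_le_osc:
  fixes g :: "'a \<Rightarrow> real"
  assumes \<mu>: "\<mu> \<in> prob_measures M" and \<nu>: "\<nu> \<in> prob_measures M" and g: "g \<in> borel_measurable M"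
    and osc: "\<And>x y. x \<in> space M \<Longrightarrow> y \<in> space M \<Longrightarrow> \<bar>g x - g y\<bar> \<le> C"
  shows "\<bar>(\<integral>x. g x \<partial>\<mu>) - (\<integral>x. g x \<partial>\<nu>)\<bar> \<le> C"
proof -
  have [measurable_cong]: "sets \<mu> = sets M" "sets \<nu> = sets M" and "prob_space \<mu>" "prob_space \<nu>"
    using \<mu> \<nu> by (simp_all add: space_prob_algebra)
  note sp = this(1,2)[THEN sets_eq_imp_space_eq]
  interpret \<mu>: prob_space \<mu> by fact
  interpret \<nu>: prob_space \<nu> by fact
  obtain x0 where x0: "x0 \<in> space M"
    using \<mu>.not_empty sp by blast
  have bd: "\<bar>g x\<bar> \<le> \<bar>g x0\<bar> + C" if "x \<in> space M" for x
    using osc[OF that x0] by linarith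
  have int: "integrable \<mu> g" "integrable \<nu> g"
    using g bd by (auto intro!: integrable_bounded \<mu>.finite_measure_axioms \<nu>.finite_measure_axioms simp: sp)
  have inner: "\<bar>(\<integral>x. g x \<partial>\<mu>) - g y\<bar> \<le> C" if y: "y \<in> space M" for y
  proof -
    have "(\<integral>x. g x \<partial>\<mu>) - g y = (\<integral>x. g x - g y \<partial>\<mu>)"
      using int by (simp add: \<mu>.prob_space)
    also have "\<bar>\<dots>\<bar> \<le> C"
      using g y by (intro abs_integral_le_bound \<mu>.prob_space_axioms osc) (auto simp: sp)
    finally show ?thesis .
  qed
  have "(\<integral>x. g x \<partial>\<mu>) - (\<integral>x. g x \<partial>\<nu>) = (\<integral>y. (\<integral>x. g x \<partial>\<mu>) - g y \<partial>\<nu>)"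
    using int by (simp add: \<nu>.prob_space)
  also have "\<bar>\<dots>\<bar> \<le> C"
    using g by (intro abs_integral_le_bound \<nu>.prob_space_axioms inner) (auto simp: sp)
  finally show ?thesis .
qed

lemma lipschitz_osc:
  fixes g :: "circle \<Rightarrow> real"
  assumes "0 \<le> L" "\<And>a b. \<bar>g a - g b\<bar> \<le> L * dist a b"
  shows "\<bar>g a - g b\<bar> \<le> L"
  using assms(2)[of a b] mult_left_le[OF dist_circle_le assms(1), of a b] by simp

lemma wasserstein1_least:
  assumes "\<And>g. (\<And>a b. \<bar>g a - g b\<bar> \<le> dist a b) \<Longrightarrow> (\<integral>x. g x \<partial>\<mu>) - (\<integral>x. g x \<partial>\<nu>) \<le> B"
  shows "wasserstein1 \<mu> \<nu> \<le> B"
  unfolding wasserstein1_def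
proof (rule cSUP_least)
  show "{g. Lip g \<le> 1} \<noteq> {}"
    using Lip_le_iff[of 1 "\<lambda>_. 0"] by auto
qed (use assms Lip_le_iff[of 1] in auto)

context
  fixes \<mu> \<nu> :: "circle measure"
  assumes \<mu>: "\<mu> \<in> prob_measures borel" and \<nu>: "\<nu> \<in> prob_measures borel"
begin

text \<open>Dividing g by L gives an admissible test function. For L = 0 there is nothing to
  rescale, and g is constant.\<close>

lemma integral_diff_le_wasserstein1:
  assumes L: "0 \<le> L" and g: "\<And>a b. \<bar>g a - g b\<bar> \<le> L * dist a b"
  shows "(\<integral>x. g x \<partial>\<mu>) - (\<integral>x. g x \<partial>\<nu>) \<le> L * wasserstein1 \<mu> \<nu>"
proof (cases "L = 0")
  case True
  then have "\<bar>(\<integral>x. g x \<partial>\<mu>) - (\<integral>x. g x \<partial>\<nu>)\<bar> \<le> 0"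
    using g by (intro abs_integral_diff_le_osc[OF \<mu> \<nu>] measurable_if_lipschitz[of _ 0]) auto
  with True show ?thesis
    by simp
next
  case False
  with L have L: "0 < L"
    by simp
  have "(\<integral>x. g x / L \<partial>\<mu>) - (\<integral>x. g x / L \<partial>\<nu>) \<le> wasserstein1 \<mu> \<nu>"
    unfolding wasserstein1_def
  proof (rule cSUP_upper)
    have "\<bar>g a / L - g b / L\<bar> \<le> dist a b" for a b
      using g[of a b] L by (simp add: diff_divide_distrib[symmetric] pos_divide_le_eq mult.commute)
    then show "(\<lambda>x. g x / L) \<in> {g. Lip g \<le> 1}"
      using Lip_le_iff[of 1] by simp
    have "(\<integral>x. g x \<partial>\<mu>) - (\<integral>x. g x \<partial>\<nu>) \<le> 1" if "Lip g \<le> 1" for g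
    proof -
      have g: "\<bar>g a - g b\<bar> \<le> 1 * dist a b" for a b
        using that Lip_le_iff[of 1 g] by simp
      have "\<bar>(\<integral>x. g x \<partial>\<mu>) - (\<integral>x. g x \<partial>\<nu>)\<bar> \<le> 1"
        by (intro abs_integral_diff_le_osc[OF \<mu> \<nu>] measurable_if_lipschitz[OF g] lipschitz_osc[OF _ g]) simp
      then show ?thesis by simp
    qed
    then show "bdd_above ((\<lambda>g. (\<integral>x. g x \<partial>\<mu>) - (\<integral>x. g x \<partial>\<nu>)) ` {g. Lip g \<le> 1})"
      by (auto intro!: bdd_aboveI2)
  qed
  then show ?thesis
    using L by (simp add: diff_divide_distrib[symmetric] pos_divide_le_eq mult.commute)
qed

lemma abs_integral_diff_le_wasserstein1:
  assumes L: "0 \<le> L" and g: "\<And>a b. \<bar>g a - g b\<bar> \<le> L * dist a b"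
  shows "\<bar>(\<integral>x. g x \<partial>\<mu>) - (\<integral>x. g x \<partial>\<nu>)\<bar> \<le> L * wasserstein1 \<mu> \<nu>"
proof -
  have "(\<integral>x. - g x \<partial>\<mu>) - (\<integral>x. - g x \<partial>\<nu>) \<le> L * wasserstein1 \<mu> \<nu>"
    using g by (intro integral_diff_le_wasserstein1[OF L]) (simp add: abs_minus_commute)
  with integral_diff_le_wasserstein1[OF L g] show ?thesis
    by simp
qed

lemma wasserstein1_nonneg: "0 \<le> wasserstein1 \<mu> \<nu>"
  using integral_diff_le_wasserstein1[of 1 "\<lambda>_. 0"] by simp

lemma wasserstein1_le_1: "wasserstein1 \<mu> \<nu> \<le> 1"
proof (rule wasserstein1_least)
  fix g :: "circle \<Rightarrow> real"
  assume "\<And>a b. \<bar>g a - g b\<bar> \<le> dist a b"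
  then have g: "\<bar>g a - g b\<bar> \<le> 1 * dist a b" for a b
    by simp
  have "\<bar>(\<integral>x. g x \<partial>\<mu>) - (\<integral>x. g x \<partial>\<nu>)\<bar> \<le> 1"
    by (intro abs_integral_diff_le_osc[OF \<mu> \<nu>] measurable_if_lipschitz[OF g] lipschitz_osc[OF _ g]) simp
  then show "(\<integral>x. g x \<partial>\<mu>) - (\<integral>x. g x \<partial>\<nu>) \<le> 1"
    by simp
qed

end

section \<open>Lipschitz functions separate probability measures\<close>

text \<open>Lipschitz tents around C shrink to its indicator. The set must be nonempty because
  \<open>infdist x {}\<close> is 0, which would make the limit 1 instead of 0.\<close>

lemma closed_indicator_limit:
  fixes C :: "'a::metric_space set"
  assumes "closed C" "C \<noteq> {}"
  shows "(\<lambda>n. max 0 (1 - real n * infdist x C)) \<longlonglongrightarrow> indicat_real C x"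
proof (cases "x \<in> C")
  case True
  then show ?thesis
    using assms by simp
next
  case False
  with assms have pos: "0 < infdist x C"
    by (metis in_closed_iff_infdist_zero infdist_nonneg less_eq_real_def)
  have "\<forall>\<^sub>F n in sequentially. max 0 (1 - real n * infdist x C) = 0"
    using eventually_gt_at_top[of "nat \<lceil>1 / infdist x C\<rceil>"]
  proof eventually_elim
    case (elim n)
    then have "1 / infdist x C \<le> real n"
      by linarith
    with pos show ?case
      by (simp add: pos_divide_le_eq)
  qed
  then have "(\<lambda>n. max 0 (1 - real n * infdist x C)) \<longlonglongrightarrow> 0"
    by (rule tendsto_eventually)
  with False show ?thesis
    by simp
qed

text \<open>Distance 0 makes the integrals of all Lipschitz functions agree, whatever their
  constants. Dominated convergence along the tents then gives equality on closed sets, which form an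
  intersection-stable generator of the Borel sets.\<close>

lemma wasserstein1_le_0_imp_eq:
  assumes \<mu>: "\<mu> \<in> prob_measures borel" and \<nu>: "\<nu> \<in> prob_measures borel" and W: "wasserstein1 \<mu> \<nu> \<le> 0"
  shows "\<mu> = \<nu>"
proof -
  have sets: "sets \<mu> = sets borel" "sets \<nu> = sets borel" and "prob_space \<mu>" "prob_space \<nu>"
    using \<mu> \<nu> by (simp_all add: space_prob_algebra)
  note [measurable_cong] = sets
  interpret \<mu>: prob_space \<mu> by fact
  interpret \<nu>: prob_space \<nu> by fact
  have eq: "measure \<mu> C = measure \<nu> C" if C: "closed C" "C \<noteq> {}" for C
  proof -
    let ?g = "\<lambda>n x. max 0 (1 - real n * infdist x C)"
    have g: "\<bar>?g n a - ?g n b\<bar> \<le> real n * dist a b" for n a b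
    proof -
      have "\<bar>infdist a C - infdist b C\<bar> \<le> dist a b"
        using infdist_triangle_abs by blast
      then have "real n * \<bar>infdist a C - infdist b C\<bar> \<le> real n * dist a b"
        by (intro mult_left_mono) auto
      moreover have "real n * \<bar>infdist a C - infdist b C\<bar> = \<bar>real n * infdist a C - real n * infdist b C\<bar>"
        by (simp add: abs_mult right_diff_distrib[symmetric])
      ultimately show ?thesis
        by linarith
    qed
    have m: "?g n \<in> borel_measurable borel" for n
      by (rule measurable_if_lipschitz[OF g])
    have eq_n: "(\<integral>x. ?g n x \<partial>\<mu>) = (\<integral>x. ?g n x \<partial>\<nu>)" for n
    proof -
      have "\<bar>(\<integral>x. ?g n x \<partial>\<mu>) - (\<integral>x. ?g n x \<partial>\<nu>)\<bar> \<le> real n * wasserstein1 \<mu> \<nu>"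
        by (rule abs_integral_diff_le_wasserstein1[OF \<mu> \<nu> _ g]) simp
      also have "\<dots> \<le> 0"
        using W by (simp add: mult_nonneg_nonpos)
      finally show ?thesis by simp
    qed
    have lim: "(\<lambda>n. \<integral>x. ?g n x \<partial>M) \<longlonglongrightarrow> measure M C" if "prob_space M" "sets M = sets borel" for M
    proof -
      interpret M: prob_space M by fact
      note [measurable_cong] = that(2)
      have "(\<lambda>n. \<integral>x. ?g n x \<partial>M) \<longlonglongrightarrow> (\<integral>x. indicat_real C x \<partial>M)"
        using m C closed_indicator_limit[OF C]
        by (intro integral_dominated_convergence[where w = "\<lambda>_. 1"])
          (auto simp: infdist_nonneg that(2) cong: measurable_cong_sets)
      then show ?thesis
        using C that(2) by (simp add: sets_eq_imp_space_eq[OF that(2)])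
    qed
    show ?thesis
      using LIMSEQ_unique[OF lim[OF \<mu>.prob_space_axioms sets(1)]] lim[OF \<nu>.prob_space_axioms sets(2)]
      by (simp add: eq_n)
  qed
  show ?thesis
  proof (rule measure_eqI_generator_eq[of "Collect closed" UNIV _ _ "\<lambda>_. UNIV"])
    show "Int_stable (Collect (closed :: circle set \<Rightarrow> bool))"
      by (auto simp: Int_stable_def)
    show "emeasure \<mu> X = emeasure \<nu> X" if "X \<in> Collect closed" for X
      using eq[of X] that by (cases "X = {}") (auto simp: \<mu>.emeasure_eq_measure \<nu>.emeasure_eq_measure)
    have "sets (borel :: circle measure) = sigma_sets UNIV (Collect closed)"
      by (subst borel_eq_closed) (simp add: sets_measure_of)
    then show "sets \<mu> = sigma_sets UNIV (Collect closed)" "sets \<nu> = sigma_sets UNIV (Collect closed)"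
      by (simp_all add: sets)
  qed auto
qed

section \<open>The self-consistent operator\<close>

lemma lipschitz_bounded:
  fixes g :: "circle \<Rightarrow> real"
  assumes g: "\<And>a b. \<bar>g a - g b\<bar> \<le> L * dist a b"
  shows "\<bar>g x\<bar> \<le> \<bar>g (to_circle 0)\<bar> + \<bar>L\<bar>"
proof -
  have "L * dist x (to_circle 0) \<le> \<bar>L\<bar> * 1"
    by (intro mult_mono) (auto simp: dist_circle_le)
  with g[of x "to_circle 0"] show ?thesis
    by linarith
qed

text \<open>The reals \<open>a\<close>, \<open>b\<^sub>1\<close>, \<open>b\<^sub>2\<close> are
  Lipschitz bounds for f and for the two variables of h; the theorem instantiates them with the
  optimal constants.\<close>

locale mean_field = noise p c for p c +
  fixes f :: "circle \<Rightarrow> real" and h :: "circle \<times> circle \<Rightarrow> real" and a b\<^sub>1 b\<^sub>2 :: real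
  assumes f_lipschitz: "\<bar>f x - f y\<bar> \<le> a * dist x y"
    and h_lipschitz1: "\<bar>h (x, y) - h (x', y)\<bar> \<le> b\<^sub>1 * dist x x'"
    and h_lipschitz2: "\<bar>h (x, y) - h (x, y')\<bar> \<le> b\<^sub>2 * dist y y'"
    and nonneg: "0 \<le> a" "0 \<le> b\<^sub>1" "0 \<le> b\<^sub>2"
    and contraction: "(1 - c) * (a + b\<^sub>1 + b\<^sub>2) < 1"
begin

abbreviation \<kappa> :: real
  where "\<kappa> \<equiv> (1 - c) * (a + b\<^sub>1 + b\<^sub>2)"

lemma kappa_nonneg: "0 \<le> \<kappa>"
  using c_le_1 nonneg by simp

definition drift :: "circle measure \<Rightarrow> circle \<Rightarrow> real"
  where "drift \<nu> u = f u + (\<integral>v. h (u, v) \<partial>\<nu>)"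

lemma drift_lipschitz:
  assumes \<nu>: "\<nu> \<in> prob_measures borel"
  shows "\<bar>drift \<nu> u - drift \<nu> u'\<bar> \<le> (a + b\<^sub>1) * dist u u'"
proof -
  have [measurable_cong]: "sets \<nu> = sets borel" and P: "prob_space \<nu>"
    using \<nu> by (simp_all add: space_prob_algebra)
  interpret prob_space \<nu> by fact
  have int: "integrable \<nu> (\<lambda>v. h (u, v))" for u
    using measurable_if_lipschitz[of "\<lambda>v. h (u, v)", OF h_lipschitz2]
      lipschitz_bounded[of "\<lambda>v. h (u, v)", OF h_lipschitz2]
    by (intro integrable_bounded[OF finite_measure_axioms]) auto
  have "(\<integral>v. h (u, v) \<partial>\<nu>) - (\<integral>v. h (u', v) \<partial>\<nu>) = (\<integral>v. h (u, v) - h (u', v) \<partial>\<nu>)"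
    using int by simp
  also have "\<bar>\<dots>\<bar> \<le> b\<^sub>1 * dist u u'"
    using int by (intro abs_integral_le_bound[OF P] h_lipschitz1) auto
  finally show ?thesis
    using f_lipschitz[of u u'] by (simp add: drift_def distrib_right)
qed

lemma measurable_drift:
  assumes "\<nu> \<in> prob_measures borel"
  shows "drift \<nu> \<in> borel_measurable borel"
  by (rule measurable_if_lipschitz[OF drift_lipschitz[OF assms]])

lemma drift_wasserstein1:
  assumes "\<mu> \<in> prob_measures borel" "\<nu> \<in> prob_measures borel"
  shows "\<bar>drift \<mu> u - drift \<nu> u\<bar> \<le> b\<^sub>2 * wasserstein1 \<mu> \<nu>"
  using abs_integral_diff_le_wasserstein1[OF assms nonneg(3) h_lipschitz2, of u] by (simp add: drift_def)

lemma density_kernel_drift: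
  fixes F :: "circle \<Rightarrow> real"
  assumes F [measurable]: "F \<in> borel_measurable borel"
  shows "density_kernel circle_lebesgue borel (\<lambda>u x. ennreal (periodic_ext p (circle_coord x - F u)))"
proof -
  interpret prob_space circle_lebesgue
    by (rule prob_space_circle_lebesgue)
  show ?thesis
  proof
    fix u :: circle
    show "(\<integral>\<^sup>+x. ennreal (periodic_ext p (circle_coord x - F u)) \<partial>circle_lebesgue) = 1"
      using prob_space.emeasure_space_1[OF prob_space_law[of "F u"]]
      unfolding law_def by (subst (asm) emeasure_density) auto
  qed measurable
qed

abbreviation P :: "circle measure \<Rightarrow> circle measure"
  where "P \<equiv> self_consistent_transfer f h p"

text \<open>The nonlinearity sits in the drift alone: with the drift of \<nu> frozen, the operator
  is an ordinary Markov kernel applied to \<nu>.\<close>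

lemma self_consistent_transfer_eq_push:
  "P \<nu> = density_kernel.push circle_lebesgue (\<lambda>u x. ennreal (periodic_ext p (circle_coord x - drift \<nu> u))) \<nu>"
  if "\<nu> \<in> prob_measures borel"
  unfolding self_consistent_transfer_def density_kernel.push_def[OF density_kernel_drift[OF measurable_drift[OF that]]]
  by (simp add: drift_def diff_diff_eq)

lemma prob_measures_circle_lebesgue: "prob_measures circle_lebesgue = prob_measures borel"
  by (simp add: space_prob_algebra)

lemma self_consistent_transfer_prob:
  assumes \<nu>: "\<nu> \<in> prob_measures borel"
  shows "P \<nu> \<in> prob_measures borel"
  using density_kernel.push_in_prob_algebra[OF density_kernel_drift[OF measurable_drift[OF \<nu>]] \<nu>]
  by (simp add: self_consistent_transfer_eq_push[OF \<nu>] prob_measures_circle_lebesgue)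

lemma integral_self_consistent_transfer:
  assumes \<nu>: "\<nu> \<in> prob_measures borel" and g: "\<And>a b. \<bar>g a - g b\<bar> \<le> L * dist a b"
  shows "(\<integral>x. g x \<partial>P \<nu>) = (\<integral>u. \<integral>x. g x \<partial>law (drift \<nu> u) \<partial>\<nu>)"
  unfolding self_consistent_transfer_eq_push[OF \<nu>] law_def
  using measurable_if_lipschitz[OF g] lipschitz_bounded[OF g]
  by (intro density_kernel.integral_push[OF density_kernel_drift[OF measurable_drift[OF \<nu>]] \<nu>]) auto

text \<open>The measure enters twice. Changing the initial measure with the drift of \<mu> frozen
  costs (1 - c) (a + b1), and changing the drift with initial measure \<nu> costs (1 - c) b2; the
  two add up to \<kappa>.\<close>

lemma self_consistent_transfer_contraction:
  assumes \<mu>: "\<mu> \<in> prob_measures borel" and \<nu>: "\<nu> \<in> prob_measures borel"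
  shows "wasserstein1 (P \<mu>) (P \<nu>) \<le> \<kappa> * wasserstein1 \<mu> \<nu>"
proof (rule wasserstein1_least)
  fix g :: "circle \<Rightarrow> real"
  assume "\<And>a b. \<bar>g a - g b\<bar> \<le> dist a b"
  then have g: "\<bar>g a - g b\<bar> \<le> 1 * dist a b" for a b
    by simp
  have sets_nu [measurable_cong]: "sets \<nu> = sets borel" and PS: "prob_space \<nu>"
    using \<nu> by (simp_all add: space_prob_algebra)
  interpret \<nu>: prob_space \<nu> by fact
  define G where "G \<xi> u = (\<integral>x. g x \<partial>law (drift \<xi> u))" for \<xi> u
  have G_lip: "\<bar>G \<xi> u - G \<xi> u'\<bar> \<le> (1 - c) * (a + b\<^sub>1) * dist u u'" if "\<xi> \<in> prob_measures borel" for \<xi> u u'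
  proof -
    have "\<bar>G \<xi> u - G \<xi> u'\<bar> \<le> (1 - c) * 1 * \<bar>drift \<xi> u - drift \<xi> u'\<bar>"
      unfolding G_def by (rule integral_law_lipschitz[OF g])
    also have "\<dots> \<le> (1 - c) * 1 * ((a + b\<^sub>1) * dist u u')"
      using c_le_1 by (intro mult_left_mono drift_lipschitz that) auto
    finally show ?thesis by simp
  qed
  have int: "integrable \<nu> (G \<xi>)" if "\<xi> \<in> prob_measures borel" for \<xi>
    using measurable_if_lipschitz[OF G_lip[OF that]] lipschitz_bounded[OF G_lip[OF that]]
    by (intro integrable_bounded[OF \<nu>.finite_measure_axioms]) auto
  have "(\<integral>x. g x \<partial>P \<mu>) - (\<integral>x. g x \<partial>P \<nu>)
      = ((\<integral>u. G \<mu> u \<partial>\<mu>) - (\<integral>u. G \<mu> u \<partial>\<nu>)) + (\<integral>u. G \<mu> u - G \<nu> u \<partial>\<nu>)"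
    using int \<mu> \<nu> by (simp add: integral_self_consistent_transfer[OF _ g] G_def[symmetric])
  also have "\<dots> \<le> (1 - c) * (a + b\<^sub>1) * wasserstein1 \<mu> \<nu> + (1 - c) * b\<^sub>2 * wasserstein1 \<mu> \<nu>"
  proof (rule add_mono)
    show "(\<integral>u. G \<mu> u \<partial>\<mu>) - (\<integral>u. G \<mu> u \<partial>\<nu>) \<le> (1 - c) * (a + b\<^sub>1) * wasserstein1 \<mu> \<nu>"
      using c_le_1 nonneg by (intro integral_diff_le_wasserstein1 \<mu> \<nu> G_lip) auto
    have "\<bar>\<integral>u. G \<mu> u - G \<nu> u \<partial>\<nu>\<bar> \<le> (1 - c) * b\<^sub>2 * wasserstein1 \<mu> \<nu>"
    proof (rule abs_integral_le_bound[OF PS])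
      show "(\<lambda>u. G \<mu> u - G \<nu> u) \<in> borel_measurable \<nu>"
        using int \<mu> \<nu> by auto
      fix u
      have "\<bar>G \<mu> u - G \<nu> u\<bar> \<le> (1 - c) * 1 * \<bar>drift \<mu> u - drift \<nu> u\<bar>"
        unfolding G_def by (rule integral_law_lipschitz[OF g])
      also have "\<dots> \<le> (1 - c) * 1 * (b\<^sub>2 * wasserstein1 \<mu> \<nu>)"
        using c_le_1 by (intro mult_left_mono drift_wasserstein1 \<mu> \<nu>) auto
      finally show "\<bar>G \<mu> u - G \<nu> u\<bar> \<le> (1 - c) * b\<^sub>2 * wasserstein1 \<mu> \<nu>"
        by simp
    qed
    then show "(\<integral>u. G \<mu> u - G \<nu> u \<partial>\<nu>) \<le> (1 - c) * b\<^sub>2 * wasserstein1 \<mu> \<nu>"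
      by simp
  qed
  finally show "(\<integral>x. g x \<partial>P \<mu>) - (\<integral>x. g x \<partial>P \<nu>) \<le> \<kappa> * wasserstein1 \<mu> \<nu>"
    by (simp add: algebra_simps)
qed

lemma self_consistent_fixed_point_unique:
  assumes "\<rho> \<in> prob_measures borel" "P \<rho> = \<rho>" "\<rho>' \<in> prob_measures borel" "P \<rho>' = \<rho>'"
  shows "\<rho> = \<rho>'"
proof (rule wasserstein1_le_0_imp_eq)
  have "(1 - \<kappa>) * wasserstein1 \<rho> \<rho>' \<le> 0"
    using self_consistent_transfer_contraction[of \<rho> \<rho>'] assms by (simp add: algebra_simps)
  then show "wasserstein1 \<rho> \<rho>' \<le> 0"
    using contraction by (simp add: mult_le_0_iff)
qed fact+

end

section \<open>Compactness and the self-consistent fixed point\<close>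

text \<open>Helly's theorem concerns measures on the line, so the measures are lifted to [0, 1),
  where they are tight, and the limit is projected back. The lift is discontinuous, but test
  functions are read through the continuous \<open>to_circle\<close>, so mass that drifts to 1 on
  the line reappears correctly at the point 0.\<close>

lemma circle_convergent_subsequence:
  fixes \<mu> :: "nat \<Rightarrow> circle measure"
  assumes \<mu>: "\<And>n. \<mu> n \<in> prob_measures borel"
  obtains r \<rho> where "strict_mono (r :: nat \<Rightarrow> nat)" "\<rho> \<in> prob_measures borel"
    "\<forall>(g :: circle \<Rightarrow> real) L. (\<forall>a b. \<bar>g a - g b\<bar> \<le> L * dist a b) \<longrightarrow>
      (\<lambda>n. \<integral>x. g x \<partial>\<mu> (r n)) \<longlonglongrightarrow> (\<integral>x. g x \<partial>\<rho>)"
proof -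
  have sets [measurable_cong]: "sets (\<mu> n) = sets borel" and prob: "prob_space (\<mu> n)" for n
    using \<mu>[of n] by (simp_all add: space_prob_algebra)
  have sp: "space (\<mu> n) = UNIV" for n
    using sets_eq_imp_space_eq[OF sets[of n]] by simp
  define m where "m n = distr (\<mu> n) borel circle_coord" for n
  have coord: "circle_coord \<in> \<mu> n \<rightarrow>\<^sub>M borel" for n
    by measurable
  have m: "real_distribution (m n)" for n
    unfolding m_def by (rule prob_space.real_distribution_distr[OF prob coord])
  have "tight m"
    unfolding tight_def
  proof (intro conjI allI impI)
    show "real_distribution (m n)" for n
      by (rule m)
    fix \<epsilon> :: real assume \<epsilon>: "0 < \<epsilon>"
    \<comment> \<open>Tightness is phrased with intervals open on the left, which must contain a
      possible atom at 0.\<close>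
    have "measure (m n) {-1<..1} = 1" for n
    proof -
      have "circle_coord -` {-1<..1} = UNIV"
      proof -
        have "-1 < circle_coord x" "circle_coord x \<le> 1" for x
          using circle_coord_bounds[of x] by simp_all
        then show ?thesis
          by auto
      qed
      then show ?thesis
        using prob_space.prob_space[OF prob[of n]] sp[of n] coord by (simp add: m_def measure_distr)
    qed
    then show "\<exists>a b. a < b \<and> (\<forall>n. 1 - \<epsilon> < measure (m n) {a<..b})"
      using \<epsilon> by (intro exI[of _ "-1"] exI[of _ 1]) simp
  qed
  from tight_imp_convergent_subsubsequence[OF this strict_mono_id]
  obtain r M where r: "strict_mono r" and M: "real_distribution M" and conv: "weak_conv_m (m \<circ> id \<circ> r) M"
    by blast
  interpret M: real_distribution M by fact
  define \<rho> where "\<rho> = distr M borel to_circle"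
  have \<rho>: "\<rho> \<in> prob_measures borel"
    unfolding \<rho>_def by (auto simp: space_prob_algebra intro!: M.prob_space_distr)
  have lim: "(\<lambda>n. \<integral>x. g x \<partial>\<mu> (r n)) \<longlonglongrightarrow> (\<integral>x. g x \<partial>\<rho>)"
    if g: "\<And>a b. \<bar>g a - g b\<bar> \<le> L * dist a b" for g :: "circle \<Rightarrow> real" and L
  proof -
    have [measurable]: "g \<in> borel_measurable borel"
      by (rule measurable_if_lipschitz[OF g])
    have "\<bar>g (to_circle x) - g (to_circle y)\<bar> \<le> \<bar>L\<bar> * \<bar>x - y\<bar>" for x y
      using g[of "to_circle x" "to_circle y"] mult_mono[OF abs_ge_self[of L] dist_to_circle_le[of x y]]
      by simp
    then have "\<bar>L\<bar>-lipschitz_on UNIV (\<lambda>x. g (to_circle x))"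
      by (intro lipschitz_onI) (auto simp: dist_real_def)
    then have "isCont (\<lambda>x. g (to_circle x)) x" for x
      using lipschitz_on_continuous_on continuous_on_eq_continuous_at by blast
    then have "(\<lambda>n. \<integral>x. g (to_circle x) \<partial>(m \<circ> id \<circ> r) n) \<longlonglongrightarrow> (\<integral>x. g (to_circle x) \<partial>M)"
      using lipschitz_bounded[OF g] m by (intro weak_conv_imp_integral_bdd_continuous_conv conv M) auto
    then show ?thesis
      unfolding m_def \<rho>_def o_def id_def using coord by (simp add: integral_distr)
  qed
  show ?thesis
    using lim by (intro that[OF r \<rho>]) blast
qed

context mean_field
begin

lemma self_consistent_fixed_point_exists:
  "\<exists>\<rho>. \<rho> \<in> prob_measures borel \<and> P \<rho> = \<rho>"
proof -
  define \<mu> where "\<mu> n = (P ^^ n) circle_lebesgue" for n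
  have \<mu>_Suc: "\<mu> (Suc n) = P (\<mu> n)" for n
    by (simp add: \<mu>_def)
  have \<mu>: "\<mu> n \<in> prob_measures borel" for n
  proof (induction n)
    case 0
    show ?case
      by (simp add: \<mu>_def space_prob_algebra prob_space_circle_lebesgue)
  qed (simp add: \<mu>_Suc self_consistent_transfer_prob)
  \<comment> \<open>The n-fold contraction acts on the pair \<open>\<mu> 0\<close>,
    \<open>\<mu> k\<close>, which are at distance at most 1 by \<open>wasserstein1_le_1\<close>. No
    triangle inequality or geometric sum is involved.\<close>
  have cauchy: "wasserstein1 (\<mu> n) (\<mu> (n + k)) \<le> \<kappa> ^ n" for n k
  proof (induction n)
    case 0
    show ?case
      using wasserstein1_le_1[OF \<mu> \<mu>] by simp
  next
    case (Suc n)
    have "wasserstein1 (\<mu> (Suc n)) (\<mu> (Suc n + k)) \<le> \<kappa> * wasserstein1 (\<mu> n) (\<mu> (n + k))"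
      using self_consistent_transfer_contraction[OF \<mu>[of n] \<mu>[of "n + k"]] by (simp add: \<mu>_Suc)
    also have "\<dots> \<le> \<kappa> * \<kappa> ^ n"
      using Suc kappa_nonneg by (intro mult_left_mono)
    finally show ?case
      by simp
  qed
  obtain r \<rho> where r: "strict_mono (r :: nat \<Rightarrow> nat)" and \<rho>: "\<rho> \<in> prob_measures borel"
    and lim: "\<forall>(g :: circle \<Rightarrow> real) L. (\<forall>a b. \<bar>g a - g b\<bar> \<le> L * dist a b) \<longrightarrow>
      (\<lambda>n. \<integral>x. g x \<partial>\<mu> (r n)) \<longlonglongrightarrow> (\<integral>x. g x \<partial>\<rho>)"
    using circle_convergent_subsequence[of \<mu>, OF \<mu>] by blast
  \<comment> \<open>Letting the second index run along the subsequence upgrades subsequential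
    convergence to a rate for every iterate.\<close>
  have close: "\<bar>(\<integral>x. g x \<partial>\<mu> n) - (\<integral>x. g x \<partial>\<rho>)\<bar> \<le> \<kappa> ^ n"
    if g: "\<And>a b. \<bar>g a - g b\<bar> \<le> 1 * dist a b" for g n
  proof (rule tendsto_upperbound)
    show "(\<lambda>k. \<bar>(\<integral>x. g x \<partial>\<mu> n) - (\<integral>x. g x \<partial>\<mu> (r k))\<bar>) \<longlonglongrightarrow> \<bar>(\<integral>x. g x \<partial>\<mu> n) - (\<integral>x. g x \<partial>\<rho>)\<bar>"
      by (intro tendsto_rabs tendsto_diff tendsto_const lim[rule_format, of g 1, OF g])
    have "\<bar>(\<integral>x. g x \<partial>\<mu> n) - (\<integral>x. g x \<partial>\<mu> (r k))\<bar> \<le> \<kappa> ^ n" if "n \<le> k" for k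
    proof -
      have "n \<le> r k"
        using seq_suble[OF r, of k] that by simp
      then show ?thesis
        using abs_integral_diff_le_wasserstein1[OF \<mu>[of n] \<mu>[of "r k"] _ g] cauchy[of n "r k - n"] by simp
    qed
    then show "\<forall>\<^sub>F k in sequentially. \<bar>(\<integral>x. g x \<partial>\<mu> n) - (\<integral>x. g x \<partial>\<mu> (r k))\<bar> \<le> \<kappa> ^ n"
      using eventually_ge_at_top[of n] by (rule eventually_mono[rotated])
  qed simp
  \<comment> \<open>Both \<open>P \<rho>\<close> and \<rho> are compared with the iterate
    \<open>\<mu> (Suc n)\<close>: the former by contracting the distance of \<rho> to
    \<open>\<mu> n\<close>, the latter by the rate just obtained.\<close>
  have "wasserstein1 (P \<rho>) \<rho> \<le> 2 * \<kappa> ^ n" for n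
  proof (rule wasserstein1_least)
    fix g :: "circle \<Rightarrow> real"
    assume "\<And>a b. \<bar>g a - g b\<bar> \<le> dist a b"
    then have g: "\<bar>g a - g b\<bar> \<le> 1 * dist a b" for a b
      by simp
    have "wasserstein1 \<rho> (\<mu> n) \<le> \<kappa> ^ n"
      using close by (intro wasserstein1_least) (fastforce simp: abs_le_iff)
    then have "\<kappa> * wasserstein1 \<rho> (\<mu> n) \<le> 1 * \<kappa> ^ n"
      using contraction kappa_nonneg wasserstein1_nonneg[OF \<rho> \<mu>] by (intro mult_mono) auto
    then have "wasserstein1 (P \<rho>) (\<mu> (Suc n)) \<le> \<kappa> ^ n"
      using self_consistent_transfer_contraction[OF \<rho> \<mu>[of n]] by (simp add: \<mu>_Suc)
    then have "\<bar>(\<integral>x. g x \<partial>P \<rho>) - (\<integral>x. g x \<partial>\<mu> (Suc n))\<bar> \<le> \<kappa> ^ n"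
      using abs_integral_diff_le_wasserstein1[OF self_consistent_transfer_prob[OF \<rho>] \<mu>[of "Suc n"] _ g] by simp
    moreover have "\<kappa> ^ Suc n \<le> \<kappa> ^ n"
      using contraction kappa_nonneg by (intro power_decreasing) auto
    with close[OF g, of "Suc n"] have "\<bar>(\<integral>x. g x \<partial>\<mu> (Suc n)) - (\<integral>x. g x \<partial>\<rho>)\<bar> \<le> \<kappa> ^ n"
      by (rule order.trans)
    ultimately show "(\<integral>x. g x \<partial>P \<rho>) - (\<integral>x. g x \<partial>\<rho>) \<le> 2 * \<kappa> ^ n"
      by linarith
  qed
  moreover have "(\<lambda>n. 2 * \<kappa> ^ n) \<longlonglongrightarrow> 2 * 0"
    using contraction kappa_nonneg by (intro tendsto_mult tendsto_const LIMSEQ_realpow_zero)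
  ultimately have "wasserstein1 (P \<rho>) \<rho> \<le> 0"
    by (intro LIMSEQ_le_const[where X = "\<lambda>n. 2 * \<kappa> ^ n"]) auto
  then have "P \<rho> = \<rho>"
    by (rule wasserstein1_le_0_imp_eq[OF self_consistent_transfer_prob[OF \<rho>] \<rho>])
  with \<rho> show ?thesis
    by blast
qed

end

section \<open>The particle system\<close>

lemma Lip_coord_le_iff:
  assumes L: "0 \<le> L"
  shows "Lip_coord N i g \<le> ennreal L \<longleftrightarrow>
    (\<forall>x\<in>torus_points N. \<forall>a b. \<bar>g (x(i := a)) - g (x(i := b))\<bar> \<le> L * dist a b)" (is "_ \<longleftrightarrow> ?R")
proof -
  have "\<bar>g (x(i := a)) - g (x(i := b))\<bar> / dist a b \<le> L \<longleftrightarrow> \<bar>g (x(i := a)) - g (x(i := b))\<bar> \<le> L * dist a b"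
    if "a \<noteq> b" for x a b
    using that by (simp add: pos_divide_le_eq)
  then have "Lip_coord N i g \<le> ennreal L \<longleftrightarrow>
      (\<forall>x\<in>torus_points N. \<forall>a b. a \<noteq> b \<longrightarrow> \<bar>g (x(i := a)) - g (x(i := b))\<bar> \<le> L * dist a b)"
    using L by (auto simp: Lip_coord_def SUP_le_iff ennreal_le_iff)
  also have "\<dots> \<longleftrightarrow> ?R"
    by (metis abs_zero diff_self dist_self mult_zero_right order.refl)
  finally show ?thesis .
qed

lemma coord_lipschitz_Lip_coord:
  assumes "\<And>i. i < N \<Longrightarrow> Lip_coord N i g < \<top>"
  shows "coord_lipschitz {..<N} (\<lambda>i. enn2real (Lip_coord N i g)) g"
  unfolding coord_lipschitz_def
proof (intro ballI conjI)
  fix i x assume "i \<in> {..<N}" and x: "x \<in> torus_points N"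
  with assms have "Lip_coord N i g \<le> ennreal (enn2real (Lip_coord N i g))"
    by simp
  with x show "\<forall>a b. \<bar>g (x(i := a)) - g (x(i := b))\<bar> \<le> enn2real (Lip_coord N i g) * dist a b"
    by (subst (asm) Lip_coord_le_iff) auto
qed simp

lemma Lip_coord_le:
  assumes "coord_lipschitz {..<N} L g" "i < N"
  shows "Lip_coord N i g \<le> ennreal (L i)"
  using coord_lipschitzD[OF assms(1), of i] assms(2) by (subst Lip_coord_le_iff) auto

lemma Lip_sum_le_1:
  assumes "Lip_sum N g \<le> 1"
  shows "coord_lipschitz {..<N} (\<lambda>i. enn2real (Lip_coord N i g)) g"
    and "(\<Sum>i<N. enn2real (Lip_coord N i g)) \<le> 1"
proof -
  have le: "Lip_coord N i g \<le> 1" if "i < N" for i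
    using assms member_le_sum[of i "{..<N}" "\<lambda>i. Lip_coord N i g"] that
    by (auto simp: Lip_sum_def intro: order.trans)
  then have fin: "Lip_coord N i g < \<top>" if "i < N" for i
    using that by (meson ennreal_one_less_top order.strict_trans1)
  then show "coord_lipschitz {..<N} (\<lambda>i. enn2real (Lip_coord N i g)) g"
    by (rule coord_lipschitz_Lip_coord)
  have "ennreal (\<Sum>i<N. enn2real (Lip_coord N i g)) = Lip_sum N g"
    using fin by (simp add: Lip_sum_def sum_ennreal[symmetric])
  with assms have "ennreal (\<Sum>i<N. enn2real (Lip_coord N i g)) \<le> ennreal 1"
    by simp
  then show "(\<Sum>i<N. enn2real (Lip_coord N i g)) \<le> 1"
    by (subst (asm) ennreal_le_iff) auto
qed

lemma Lip_sum_le: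
  assumes "coord_lipschitz {..<N} L g"
  shows "Lip_sum N g \<le> ennreal (\<Sum>i<N. L i)"
proof -
  have "Lip_sum N g \<le> (\<Sum>i<N. ennreal (L i))"
    unfolding Lip_sum_def using Lip_coord_le[OF assms] by (intro sum_mono) auto
  then show ?thesis
    using coord_lipschitzD(1)[OF assms] by (subst (asm) sum_ennreal) auto
qed

lemma wasserstein_least:
  assumes "\<And>g L. coord_lipschitz {..<N} L g \<Longrightarrow> (\<Sum>i<N. L i) \<le> 1 \<Longrightarrow> (\<integral>x. g x \<partial>\<mu>) - (\<integral>x. g x \<partial>\<nu>) \<le> B"
  shows "wasserstein N \<mu> \<nu> \<le> B"
  unfolding wasserstein_def
proof (rule cSUP_least)
  have "Lip_sum N (\<lambda>_. 0) \<le> ennreal (\<Sum>i<N. 0)"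
    by (rule Lip_sum_le) (simp add: coord_lipschitz_def)
  then have "(\<lambda>_. 0) \<in> {g. Lip_sum N g \<le> 1}"
    by simp
  then show "{g. Lip_sum N g \<le> 1} \<noteq> {}"
    by blast
qed (use assms[OF Lip_sum_le_1] in simp)

lemma space_torus: "space (torus N) = torus_points N"
  by (simp add: torus_def space_PiM)

lemma measurable_torus:
  fixes g :: "(nat \<Rightarrow> circle) \<Rightarrow> real"
  assumes "coord_lipschitz {..<N} L g"
  shows "g \<in> borel_measurable (torus N)"
  using measurable_coord_lipschitz[OF assms] by (simp add: torus_def)

lemma torus_points_nonempty: "torus_points N \<noteq> {}"
  by (simp add: PiE_eq_empty_iff)

lemma coord_lipschitz_bounded:
  fixes g :: "(nat \<Rightarrow> circle) \<Rightarrow> real"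
  assumes "coord_lipschitz {..<N} L g"
  obtains B where "\<And>x. x \<in> torus_points N \<Longrightarrow> \<bar>g x\<bar> \<le> B"
proof -
  obtain x0 where x0: "x0 \<in> torus_points N"
    using torus_points_nonempty by blast
  have "\<bar>g x\<bar> \<le> \<bar>g x0\<bar> + (\<Sum>i<N. L i)" if "x \<in> torus_points N" for x
    using coord_lipschitz_osc[OF assms _ that x0] by simp
  then show ?thesis
    by (rule that)
qed

lemma integral_diff_le_wasserstein:
  assumes \<mu>: "\<mu> \<in> prob_measures (torus N)" and \<nu>: "\<nu> \<in> prob_measures (torus N)"
    and g: "coord_lipschitz {..<N} L g"
  shows "(\<integral>x. g x \<partial>\<mu>) - (\<integral>x. g x \<partial>\<nu>) \<le> (\<Sum>i<N. L i) * wasserstein N \<mu> \<nu>"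
proof -
  have diff: "\<bar>(\<integral>x. g x \<partial>\<mu>) - (\<integral>x. g x \<partial>\<nu>)\<bar> \<le> (\<Sum>i<N. L i)" if "coord_lipschitz {..<N} L g" for L g
    using that by (intro abs_integral_diff_le_osc[OF \<mu> \<nu>] measurable_torus)
      (auto simp: space_torus intro: coord_lipschitz_osc)
  have s: "0 \<le> (\<Sum>i<N. L i)"
    using coord_lipschitzD(1)[OF g] by (intro sum_nonneg) auto
  show ?thesis
  proof (cases "(\<Sum>i<N. L i) = 0")
    case True
    with diff[OF g] show ?thesis
      by simp
  next
    case False
    with s have s: "0 < (\<Sum>i<N. L i)"
      by simp
    have "(\<integral>x. g x / (\<Sum>i<N. L i) \<partial>\<mu>) - (\<integral>x. g x / (\<Sum>i<N. L i) \<partial>\<nu>) \<le> wasserstein N \<mu> \<nu>"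
      unfolding wasserstein_def
    proof (rule cSUP_upper)
      have "coord_lipschitz {..<N} (\<lambda>i. L i / (\<Sum>i<N. L i)) (\<lambda>x. g x / (\<Sum>i<N. L i))"
        using g s by (auto simp: coord_lipschitz_def diff_divide_distrib[symmetric] divide_right_mono)
      from Lip_sum_le[OF this] s show "(\<lambda>x. g x / (\<Sum>i<N. L i)) \<in> {g. Lip_sum N g \<le> 1}"
        by (simp add: sum_divide_distrib[symmetric])
      have "(\<integral>x. g x \<partial>\<mu>) - (\<integral>x. g x \<partial>\<nu>) \<le> 1" if "Lip_sum N g \<le> 1" for g
        using diff[OF Lip_sum_le_1(1)[OF that]] Lip_sum_le_1(2)[OF that] by linarith
      then show "bdd_above ((\<lambda>g. (\<integral>x. g x \<partial>\<mu>) - (\<integral>x. g x \<partial>\<nu>)) ` {g. Lip_sum N g \<le> 1})"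
        by (auto intro!: bdd_aboveI2)
    qed
    then show ?thesis
      using s by (simp add: diff_divide_distrib[symmetric] pos_divide_le_eq mult.commute)
  qed
qed

section \<open>Product kernels on the torus\<close>

context noise
begin

lemma integral_PiM_law_diff:
  fixes g :: "('i \<Rightarrow> circle) \<Rightarrow> real"
  assumes g: "coord_lipschitz I L g" and I: "finite I"
  shows "\<bar>(\<integral>x. g x \<partial>(\<Pi>\<^sub>M i\<in>I. law (z i))) - (\<integral>x. g x \<partial>(\<Pi>\<^sub>M i\<in>I. law (z' i)))\<bar>
    \<le> (\<Sum>i\<in>I. (1 - c) * L i * \<bar>z i - z' i\<bar>)"
proof -
  \<comment> \<open>Telescoping over coordinates is stated for extensional vectors, while the
    product measure only sees z on I.\<close>
  have "(\<Pi>\<^sub>M i\<in>I. law (z i)) = (\<Pi>\<^sub>M i\<in>I. law (restrict z I i))" for z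
    by (intro PiM_cong) auto
  moreover have "(\<Sum>i\<in>I. (1 - c) * L i * dist (restrict z I i) (restrict z' I i))
      = (\<Sum>i\<in>I. (1 - c) * L i * \<bar>z i - z' i\<bar>)"
    by (intro sum.cong) (auto simp: dist_real_def)
  ultimately show ?thesis
    using coord_lipschitz_sum[OF coord_lipschitz_integral_law[OF g I] I, of "restrict z I" "restrict z' I"]
    by simp
qed

definition torus_kernel :: "nat \<Rightarrow> ((nat \<Rightarrow> circle) \<Rightarrow> nat \<Rightarrow> real) \<Rightarrow> (nat \<Rightarrow> circle) \<Rightarrow> (nat \<Rightarrow> circle) \<Rightarrow> ennreal"
  where "torus_kernel N F u x = (\<Prod>j<N. ennreal (periodic_ext p (circle_coord (x j) - F u j)))"

lemma sets_torus_lebesgue [measurable_cong]: "sets (torus_lebesgue N) = sets (torus N)"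
  unfolding torus_lebesgue_def torus_def by (intro sets_PiM_cong) auto

lemma prob_measures_torus_lebesgue: "prob_measures (torus_lebesgue N) = prob_measures (torus N)"
  by (simp add: space_prob_algebra sets_torus_lebesgue)

text \<open>Given the previous state, the new coordinates are independent. This is what opens the
  way to coordinatewise estimates and to the bounded differences inequality.\<close>

lemma density_torus_kernel:
  "density (torus_lebesgue N) (torus_kernel N F u) = (\<Pi>\<^sub>M j\<in>{..<N}. law (F u j))"
  unfolding law_def torus_lebesgue_def torus_kernel_def[abs_def]
proof (rule PiM_density[symmetric, where M = "\<lambda>_. circle_lebesgue"
      and f = "\<lambda>j x. ennreal (periodic_ext p (circle_coord x - F u j))"])
  show "product_sigma_finite (\<lambda>_. circle_lebesgue)"
    by (simp add: product_sigma_finite_def prob_space_circle_lebesgue prob_space_imp_sigma_finite)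
  show "sigma_finite_measure (density circle_lebesgue (\<lambda>x. ennreal (periodic_ext p (circle_coord x - F u j))))" for j
    using prob_space_law[of "F u j"] by (simp add: law_def prob_space_imp_sigma_finite)
  show "(\<lambda>x. ennreal (periodic_ext p (circle_coord x - F u j))) \<in> borel_measurable circle_lebesgue" for j
    by measurable
qed simp

text \<open>The source S may be any measure with the right sigma-algebra: \<open>torus N\<close> for
  integration formulas, \<open>torus_lebesgue N\<close> for the Doeblin argument, where source and
  reference measure coincide.\<close>

lemma density_kernel_torus:
  assumes S [measurable_cong]: "sets S = sets (torus N)"
    and F [measurable]: "\<And>j. j < N \<Longrightarrow> (\<lambda>u. F u j) \<in> borel_measurable (torus N)"
  shows "density_kernel (torus_lebesgue N) S (torus_kernel N F)"
proof -
  interpret prob_space "torus_lebesgue N"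
    unfolding torus_lebesgue_def by (intro prob_space_PiM prob_space_circle_lebesgue)
  show ?thesis
  proof
    have [measurable]: "(\<lambda>x. x j) \<in> torus N \<rightarrow>\<^sub>M borel" if "j < N" for j
      using that unfolding torus_def by (intro measurable_component_singleton) simp
    show "case_prod (torus_kernel N F) \<in> borel_measurable (S \<Otimes>\<^sub>M torus_lebesgue N)"
      unfolding torus_kernel_def[abs_def] case_prod_beta' by measurable
    fix u assume "u \<in> space S"
    then have u: "u \<in> space (torus N)"
      using sets_eq_imp_space_eq[OF S] by simp
    have m: "torus_kernel N F u \<in> borel_measurable (torus_lebesgue N)"
      unfolding torus_kernel_def[abs_def] by measurable
    have "prob_space (density (torus_lebesgue N) (torus_kernel N F u))"
      unfolding density_torus_kernel by (intro prob_space_PiM prob_space_law)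
    from prob_space.emeasure_space_1[OF this] m
    show "(\<integral>\<^sup>+x. torus_kernel N F u x \<partial>torus_lebesgue N) = 1"
      by (simp add: emeasure_density cong: nn_integral_cong_simp)
  qed
qed

lemma torus_kernel_ge: "ennreal (c ^ N) \<le> torus_kernel N F u x"
proof -
  have "ennreal (c ^ N) = (\<Prod>j<N. ennreal c)"
    using c_pos by (simp add: ennreal_power)
  also have "\<dots> \<le> torus_kernel N F u x"
    unfolding torus_kernel_def using p_gt by (intro prod_mono_ennreal ennreal_leI) (auto intro: less_imp_le)
  finally show ?thesis .
qed

end

section \<open>The particle drift and the transfer of Lipschitz constants\<close>

context mean_field
begin

definition particle_drift :: "nat \<Rightarrow> (nat \<Rightarrow> circle) \<Rightarrow> nat \<Rightarrow> real"
  where "particle_drift N u j = f (u j) + (1 / real N) * (\<Sum>k<N. h (u j, u k))"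

abbreviation P\<^sub>N :: "nat \<Rightarrow> (nat \<Rightarrow> circle) measure \<Rightarrow> (nat \<Rightarrow> circle) measure"
  where "P\<^sub>N \<equiv> transfer_N f h p"

lemma h_lipschitz: "\<bar>h (x, y) - h (x', y')\<bar> \<le> b\<^sub>1 * dist x x' + b\<^sub>2 * dist y y'"
  using h_lipschitz1[of x y x'] h_lipschitz2[of x' y y'] by linarith

text \<open>Particle i enters its own drift through f and the first variable of h, and every drift,
  its own included, through one of the N summands in the second variable.\<close>

lemma particle_drift_update:
  assumes i: "i < N"
  shows "\<bar>particle_drift N (u(i := x)) j - particle_drift N (u(i := y)) j\<bar>
    \<le> ((if i = j then a + b\<^sub>1 else 0) + b\<^sub>2 / real N) * dist x y"
proof -
  let ?d = "\<lambda>k. if k = i then dist x y else 0"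
  have d: "dist ((u(i := x)) k) ((u(i := y)) k) = ?d k" for k
    by simp
  have N: "0 < real N"
    using i by simp
  have "particle_drift N (u(i := x)) j - particle_drift N (u(i := y)) j
      = (f ((u(i := x)) j) - f ((u(i := y)) j)) + (1 / real N) *
        (\<Sum>k<N. h ((u(i := x)) j, (u(i := x)) k) - h ((u(i := y)) j, (u(i := y)) k))"
    by (simp only: particle_drift_def sum_subtractf right_diff_distrib)
  also have "\<bar>\<dots>\<bar> \<le> a * ?d j + (1 / real N) * (\<Sum>k<N. b\<^sub>1 * ?d j + b\<^sub>2 * ?d k)"
  proof (rule order.trans[OF abs_triangle_ineq add_mono])
    show "\<bar>f ((u(i := x)) j) - f ((u(i := y)) j)\<bar> \<le> a * ?d j"
      using f_lipschitz[of "(u(i := x)) j" "(u(i := y)) j"] unfolding d .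
    have "\<bar>\<Sum>k<N. h ((u(i := x)) j, (u(i := x)) k) - h ((u(i := y)) j, (u(i := y)) k)\<bar>
        \<le> (\<Sum>k<N. b\<^sub>1 * ?d j + b\<^sub>2 * ?d k)"
    proof (intro order.trans[OF sum_abs] sum_mono)
      show "\<bar>h ((u(i := x)) j, (u(i := x)) k) - h ((u(i := y)) j, (u(i := y)) k)\<bar> \<le> b\<^sub>1 * ?d j + b\<^sub>2 * ?d k" for k
        using h_lipschitz[of "(u(i := x)) j" "(u(i := x)) k" "(u(i := y)) j" "(u(i := y)) k"] unfolding d .
    qed
    then show "\<bar>(1 / real N) * (\<Sum>k<N. h ((u(i := x)) j, (u(i := x)) k) - h ((u(i := y)) j, (u(i := y)) k))\<bar>
        \<le> (1 / real N) * (\<Sum>k<N. b\<^sub>1 * ?d j + b\<^sub>2 * ?d k)"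
      using N by (simp add: abs_mult divide_right_mono)
  qed
  also have "\<dots> = ((if i = j then a + b\<^sub>1 else 0) + b\<^sub>2 / real N) * dist x y"
    using N i by (auto simp: sum.distrib sum_distrib_left[symmetric] field_simps)
  finally show ?thesis .
qed

lemma measurable_particle_drift:
  assumes N: "0 < N"
  shows "(\<lambda>u. particle_drift N u j) \<in> borel_measurable (torus N)"
proof (rule measurable_torus)
  show "coord_lipschitz {..<N} (\<lambda>i. (if i = j then a + b\<^sub>1 else 0) + b\<^sub>2 / real N) (\<lambda>u. particle_drift N u j)"
    using nonneg particle_drift_update by (auto simp: coord_lipschitz_def)
qed

lemma transfer_N_eq_push:
  assumes "0 < N"
  shows "P\<^sub>N N \<mu> = density_kernel.push (torus_lebesgue N) (torus_kernel N (particle_drift N)) \<mu>"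
  unfolding density_kernel.push_def[OF density_kernel_torus[OF refl measurable_particle_drift[OF assms]]]
  by (simp add: transfer_N_def torus_kernel_def particle_drift_def diff_diff_eq)

lemma transfer_N_prob:
  assumes N: "0 < N" and \<mu>: "\<mu> \<in> prob_measures (torus N)"
  shows "P\<^sub>N N \<mu> \<in> prob_measures (torus N)"
  using density_kernel.push_in_prob_algebra[OF density_kernel_torus[OF refl measurable_particle_drift[OF N]] \<mu>]
  by (simp add: transfer_N_eq_push[OF N] prob_measures_torus_lebesgue)

lemma transfer_N_fixed_point:
  assumes N: "0 < N"
  shows "\<exists>!\<mu>. \<mu> \<in> prob_measures (torus N) \<and> P\<^sub>N N \<mu> = \<mu>"
  unfolding transfer_N_eq_push[OF N] prob_measures_torus_lebesgue[symmetric]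
  using c_pos
  by (intro doeblin_fixed_point[where \<epsilon> = "ennreal (c ^ N)"] torus_kernel_ge
      density_kernel_torus measurable_particle_drift N sets_torus_lebesgue) simp

lemma integral_transfer_N:
  fixes g :: "(nat \<Rightarrow> circle) \<Rightarrow> real"
  assumes N: "0 < N" and \<mu>: "\<mu> \<in> prob_measures (torus N)"
    and g: "g \<in> borel_measurable (torus N)" "\<And>x. x \<in> torus_points N \<Longrightarrow> \<bar>g x\<bar> \<le> B"
  shows "(\<integral>x. g x \<partial>P\<^sub>N N \<mu>) = (\<integral>u. \<integral>x. g x \<partial>(\<Pi>\<^sub>M j\<in>{..<N}. law (particle_drift N u j)) \<partial>\<mu>)"
    and "(\<lambda>u. \<integral>x. g x \<partial>(\<Pi>\<^sub>M j\<in>{..<N}. law (particle_drift N u j))) \<in> borel_measurable (torus N)"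
proof -
  have sp: "space (torus_lebesgue N) = torus_points N"
    using sets_eq_imp_space_eq[OF sets_torus_lebesgue] by (simp add: space_torus)
  have K: "density_kernel (torus_lebesgue N) (torus N) (torus_kernel N (particle_drift N))"
    by (intro density_kernel_torus refl measurable_particle_drift N)
  have m: "g \<in> borel_measurable (torus_lebesgue N)"
    using g(1) measurable_cong_sets[OF sets_torus_lebesgue refl] by blast
  show "(\<integral>x. g x \<partial>P\<^sub>N N \<mu>) = (\<integral>u. \<integral>x. g x \<partial>(\<Pi>\<^sub>M j\<in>{..<N}. law (particle_drift N u j)) \<partial>\<mu>)"
    unfolding transfer_N_eq_push[OF N] density_torus_kernel[symmetric]
    using g(2) by (intro density_kernel.integral_push(1)[OF K \<mu> m]) (simp add: sp)
  show "(\<lambda>u. \<integral>x. g x \<partial>(\<Pi>\<^sub>M j\<in>{..<N}. law (particle_drift N u j))) \<in> borel_measurable (torus N)"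
    unfolding density_torus_kernel[symmetric]
    using g(2) by (intro density_kernel.integral_push(2)[OF K \<mu> m]) (simp add: sp)
qed

text \<open>A bound for the Lipschitz constant, in coordinate i, of the expected value of g after
  one step as a function of the current state.\<close>

definition transferred_lip :: "nat \<Rightarrow> (nat \<Rightarrow> real) \<Rightarrow> nat \<Rightarrow> real"
  where "transferred_lip N L i = (1 - c) * ((a + b\<^sub>1) * L i + b\<^sub>2 / real N * (\<Sum>j<N. L j))"

lemma coord_lipschitz_transfer:
  assumes g: "coord_lipschitz {..<N} L g"
  shows "coord_lipschitz {..<N} (transferred_lip N L)
    (\<lambda>u. \<integral>x. g x \<partial>(\<Pi>\<^sub>M j\<in>{..<N}. law (particle_drift N u j)))"
proof -
  have L: "0 \<le> L i" if "i < N" for i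
    using coord_lipschitzD(1)[OF g] that by simp
  have "0 \<le> transferred_lip N L i" if "i < N" for i
    unfolding transferred_lip_def using L nonneg c_le_1 that
    by (intro mult_nonneg_nonneg add_nonneg_nonneg sum_nonneg divide_nonneg_nonneg) auto
  moreover have "\<bar>(\<integral>y. g y \<partial>(\<Pi>\<^sub>M j\<in>{..<N}. law (particle_drift N (u(i := x)) j)))
      - (\<integral>y. g y \<partial>(\<Pi>\<^sub>M j\<in>{..<N}. law (particle_drift N (u(i := x')) j)))\<bar> \<le> transferred_lip N L i * dist x x'"
    if i: "i < N" for i u x x'
  proof -
    have "\<bar>(\<integral>y. g y \<partial>(\<Pi>\<^sub>M j\<in>{..<N}. law (particle_drift N (u(i := x)) j)))
        - (\<integral>y. g y \<partial>(\<Pi>\<^sub>M j\<in>{..<N}. law (particle_drift N (u(i := x')) j)))\<bar>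
        \<le> (\<Sum>j<N. (1 - c) * L j * \<bar>particle_drift N (u(i := x)) j - particle_drift N (u(i := x')) j\<bar>)"
      by (rule integral_PiM_law_diff[OF g]) simp
    also have "\<dots> \<le> (\<Sum>j<N. (1 - c) * L j * (((if i = j then a + b\<^sub>1 else 0) + b\<^sub>2 / real N) * dist x x'))"
      using L c_le_1 by (intro sum_mono mult_left_mono particle_drift_update i) auto
    also have "\<dots> = (\<Sum>j<N. (if i = j then (1 - c) * (a + b\<^sub>1) * L j * dist x x' else 0)
        + (1 - c) * (b\<^sub>2 / real N) * dist x x' * L j)"
      by (intro sum.cong) (auto simp: algebra_simps)
    also have "\<dots> = (1 - c) * (a + b\<^sub>1) * L i * dist x x' + (1 - c) * (b\<^sub>2 / real N) * dist x x' * (\<Sum>j<N. L j)"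
      using i by (simp add: sum.distrib sum_distrib_left)
    also have "\<dots> = transferred_lip N L i * dist x x'"
      by (simp add: transferred_lip_def algebra_simps)
    finally show ?thesis .
  qed
  ultimately show ?thesis
    unfolding coord_lipschitz_def by blast
qed

lemma sum_transferred_lip:
  assumes N: "0 < N"
  shows "(\<Sum>i<N. transferred_lip N L i) = \<kappa> * (\<Sum>i<N. L i)"
proof -
  have "(\<Sum>i<N. transferred_lip N L i)
      = (1 - c) * ((a + b\<^sub>1) * (\<Sum>i<N. L i) + real N * (b\<^sub>2 / real N * (\<Sum>j<N. L j)))"
    by (simp add: transferred_lip_def sum_distrib_left[symmetric] sum.distrib)
  then show ?thesis
    using N by (simp add: algebra_simps)
qed

text \<open>After expanding the square, the mean-field terms contain the squared sum of the
  constants divided by N. By Cauchy-Schwarz this is at most the sum of their squares, with equality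
  for constant L.\<close>

lemma sum_squares_transferred_lip:
  assumes N: "0 < N"
  shows "(\<Sum>i<N. (transferred_lip N L i)\<^sup>2) \<le> \<kappa>\<^sup>2 * (\<Sum>i<N. (L i)\<^sup>2)"
proof -
  define A where "A = a + b\<^sub>1"
  define q where "q = b\<^sub>2 / real N * (\<Sum>i<N. L i)"
  define s S where "s = (\<Sum>i<N. L i)" and "S = (\<Sum>i<N. (L i)\<^sup>2)"
  have cs: "s\<^sup>2 / real N \<le> S"
    using sum_squared_le_sum_of_squares[of L "{..<N}"] N
    by (simp add: s_def S_def pos_divide_le_eq mult.commute)
  have "(\<Sum>i<N. (transferred_lip N L i)\<^sup>2)
      = (\<Sum>i<N. (1 - c)\<^sup>2 * (A\<^sup>2 * (L i)\<^sup>2 + 2 * A * q * L i + q\<^sup>2))"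
    unfolding transferred_lip_def A_def[symmetric] q_def[symmetric]
    by (simp add: power_mult_distrib power2_sum ac_simps)
  also have "\<dots> = (1 - c)\<^sup>2 * (A\<^sup>2 * S + 2 * A * q * s + real N * q\<^sup>2)"
    by (simp add: sum_distrib_left[symmetric] sum.distrib s_def[symmetric] S_def[symmetric])
  also have "\<dots> = (1 - c)\<^sup>2 * (A\<^sup>2 * S + (2 * A * b\<^sub>2 + b\<^sub>2\<^sup>2) * (s\<^sup>2 / real N))"
    using N by (simp add: q_def s_def[symmetric] field_simps power2_eq_square)
  also have "\<dots> \<le> (1 - c)\<^sup>2 * (A\<^sup>2 * S + (2 * A * b\<^sub>2 + b\<^sub>2\<^sup>2) * S)"
    using cs nonneg by (intro mult_left_mono add_left_mono) (auto simp: A_def)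
  also have "\<dots> = \<kappa>\<^sup>2 * S"
    by (simp add: A_def power_mult_distrib power2_eq_square algebra_simps)
  finally show ?thesis
    by (simp add: S_def)
qed

end

section \<open>Comparison with the product measure\<close>

context mean_field
begin

text \<open>Under the product measure this is centred in the variable u k if k differs from j. The
  self-interaction term k = j need not be centred.\<close>

definition fluctuation :: "circle measure \<Rightarrow> nat \<Rightarrow> nat \<Rightarrow> (nat \<Rightarrow> circle) \<Rightarrow> real"
  where "fluctuation \<rho> j k u = h (u j, u k) - (\<integral>v. h (u j, v) \<partial>\<rho>)"

context
  fixes \<rho> :: "circle measure" and N :: nat
  assumes \<rho>: "\<rho> \<in> prob_measures borel" and N: "0 < N"
begin

lemma sets_rho: "sets \<rho> = sets borel"
  using \<rho> by (simp add: space_prob_algebra)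

lemma prob_space_rho: "prob_space \<rho>"
  using \<rho> by (simp add: space_prob_algebra)

lemma sets_tensor_power: "sets (tensor_power N \<rho>) = sets (torus N)"
  unfolding torus_def using sets_rho by (intro sets_PiM_cong) auto

lemma tensor_power_prob: "tensor_power N \<rho> \<in> prob_measures (torus N)"
  using prob_space_rho by (simp add: space_prob_algebra sets_tensor_power prob_space_PiM)

lemma measurable_tensor_power: "borel_measurable (tensor_power N \<rho>) = borel_measurable (torus N)"
  by (rule measurable_cong_sets[OF sets_tensor_power refl])

lemma integrable_h: "integrable \<rho> (\<lambda>v. h (x, v))"
proof (rule integrable_bounded)
  show "finite_measure \<rho>"
    using prob_space_rho by (rule prob_space.finite_measure)
  show "(\<lambda>v. h (x, v)) \<in> borel_measurable \<rho>"
    using measurable_if_lipschitz[of "\<lambda>v. h (x, v)", OF h_lipschitz2]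
    by (simp add: measurable_cong_sets[OF sets_rho refl])
qed (rule lipschitz_bounded[of "\<lambda>v. h (x, v)", OF h_lipschitz2])

lemma fluctuation_bounded: "\<bar>fluctuation \<rho> j k u\<bar> \<le> b\<^sub>2"
proof -
  interpret prob_space \<rho>
    by (rule prob_space_rho)
  have "fluctuation \<rho> j k u = (\<integral>v. h (u j, u k) - h (u j, v) \<partial>\<rho>)"
    using integrable_h[of "u j"] by (simp add: fluctuation_def prob_space)
  also have "\<bar>\<dots>\<bar> \<le> b\<^sub>2"
    using integrable_h[of "u j"]
    by (intro abs_integral_le_bound[OF prob_space_axioms] lipschitz_osc[OF nonneg(3) h_lipschitz2]) auto
  finally show ?thesis .
qed

lemma measurable_fluctuation:
  assumes j: "j < N" and k: "k < N"
  shows "fluctuation \<rho> j k \<in> borel_measurable (torus N)"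
proof -
  have "coord_lipschitz {..<N} (\<lambda>_. b\<^sub>1 + b\<^sub>2) (\<lambda>u. h (u j, u k))"
    unfolding coord_lipschitz_def
  proof (intro ballI conjI allI)
    fix i and u :: "nat \<Rightarrow> circle" and x y :: circle
    have "b\<^sub>1 * dist ((u(i := x)) j) ((u(i := y)) j) + b\<^sub>2 * dist ((u(i := x)) k) ((u(i := y)) k)
        \<le> (b\<^sub>1 + b\<^sub>2) * dist x y"
      using nonneg by (simp add: distrib_right)
    then show "\<bar>h ((u(i := x)) j, (u(i := x)) k) - h ((u(i := y)) j, (u(i := y)) k)\<bar> \<le> (b\<^sub>1 + b\<^sub>2) * dist x y"
      by (rule order.trans[OF h_lipschitz])
  qed (use nonneg in simp)
  then have h_meas: "(\<lambda>u. h (u j, u k)) \<in> borel_measurable (torus N)"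
    by (rule measurable_torus)
  have "(\<lambda>x. \<integral>v. h (x, v) \<partial>\<rho>) = (\<lambda>x. drift \<rho> x - f x)"
    by (simp add: drift_def)
  then have "(\<lambda>x. \<integral>v. h (x, v) \<partial>\<rho>) \<in> borel_measurable borel"
    using measurable_drift[OF \<rho>] measurable_if_lipschitz[OF f_lipschitz] by simp
  moreover have "(\<lambda>u. u j) \<in> torus N \<rightarrow>\<^sub>M borel"
    using j unfolding torus_def by (intro measurable_component_singleton) simp
  ultimately have "(\<lambda>u. \<integral>v. h (u j, v) \<partial>\<rho>) \<in> borel_measurable (torus N)"
    by (rule measurable_compose[rotated])
  with h_meas show ?thesis
    unfolding fluctuation_def[abs_def] by simp
qed

text \<open>Integrate over u k first: neither the other factor nor the subtracted mean involves u k,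
  so the centring makes the inner integral vanish.\<close>

lemma fluctuation_uncorrelated_aux:
  assumes j: "j < N" and k: "k < N" and l: "l < N" and kj: "k \<noteq> j" and kl: "k \<noteq> l"
  shows "(\<integral>u. fluctuation \<rho> j k u * fluctuation \<rho> j l u \<partial>tensor_power N \<rho>) = 0"
proof -
  interpret product_prob_space "\<lambda>_ :: nat. \<rho>" "{..<N}"
    by (intro product_prob_spaceI prob_space_rho)
  have "(\<integral>u. fluctuation \<rho> j k u * fluctuation \<rho> j l u \<partial>tensor_power N \<rho>)
      = (\<integral>u. \<integral>v. fluctuation \<rho> j k (u(k := v)) * fluctuation \<rho> j l (u(k := v)) \<partial>\<rho> \<partial>tensor_power N \<rho>)"
  proof (rule integral_PiM_coordinate(1))
    show "(\<lambda>u. fluctuation \<rho> j k u * fluctuation \<rho> j l u) \<in> borel_measurable (tensor_power N \<rho>)"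
      using measurable_fluctuation j k l by (simp add: measurable_tensor_power)
    show "\<bar>fluctuation \<rho> j k u * fluctuation \<rho> j l u\<bar> \<le> b\<^sub>2 * b\<^sub>2" for u
      unfolding abs_mult using nonneg by (intro mult_mono fluctuation_bounded) auto
  qed (use k in auto)
  also have "\<dots> = (\<integral>u. (\<integral>v. h (u j, v) - (\<integral>v. h (u j, v) \<partial>\<rho>) \<partial>\<rho>) * fluctuation \<rho> j l u \<partial>tensor_power N \<rho>)"
    using kj kl by (simp add: fluctuation_def)
  also have "\<dots> = 0"
    using integrable_h by (simp add: prob_space.prob_space[OF prob_space_rho])
  finally show ?thesis .
qed

text \<open>Of two distinct indices at least one differs from j and provides the centred factor. So
  even the self-interaction term is uncorrelated with all others.\<close>

lemma fluctuation_uncorrelated: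
  assumes "j < N" "k < N" "l < N" "k \<noteq> l"
  shows "(\<integral>u. fluctuation \<rho> j k u * fluctuation \<rho> j l u \<partial>tensor_power N \<rho>) = 0"
  using fluctuation_uncorrelated_aux[of j k l] fluctuation_uncorrelated_aux[of j l k] assms
  by (cases "k = j") (auto simp: mult.commute)

lemma particle_drift_minus_drift:
  "particle_drift N u j - drift \<rho> (u j) = (\<Sum>k<N. fluctuation \<rho> j k u) / real N"
  using N by (simp add: particle_drift_def drift_def fluctuation_def sum_subtractf diff_divide_distrib)

text \<open>An average of N pairwise uncorrelated terms bounded by b2 has second moment at most b2^2
  / N, since only the diagonal survives; the first moment follows.\<close>

lemma expected_drift_deviation:
  assumes j: "j < N"
  shows "(\<integral>u. \<bar>particle_drift N u j - drift \<rho> (u j)\<bar> \<partial>tensor_power N \<rho>) \<le> b\<^sub>2 / sqrt (real N)"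
    and "integrable (tensor_power N \<rho>) (\<lambda>u. \<bar>particle_drift N u j - drift \<rho> (u j)\<bar>)"
proof -
  interpret Q: prob_space "tensor_power N \<rho>"
    by (intro prob_space_PiM prob_space_rho)
  define Y where "Y = fluctuation \<rho> j"
  have Y_meas [measurable]: "Y k \<in> borel_measurable (tensor_power N \<rho>)" if "k < N" for k
    using measurable_fluctuation[OF j that] by (simp add: Y_def measurable_tensor_power)
  have YY_bd: "\<bar>Y k u * Y l u\<bar> \<le> b\<^sub>2 * b\<^sub>2" for k l u
    unfolding Y_def abs_mult using nonneg by (intro mult_mono fluctuation_bounded) auto
  have YY_int: "integrable (tensor_power N \<rho>) (\<lambda>u. Y k u * Y l u)" if "k < N" "l < N" for k l
    using that YY_bd by (intro integrable_bounded[OF Q.finite_measure_axioms]) auto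
  have YY: "(\<integral>u. Y k u * Y l u \<partial>tensor_power N \<rho>) \<le> (if l = k then b\<^sub>2\<^sup>2 else 0)" if "k < N" "l < N" for k l
  proof (cases "l = k")
    case True
    have "\<bar>\<integral>u. Y k u * Y l u \<partial>tensor_power N \<rho>\<bar> \<le> b\<^sub>2 * b\<^sub>2"
      using that YY_bd by (intro abs_integral_le_bound[OF Q.prob_space_axioms]) auto
    with True show ?thesis
      by (simp add: power2_eq_square)
  next
    case False
    then show ?thesis
      using fluctuation_uncorrelated[OF j that] by (simp add: Y_def)
  qed
  let ?X = "\<lambda>u. \<bar>(\<Sum>k<N. Y k u) / real N\<bar>"
  have sq: "(?X u)\<^sup>2 = (\<Sum>k<N. \<Sum>l<N. Y k u * Y l u) / (real N)\<^sup>2" for u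
    by (simp add: power_divide power2_eq_square[of "sum _ _"] sum_product)
  have X_int: "integrable (tensor_power N \<rho>) ?X"
    using Y_meas Q.finite_measure_axioms
    by (intro integrable_abs integrable_divide Bochner_Integration.integrable_sum
        integrable_bounded[OF Q.finite_measure_axioms, where B = b\<^sub>2]) (auto simp: Y_def fluctuation_bounded)
  have X2_int: "integrable (tensor_power N \<rho>) (\<lambda>u. (?X u)\<^sup>2)"
    unfolding sq using YY_int by (intro integrable_divide Bochner_Integration.integrable_sum) auto
  have "(\<integral>u. (\<Sum>k<N. \<Sum>l<N. Y k u * Y l u) \<partial>tensor_power N \<rho>)
      = (\<Sum>k<N. \<integral>u. (\<Sum>l<N. Y k u * Y l u) \<partial>tensor_power N \<rho>)"
    using YY_int by (intro Bochner_Integration.integral_sum Bochner_Integration.integrable_sum) auto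
  also have "\<dots> = (\<Sum>k<N. \<Sum>l<N. \<integral>u. Y k u * Y l u \<partial>tensor_power N \<rho>)"
    using YY_int by (intro sum.cong refl Bochner_Integration.integral_sum) auto
  finally have "(\<integral>u. (?X u)\<^sup>2 \<partial>tensor_power N \<rho>)
      = (\<Sum>k<N. \<Sum>l<N. \<integral>u. Y k u * Y l u \<partial>tensor_power N \<rho>) / (real N)\<^sup>2"
    unfolding sq by simp
  also have "\<dots> \<le> (\<Sum>k<N. \<Sum>l<N. if l = k then b\<^sub>2\<^sup>2 else 0) / (real N)\<^sup>2"
    using YY by (intro divide_right_mono sum_mono) auto
  also have "\<dots> = (b\<^sub>2 / sqrt (real N))\<^sup>2"
    using N by (simp add: power_divide power2_eq_square)
  finally have second: "(\<integral>u. (?X u)\<^sup>2 \<partial>tensor_power N \<rho>) \<le> (b\<^sub>2 / sqrt (real N))\<^sup>2" .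
  \<comment> \<open>Jensen's inequality for the square, in the form that the variance is
    nonnegative.\<close>
  have "(\<integral>u. ?X u \<partial>tensor_power N \<rho>)\<^sup>2 \<le> (\<integral>u. (?X u)\<^sup>2 \<partial>tensor_power N \<rho>)"
    using Q.variance_positive[of ?X] unfolding Q.variance_eq[OF X_int X2_int] by linarith
  also note second
  finally have "(\<integral>u. ?X u \<partial>tensor_power N \<rho>) \<le> b\<^sub>2 / sqrt (real N)"
    using nonneg by - (rule power2_le_imp_le, simp_all)
  then show "(\<integral>u. \<bar>particle_drift N u j - drift \<rho> (u j)\<bar> \<partial>tensor_power N \<rho>) \<le> b\<^sub>2 / sqrt (real N)"
    by (simp add: particle_drift_minus_drift Y_def)
  show "integrable (tensor_power N \<rho>) (\<lambda>u. \<bar>particle_drift N u j - drift \<rho> (u j)\<bar>)"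
    using X_int by (simp add: particle_drift_minus_drift Y_def)
qed

lemma measurable_drift_torus: "j < N \<Longrightarrow> (\<lambda>u. drift \<rho> (u j)) \<in> borel_measurable (torus N)"
  unfolding torus_def
  by (rule measurable_compose[of "\<lambda>u. u j" _ borel "drift \<rho>"])
    (simp_all add: measurable_drift[OF \<rho>])

text \<open>The fixed point equation gives \<rho> a density that is an integral over \<rho>. The
  density of the tensor power is a product of such integrals, which Tonelli rewrites as one integral
  of the product kernel.\<close>

lemma tensor_power_eq_push:
  assumes fixed: "P \<rho> = \<rho>"
  shows "tensor_power N \<rho> = density_kernel.push (torus_lebesgue N)
    (torus_kernel N (\<lambda>u j. drift \<rho> (u j))) (tensor_power N \<rho>)"
proof -
  let ?k = "\<lambda>u x. ennreal (periodic_ext p (circle_coord x - drift \<rho> u))"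
  define d where "d x = (\<integral>\<^sup>+u. ?k u x \<partial>\<rho>)" for x
  interpret \<rho>: prob_space \<rho>
    by (rule prob_space_rho)
  note [measurable_cong] = sets_rho
  note [measurable] = measurable_drift[OF \<rho>]
  have d_meas: "d \<in> borel_measurable circle_lebesgue"
    unfolding d_def by measurable
  have rho: "\<rho> = density circle_lebesgue d"
    using fixed by (simp add: self_consistent_transfer_def d_def[abs_def] drift_def diff_diff_eq)
  have "tensor_power N \<rho> = (\<Pi>\<^sub>M j\<in>{..<N}. density circle_lebesgue d)"
    using rho by simp
  also have "\<dots> = density (torus_lebesgue N) (\<lambda>x. \<Prod>j<N. d (x j))"
    unfolding torus_lebesgue_def
  proof (rule PiM_density[where M = "\<lambda>_. circle_lebesgue" and f = "\<lambda>_. d"])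
    show "product_sigma_finite (\<lambda>_. circle_lebesgue)"
      by (simp add: product_sigma_finite_def prob_space_circle_lebesgue prob_space_imp_sigma_finite)
    show "sigma_finite_measure (density circle_lebesgue d)"
      using rho \<rho>.sigma_finite_measure_axioms by simp
  qed (use d_meas in simp_all)
  also have "(\<lambda>x. \<Prod>j<N. d (x j)) = (\<lambda>x. \<integral>\<^sup>+u. torus_kernel N (\<lambda>u j. drift \<rho> (u j)) u x \<partial>tensor_power N \<rho>)"
  proof
    fix x :: "nat \<Rightarrow> circle"
    interpret product_sigma_finite "\<lambda>_ :: nat. \<rho>"
      by (simp add: product_sigma_finite_def \<rho>.sigma_finite_measure_axioms)
    have "(\<lambda>u. ennreal (periodic_ext p (z - drift \<rho> u))) \<in> borel_measurable \<rho>" for z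
      by measurable
    then show "(\<Prod>j<N. d (x j)) = (\<integral>\<^sup>+u. torus_kernel N (\<lambda>u j. drift \<rho> (u j)) u x \<partial>tensor_power N \<rho>)"
      unfolding torus_kernel_def d_def
      by (intro product_nn_integral_prod[symmetric, of "{..<N}" "\<lambda>j u. ?k u (x j)"]) auto
  qed
  finally show ?thesis
    by (simp only: density_kernel.push_def[OF density_kernel_torus[OF refl measurable_drift_torus]])
qed

lemma integral_tensor_power:
  fixes g :: "(nat \<Rightarrow> circle) \<Rightarrow> real"
  assumes fixed: "P \<rho> = \<rho>"
    and g: "g \<in> borel_measurable (torus N)" "\<And>x. x \<in> torus_points N \<Longrightarrow> \<bar>g x\<bar> \<le> B"
  shows "(\<integral>x. g x \<partial>tensor_power N \<rho>)
      = (\<integral>u. \<integral>x. g x \<partial>(\<Pi>\<^sub>M j\<in>{..<N}. law (drift \<rho> (u j))) \<partial>tensor_power N \<rho>)"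
    and "(\<lambda>u. \<integral>x. g x \<partial>(\<Pi>\<^sub>M j\<in>{..<N}. law (drift \<rho> (u j)))) \<in> borel_measurable (torus N)"
proof -
  have sp: "space (torus_lebesgue N) = torus_points N"
    using sets_eq_imp_space_eq[OF sets_torus_lebesgue] by (simp add: space_torus)
  have K: "density_kernel (torus_lebesgue N) (torus N) (torus_kernel N (\<lambda>u j. drift \<rho> (u j)))"
    by (intro density_kernel_torus refl measurable_drift_torus)
  have m: "g \<in> borel_measurable (torus_lebesgue N)"
    using g(1) measurable_cong_sets[OF sets_torus_lebesgue refl] by blast
  have "(\<integral>x. g x \<partial>density_kernel.push (torus_lebesgue N) (torus_kernel N (\<lambda>u j. drift \<rho> (u j))) (tensor_power N \<rho>))
      = (\<integral>u. \<integral>x. g x \<partial>(\<Pi>\<^sub>M j\<in>{..<N}. law (drift \<rho> (u j))) \<partial>tensor_power N \<rho>)"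
    unfolding density_torus_kernel[of N "\<lambda>u j. drift \<rho> (u j)", symmetric]
    using g(2) by (intro density_kernel.integral_push(1)[OF K tensor_power_prob m]) (simp add: sp)
  then show "(\<integral>x. g x \<partial>tensor_power N \<rho>)
      = (\<integral>u. \<integral>x. g x \<partial>(\<Pi>\<^sub>M j\<in>{..<N}. law (drift \<rho> (u j))) \<partial>tensor_power N \<rho>)"
    unfolding tensor_power_eq_push[OF fixed, symmetric] .
  show "(\<lambda>u. \<integral>x. g x \<partial>(\<Pi>\<^sub>M j\<in>{..<N}. law (drift \<rho> (u j)))) \<in> borel_measurable (torus N)"
    unfolding density_torus_kernel[of N "\<lambda>u j. drift \<rho> (u j)", symmetric]
    using g(2) by (intro density_kernel.integral_push(2)[OF K tensor_power_prob m]) (simp add: sp)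
qed

text \<open>Between the two one-step expectations, insert the particle kernel started from the
  product measure. One difference has equal kernels and contracts by \<kappa>; the other has equal
  initial measures. Comparing the kernels under the product measure, and not under \<mu>, is what
  makes independence available.\<close>

lemma wasserstein_transfer_N:
  assumes fixed: "P \<rho> = \<rho>" and \<mu>: "\<mu> \<in> prob_measures (torus N)"
  shows "wasserstein N (P\<^sub>N N \<mu>) (tensor_power N \<rho>)
    \<le> \<kappa> * wasserstein N \<mu> (tensor_power N \<rho>) + (1 - c) * b\<^sub>2 / sqrt (real N)"
proof (rule wasserstein_least)
  fix g :: "(nat \<Rightarrow> circle) \<Rightarrow> real" and L assume g: "coord_lipschitz {..<N} L g" and L_sum: "(\<Sum>i<N. L i) \<le> 1"
  have L: "0 \<le> L i" if "i < N" for i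
    using coord_lipschitzD(1)[OF g] that by simp
  let ?R = "tensor_power N \<rho>"
  interpret Q: prob_space ?R
    by (intro prob_space_PiM prob_space_rho)
  obtain B where B: "\<And>x. x \<in> torus_points N \<Longrightarrow> \<bar>g x\<bar> \<le> B"
    using coord_lipschitz_bounded[OF g] by blast
  note g_meas = measurable_torus[OF g]
  define G where "G u = (\<integral>x. g x \<partial>(\<Pi>\<^sub>M j\<in>{..<N}. law (particle_drift N u j)))" for u
  define H where "H u = (\<integral>x. g x \<partial>(\<Pi>\<^sub>M j\<in>{..<N}. law (drift \<rho> (u j))))" for u
  have G_lip: "coord_lipschitz {..<N} (transferred_lip N L) G"
    unfolding G_def by (rule coord_lipschitz_transfer[OF g])
  have bd: "\<bar>\<integral>x. g x \<partial>(\<Pi>\<^sub>M j\<in>{..<N}. law (z j))\<bar> \<le> B" for z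
  proof (rule abs_integral_le_bound)
    have "sets (\<Pi>\<^sub>M j\<in>{..<N}. law (z j)) = sets (torus N)"
      unfolding torus_def by (intro sets_PiM_cong) auto
    then show "g \<in> borel_measurable (\<Pi>\<^sub>M j\<in>{..<N}. law (z j))"
      using g_meas measurable_cong_sets by blast
  qed (auto simp: space_PiM intro!: B prob_space_PiM prob_space_law)
  have G_int: "integrable ?R G"
    using integral_transfer_N(2)[OF N \<mu> g_meas B] bd
    by (intro integrable_bounded[OF Q.finite_measure_axioms]) (auto simp: G_def[abs_def] measurable_tensor_power)
  have H_int: "integrable ?R H"
    using integral_tensor_power(2)[OF fixed g_meas B] bd
    by (intro integrable_bounded[OF Q.finite_measure_axioms]) (auto simp: H_def[abs_def] measurable_tensor_power)
  have "(\<integral>x. g x \<partial>P\<^sub>N N \<mu>) - (\<integral>x. g x \<partial>?R) = (\<integral>u. G u \<partial>\<mu>) - (\<integral>u. H u \<partial>?R)"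
    using integral_transfer_N(1)[OF N \<mu> g_meas B] integral_tensor_power(1)[OF fixed g_meas B]
    by (simp add: G_def H_def)
  also have "\<dots> = ((\<integral>u. G u \<partial>\<mu>) - (\<integral>u. G u \<partial>?R)) + (\<integral>u. G u - H u \<partial>?R)"
    using G_int H_int by simp
  also have "\<dots> \<le> \<kappa> * wasserstein N \<mu> ?R + (1 - c) * b\<^sub>2 / sqrt (real N)"
  proof (rule add_mono)
    \<comment> \<open>The zero function with constants 1 / N, which sum to 1, is the test function
      here.\<close>
    have W: "0 \<le> wasserstein N \<mu> ?R"
      using integral_diff_le_wasserstein[OF \<mu> tensor_power_prob, of "\<lambda>_. 1 / real N" "\<lambda>_. 0"] N
      by (simp add: coord_lipschitz_def)
    have "(\<integral>u. G u \<partial>\<mu>) - (\<integral>u. G u \<partial>?R) \<le> (\<Sum>i<N. transferred_lip N L i) * wasserstein N \<mu> ?R"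
      by (rule integral_diff_le_wasserstein[OF \<mu> tensor_power_prob G_lip])
    also have "\<dots> \<le> \<kappa> * wasserstein N \<mu> ?R"
      unfolding sum_transferred_lip[OF N] using kappa_nonneg L_sum W by (intro mult_right_mono mult_left_le) auto
    finally show "(\<integral>u. G u \<partial>\<mu>) - (\<integral>u. G u \<partial>?R) \<le> \<kappa> * wasserstein N \<mu> ?R" .
    have "(\<integral>u. G u - H u \<partial>?R) \<le> (\<integral>u. (\<Sum>j<N. (1 - c) * L j * \<bar>particle_drift N u j - drift \<rho> (u j)\<bar>) \<partial>?R)"
    proof (rule integral_mono)
      show "integrable ?R (\<lambda>u. G u - H u)"
        using G_int H_int by simp
      show "integrable ?R (\<lambda>u. \<Sum>j<N. (1 - c) * L j * \<bar>particle_drift N u j - drift \<rho> (u j)\<bar>)"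
        using expected_drift_deviation(2) by (intro Bochner_Integration.integrable_sum integrable_mult_right) auto
      show "G u - H u \<le> (\<Sum>j<N. (1 - c) * L j * \<bar>particle_drift N u j - drift \<rho> (u j)\<bar>)" for u
        unfolding G_def H_def by (rule order.trans[OF abs_ge_self integral_PiM_law_diff[OF g]]) simp
    qed
    also have "\<dots> = (\<Sum>j<N. (1 - c) * L j * (\<integral>u. \<bar>particle_drift N u j - drift \<rho> (u j)\<bar> \<partial>?R))"
      using expected_drift_deviation(2) by (subst Bochner_Integration.integral_sum) auto
    also have "\<dots> \<le> (\<Sum>j<N. (1 - c) * L j * (b\<^sub>2 / sqrt (real N)))"
      using L c_le_1 by (intro sum_mono mult_left_mono expected_drift_deviation(1)) auto
    also have "\<dots> = (1 - c) * b\<^sub>2 / sqrt (real N) * (\<Sum>j<N. L j)"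
      by (simp add: sum_distrib_left sum_divide_distrib ac_simps)
    also have "\<dots> \<le> (1 - c) * b\<^sub>2 / sqrt (real N)"
      using L_sum c_le_1 nonneg by (intro mult_left_le) auto
    finally show "(\<integral>u. G u - H u \<partial>?R) \<le> (1 - c) * b\<^sub>2 / sqrt (real N)" .
  qed
  finally show "(\<integral>x. g x \<partial>P\<^sub>N N \<mu>) - (\<integral>x. g x \<partial>?R)
      \<le> \<kappa> * wasserstein N \<mu> ?R + (1 - c) * b\<^sub>2 / sqrt (real N)" .
qed

end

section \<open>Exponential moments of the invariant particle measure\<close>

text \<open>By invariance the exponential moment may be computed after one step, which yields a
  Gaussian factor times the moment of the transferred observable. After n steps the remaining
  observable oscillates by at most \<kappa>^n times the sum of the L i; the crude bound for it is
  the second term, which disappears in the limit.\<close>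

lemma mgf_bound_iterated:
  assumes N: "0 < N" and \<mu>: "\<mu> \<in> prob_measures (torus N)" and fixed: "P\<^sub>N N \<mu> = \<mu>"
    and g: "coord_lipschitz {..<N} L g"
  shows "(\<integral>x. exp (l * (g x - (\<integral>y. g y \<partial>\<mu>))) \<partial>\<mu>)
    \<le> exp (l\<^sup>2 / 8 * (\<Sum>k<n. (\<kappa>\<^sup>2) ^ k) * (\<Sum>i<N. (L i)\<^sup>2) + \<bar>l\<bar> * \<kappa> ^ n * (\<Sum>i<N. L i))"
  using g
proof (induction n arbitrary: g L)
  case 0
  have sets_mu: "sets \<mu> = sets (torus N)" and P: "prob_space \<mu>"
    using \<mu> by (simp_all add: space_prob_algebra)
  interpret prob_space \<mu> by fact
  note [measurable_cong] = sets_mu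
  have sp: "space \<mu> = torus_points N"
    using sets_eq_imp_space_eq[OF sets_mu] by (simp add: space_torus)
  have [measurable]: "g \<in> borel_measurable (torus N)"
    by (rule measurable_torus[OF 0])
  obtain B where B: "\<And>x. x \<in> torus_points N \<Longrightarrow> \<bar>g x\<bar> \<le> B"
    using coord_lipschitz_bounded[OF 0] by blast
  have g_int: "integrable \<mu> g"
    using B by (intro integrable_bounded[OF finite_measure_axioms, of _ B]) (auto simp: sp)
  have bd: "exp (l * (g x - (\<integral>y. g y \<partial>\<mu>))) \<le> exp (\<bar>l\<bar> * (\<Sum>i<N. L i))" if x: "x \<in> torus_points N" for x
  proof -
    have "g x - (\<integral>y. g y \<partial>\<mu>) = (\<integral>y. g x - g y \<partial>\<mu>)"
      using g_int by (simp add: prob_space)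
    also have "\<bar>\<dots>\<bar> \<le> (\<Sum>i<N. L i)"
      by (rule abs_integral_le_bound[OF P]) (auto simp: sp intro!: coord_lipschitz_osc[OF 0 _ x])
    finally have "\<bar>l * (g x - (\<integral>y. g y \<partial>\<mu>))\<bar> \<le> \<bar>l\<bar> * (\<Sum>i<N. L i)"
      by (simp add: abs_mult mult_left_mono)
    then show ?thesis
      by simp
  qed
  have "\<bar>\<integral>x. exp (l * (g x - (\<integral>y. g y \<partial>\<mu>))) \<partial>\<mu>\<bar> \<le> exp (\<bar>l\<bar> * (\<Sum>i<N. L i))"
    using bd by (intro abs_integral_le_bound[OF P]) (auto simp: sp)
  then show ?case
    by simp
next
  case (Suc n)
  have sets_mu: "sets \<mu> = sets (torus N)" and P: "prob_space \<mu>"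
    using \<mu> by (simp_all add: space_prob_algebra)
  interpret prob_space \<mu> by fact
  note [measurable_cong] = sets_mu
  have sp: "space \<mu> = torus_points N"
    using sets_eq_imp_space_eq[OF sets_mu] by (simp add: space_torus)
  have g_meas [measurable]: "g \<in> borel_measurable (torus N)"
    by (rule measurable_torus[OF Suc.prems])
  obtain B where B: "\<And>x. x \<in> torus_points N \<Longrightarrow> \<bar>g x\<bar> \<le> B"
    using coord_lipschitz_bounded[OF Suc.prems] by blast
  define K where "K u = (\<Pi>\<^sub>M j\<in>{..<N}. law (particle_drift N u j))" for u
  have K_sets [measurable_cong]: "sets (K u) = sets (torus N)" for u
    unfolding torus_def K_def by (intro sets_PiM_cong) auto
  have K_sp: "space (K u) = torus_points N" for u
    by (simp add: K_def space_PiM)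
  define G where "G u = (\<integral>x. g x \<partial>K u)" for u
  define m where "m = (\<integral>x. g x \<partial>\<mu>)"
  have G_lip: "coord_lipschitz {..<N} (transferred_lip N L) G"
    unfolding G_def K_def by (rule coord_lipschitz_transfer[OF Suc.prems])
  have [measurable]: "G \<in> borel_measurable (torus N)"
    by (rule measurable_torus[OF G_lip])
  obtain B' where B': "\<And>x. x \<in> torus_points N \<Longrightarrow> \<bar>G x\<bar> \<le> B'"
    using coord_lipschitz_bounded[OF G_lip] by blast
  \<comment> \<open>Invariance gives g and its transfer the same mean, so the exponent stays centred
    when the induction hypothesis is applied.\<close>
  have m_G: "m = (\<integral>u. G u \<partial>\<mu>)"
    using integral_transfer_N(1)[OF N \<mu> g_meas B] by (simp add: fixed m_def G_def K_def)
  have exp_bd: "\<bar>exp (l * (z - m))\<bar> \<le> exp (\<bar>l\<bar> * (C + \<bar>m\<bar>))" if "\<bar>z\<bar> \<le> C" for z C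
  proof -
    have "l * (z - m) \<le> \<bar>l\<bar> * \<bar>z - m\<bar>"
      by (simp add: abs_mult[symmetric])
    also have "\<dots> \<le> \<bar>l\<bar> * (C + \<bar>m\<bar>)"
      using that by (intro mult_left_mono) auto
    finally show ?thesis by simp
  qed
  let ?S = "\<Sum>i<N. (L i)\<^sup>2"
  have local: "(\<integral>x. exp (l * (g x - m)) \<partial>K u) \<le> exp (l\<^sup>2 / 8 * ?S) * exp (l * (G u - m))" for u
  proof -
    interpret law: product_prob_space "\<lambda>j. law (particle_drift N u j)" "{..<N}"
      by (rule product_prob_space_law)
    have "(\<integral>x. exp (l * (g x - (\<integral>y. g y \<partial>K u))) \<partial>K u) \<le> exp (l\<^sup>2 / 8 * ?S)"
      unfolding K_def
    proof (rule law.bounded_differences_mgf)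
      show "g \<in> borel_measurable (\<Pi>\<^sub>M j\<in>{..<N}. law (particle_drift N u j))"
        using g_meas measurable_cong_sets[OF K_sets refl] unfolding K_def by blast
      show "\<bar>g x\<bar> \<le> B" if "x \<in> space (\<Pi>\<^sub>M j\<in>{..<N}. law (particle_drift N u j))" for x
        using that B by (simp add: space_PiM)
      show "\<bar>g (x(i := y)) - g (x(i := y'))\<bar> \<le> L i"
        if "i \<in> {..<N}" "x \<in> space (\<Pi>\<^sub>M j\<in>{..<N}. law (particle_drift N u j))" for i x y y'
      proof (rule order.trans)
        show "\<bar>g (x(i := y)) - g (x(i := y'))\<bar> \<le> L i * dist y y'"
          using that by (intro coord_lipschitzD(2)[OF Suc.prems]) (simp_all add: space_PiM)
        show "L i * dist y y' \<le> L i"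
          using coord_lipschitzD(1)[OF Suc.prems that(1)] by (simp add: mult_left_le dist_circle_le)
      qed
    qed simp
    then have "(\<integral>x. exp (l * (g x - G u)) \<partial>K u) * exp (l * (G u - m)) \<le> exp (l\<^sup>2 / 8 * ?S) * exp (l * (G u - m))"
      unfolding G_def by (rule mult_right_mono) simp
    moreover have "exp (l * (g x - m)) = exp (l * (g x - G u)) * exp (l * (G u - m))" for x
      by (simp add: exp_add[symmetric] algebra_simps)
    then have "(\<integral>x. exp (l * (g x - m)) \<partial>K u) = (\<integral>x. exp (l * (g x - G u)) \<partial>K u) * exp (l * (G u - m))"
      by (simp only: integral_mult_left_zero)
    ultimately show ?thesis
      by simp
  qed
  have "(\<integral>x. exp (l * (g x - m)) \<partial>\<mu>) = (\<integral>x. exp (l * (g x - m)) \<partial>P\<^sub>N N \<mu>)"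
    by (simp add: fixed)
  also have "\<dots> = (\<integral>u. \<integral>x. exp (l * (g x - m)) \<partial>K u \<partial>\<mu>)"
    unfolding K_def by (rule integral_transfer_N(1)[OF N \<mu> _ exp_bd[OF B]]) auto
  also have "\<dots> \<le> (\<integral>u. exp (l\<^sup>2 / 8 * ?S) * exp (l * (G u - m)) \<partial>\<mu>)"
    using exp_bd[OF B'] local
    by (intro integral_mono' integrable_mult_right integrable_bounded[OF finite_measure_axioms,
          where B = "exp (\<bar>l\<bar> * (B' + \<bar>m\<bar>))"]) (auto simp: sp)
  also have "\<dots> = exp (l\<^sup>2 / 8 * ?S) * (\<integral>u. exp (l * (G u - (\<integral>u. G u \<partial>\<mu>))) \<partial>\<mu>)"
    by (simp add: m_G)
  also have "\<dots> \<le> exp (l\<^sup>2 / 8 * ?S) * exp (l\<^sup>2 / 8 * (\<Sum>k<n. (\<kappa>\<^sup>2) ^ k) * (\<Sum>i<N. (transferred_lip N L i)\<^sup>2)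
      + \<bar>l\<bar> * \<kappa> ^ n * (\<Sum>i<N. transferred_lip N L i))"
    by (intro mult_left_mono Suc.IH G_lip) simp
  also have "\<dots> \<le> exp (l\<^sup>2 / 8 * ?S) * exp (l\<^sup>2 / 8 * (\<Sum>k<n. (\<kappa>\<^sup>2) ^ k) * (\<kappa>\<^sup>2 * ?S)
      + \<bar>l\<bar> * \<kappa> ^ n * (\<kappa> * (\<Sum>i<N. L i)))"
    unfolding sum_transferred_lip[OF N]
    by (auto intro!: mult_left_mono sum_squares_transferred_lip[OF N] mult_nonneg_nonneg sum_nonneg)
  also have "\<dots> = exp (l\<^sup>2 / 8 * (\<Sum>k<Suc n. (\<kappa>\<^sup>2) ^ k) * ?S + \<bar>l\<bar> * \<kappa> ^ Suc n * (\<Sum>i<N. L i))"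
  proof -
    have geo: "(\<Sum>k<Suc n. (\<kappa>\<^sup>2) ^ k) = 1 + \<kappa>\<^sup>2 * (\<Sum>k<n. (\<kappa>\<^sup>2) ^ k)"
      by (simp only: sum.lessThan_Suc_shift power_0 power_Suc sum_distrib_left)
    have "exp (x * S) * exp (x * T * (q\<^sup>2 * S) + y * q ^ n * (q * s)) = exp (x * (1 + q\<^sup>2 * T) * S + y * q ^ Suc n * s)"
      for x y q s S T :: real
      by (simp add: exp_add[symmetric] algebra_simps)
    then show ?thesis
      unfolding geo .
  qed
  finally show ?case
    unfolding m_def .
qed

text \<open>Joint Lipschitz continuity makes each \<open>Lip_coord\<close> finite, so that
  \<open>enn2real\<close> returns the true constant and not its default 0.\<close>

lemma torus_lipschitz_coord_lipschitz:
  assumes "torus_lipschitz N g"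
  shows "coord_lipschitz {..<N} (\<lambda>i. enn2real (Lip_coord N i g)) g"
proof (rule coord_lipschitz_Lip_coord)
  fix i assume i: "i < N"
  from assms obtain M where M: "\<And>x y. x \<in> torus_points N \<Longrightarrow> y \<in> torus_points N \<Longrightarrow>
      \<bar>g x - g y\<bar> \<le> M * (\<Sum>i<N. dist (x i) (y i))"
    unfolding torus_lipschitz_def by blast
  have "Lip_coord N i g \<le> ennreal \<bar>M\<bar>"
  proof (subst Lip_coord_le_iff, simp, intro ballI allI)
    fix x :: "nat \<Rightarrow> circle" and y z assume x: "x \<in> torus_points N"
    have upd: "x(i := w) \<in> torus_points N" for w
      using x i by (auto simp: PiE_def extensional_def)
    have "(\<Sum>k<N. dist ((x(i := y)) k) ((x(i := z)) k)) = (\<Sum>k<N. if k = i then dist y z else 0)"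
      by (intro sum.cong) auto
    then have "\<bar>g (x(i := y)) - g (x(i := z))\<bar> \<le> M * dist y z"
      using M[OF upd upd, of y z] i by simp
    also have "\<dots> \<le> \<bar>M\<bar> * dist y z"
      by (intro mult_right_mono) auto
    finally show "\<bar>g (x(i := y)) - g (x(i := z))\<bar> \<le> \<bar>M\<bar> * dist y z" .
  qed
  then show "Lip_coord N i g < \<top>"
    by (rule order.strict_trans1) simp
qed

lemma sub_gaussian_fixed_point:
  assumes N: "0 < N" and \<mu>: "\<mu> \<in> prob_measures (torus N)" and fixed: "P\<^sub>N N \<mu> = \<mu>"
    and kappa: "\<kappa>\<^sup>2 \<le> 3 / 4"
  shows "sub_gaussian N \<mu>"
  unfolding sub_gaussian_def
proof (intro allI impI)
  fix g l assume "torus_lipschitz N g"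
  define L where "L i = enn2real (Lip_coord N i g)" for i
  have g: "coord_lipschitz {..<N} L g"
    unfolding L_def by (rule torus_lipschitz_coord_lipschitz) fact
  let ?S = "\<Sum>i<N. (L i)\<^sup>2"
  have geo: "(\<lambda>n. \<Sum>k<n. (\<kappa>\<^sup>2) ^ k) \<longlonglongrightarrow> 1 / (1 - \<kappa>\<^sup>2)"
    using kappa by (intro geometric_sums[unfolded sums_def]) auto
  have "(\<lambda>n. exp (l\<^sup>2 / 8 * (\<Sum>k<n. (\<kappa>\<^sup>2) ^ k) * ?S + \<bar>l\<bar> * \<kappa> ^ n * (\<Sum>i<N. L i)))
      \<longlonglongrightarrow> exp (l\<^sup>2 / 8 * (1 / (1 - \<kappa>\<^sup>2)) * ?S + \<bar>l\<bar> * 0 * (\<Sum>i<N. L i))"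
    using contraction kappa_nonneg
    by (intro tendsto_exp tendsto_add tendsto_mult tendsto_const geo LIMSEQ_realpow_zero)
  then have "(\<integral>x. exp (l * (g x - (\<integral>y. g y \<partial>\<mu>))) \<partial>\<mu>)
      \<le> exp (l\<^sup>2 / 8 * (1 / (1 - \<kappa>\<^sup>2)) * ?S + \<bar>l\<bar> * 0 * (\<Sum>i<N. L i))"
    using mgf_bound_iterated[OF N \<mu> fixed g] by (intro LIMSEQ_le_const) blast+
  \<comment> \<open>The bound 3/4 on the square of \<kappa> caps the geometric series at 4, which
    turns Hoeffding's 1/8 into the 1/2 of \<open>sub_gaussian\<close>.\<close>
  also have "\<dots> \<le> exp (l\<^sup>2 / 8 * 4 * ?S)"
  proof -
    have "1 / (1 - \<kappa>\<^sup>2) \<le> 4"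
      using kappa by (simp add: pos_divide_le_eq)
    then have "l\<^sup>2 / 8 * (1 / (1 - \<kappa>\<^sup>2)) * ?S \<le> l\<^sup>2 / 8 * 4 * ?S"
      by (intro mult_right_mono mult_left_mono sum_nonneg) auto
    then show ?thesis
      by simp
  qed
  finally show "(\<integral>x. exp (l * (g x - (\<integral>y. g y \<partial>\<mu>))) \<partial>\<mu>)
      \<le> exp (l\<^sup>2 / 2 * (\<Sum>i<N. (enn2real (Lip_coord N i g))\<^sup>2))"
    by (simp add: L_def)
qed

end

theorem theorem1p3:
  fixes f :: "circle \<Rightarrow> real" and h :: "circle \<times> circle \<Rightarrow> real"
    and p :: "real \<Rightarrow> real" and c \<kappa> Cbar :: real
  assumes f: "\<exists>L. L-lipschitz_on UNIV f"
    and h: "\<exists>L. L-lipschitz_on UNIV h"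
    and p: "prob_density_on_unit p"
    and c: "c > 0" "\<forall>x\<in>{0..1}. p x > c"
    and kappa: "\<kappa> = (1 - c) * (enn2real (Lip f) + enn2real (Lip1 h) + enn2real (Lip2 h))"
    and kappa_less: "\<kappa> < sqrt 3 / 2"
    and Cbar: "Cbar = (1 - c) * enn2real (Lip2 h) / (1 - \<kappa>)"
  shows "(\<forall>\<mu>\<in>prob_measures borel. self_consistent_transfer f h p \<mu> \<in> prob_measures borel) \<and>
    (\<forall>\<mu>\<^sub>1\<in>prob_measures borel. \<forall>\<mu>\<^sub>2\<in>prob_measures borel.
      wasserstein1 (self_consistent_transfer f h p \<mu>\<^sub>1) (self_consistent_transfer f h p \<mu>\<^sub>2)
        \<le> \<kappa> * wasserstein1 \<mu>\<^sub>1 \<mu>\<^sub>2) \<and>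
    (\<exists>!\<rho>. \<rho> \<in> prob_measures borel \<and> self_consistent_transfer f h p \<rho> = \<rho>) \<and>
    (\<forall>\<rho>\<in>prob_measures borel. self_consistent_transfer f h p \<rho> = \<rho> \<longrightarrow>
      (\<forall>N\<ge>2.
        transfer_N f h p N ` wasserstein_ball Cbar N \<rho> \<subseteq> wasserstein_ball Cbar N \<rho> \<and>
        (\<exists>!\<rho>\<^sub>N. \<rho>\<^sub>N \<in> prob_measures (torus N) \<and> transfer_N f h p N \<rho>\<^sub>N = \<rho>\<^sub>N) \<and>
        (\<forall>\<rho>\<^sub>N\<in>prob_measures (torus N). transfer_N f h p N \<rho>\<^sub>N = \<rho>\<^sub>N \<longrightarrow>
          sub_gaussian N \<rho>\<^sub>N \<and>
          \<rho>\<^sub>N \<in> wasserstein_ball Cbar N \<rho> \<and>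
          wasserstein N \<rho>\<^sub>N (tensor_power N \<rho>) \<le> Cbar / sqrt (real N))))"
proof -
  have noise: "noise p c"
    using p c by unfold_locales auto
  obtain Lf where Lf: "Lf-lipschitz_on UNIV f"
    using f by blast
  obtain Lh where Lh: "Lh-lipschitz_on UNIV h"
    using h by blast
  have c1: "c \<le> 1"
    by (rule noise.c_le_1[OF noise])
  have kappa_ge_0: "0 \<le> \<kappa>"
    using c1 by (simp add: kappa enn2real_nonneg)
  have "\<kappa>\<^sup>2 \<le> (sqrt 3 / 2)\<^sup>2"
    using kappa_less kappa_ge_0 by (intro power_mono) auto
  then have kappa_sq: "\<kappa>\<^sup>2 \<le> 3 / 4"
    by (simp add: power_divide)
  have kappa_1: "\<kappa> < 1"
  proof (rule power2_less_imp_less)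
    show "\<kappa>\<^sup>2 < 1\<^sup>2"
      using kappa_sq by simp
  qed simp
  interpret mean_field p c f h "enn2real (Lip f)" "enn2real (Lip1 h)" "enn2real (Lip2 h)"
  proof (intro mean_field.intro noise mean_field_axioms.intro)
    show "(1 - c) * (enn2real (Lip f) + enn2real (Lip1 h) + enn2real (Lip2 h)) < 1"
      using kappa_1 kappa by simp
  qed (use lipschitz_Lip[OF Lf] lipschitz_Lip1[OF Lh] lipschitz_Lip2[OF Lh] in auto)
  have unique: "\<exists>!\<rho>. \<rho> \<in> prob_measures borel \<and> self_consistent_transfer f h p \<rho> = \<rho>"
    using self_consistent_fixed_point_exists self_consistent_fixed_point_unique by blast
  \<comment> \<open>The additive error of one step becomes (1 - \<kappa>) times the target radius,
    so each step is bounded by a convex combination of the old distance and that radius.\<close>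
  have Cbar_eq: "(1 - c) * enn2real (Lip2 h) = (1 - \<kappa>) * Cbar"
    using kappa_1 by (simp add: Cbar)
  have torus: "transfer_N f h p N ` wasserstein_ball Cbar N \<rho> \<subseteq> wasserstein_ball Cbar N \<rho> \<and>
      (\<exists>!\<rho>\<^sub>N. \<rho>\<^sub>N \<in> prob_measures (torus N) \<and> transfer_N f h p N \<rho>\<^sub>N = \<rho>\<^sub>N) \<and>
      (\<forall>\<rho>\<^sub>N\<in>prob_measures (torus N). transfer_N f h p N \<rho>\<^sub>N = \<rho>\<^sub>N \<longrightarrow>
        sub_gaussian N \<rho>\<^sub>N \<and> \<rho>\<^sub>N \<in> wasserstein_ball Cbar N \<rho> \<and>
        wasserstein N \<rho>\<^sub>N (tensor_power N \<rho>) \<le> Cbar / sqrt (real N))"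
    if \<rho>: "\<rho> \<in> prob_measures borel" "self_consistent_transfer f h p \<rho> = \<rho>" and "2 \<le> N" for \<rho> N
  proof -
    have N: "0 < N"
      using \<open>2 \<le> N\<close> by simp
    let ?W = "\<lambda>\<mu>. wasserstein N \<mu> (tensor_power N \<rho>)"
    have step: "?W (transfer_N f h p N \<mu>) \<le> \<kappa> * ?W \<mu> + (1 - \<kappa>) * (Cbar / sqrt (real N))"
      if "\<mu> \<in> prob_measures (torus N)" for \<mu>
      using wasserstein_transfer_N[OF \<rho>(1) N \<rho>(2) that] by (simp add: kappa[symmetric] Cbar_eq)
    have ball: "transfer_N f h p N \<mu> \<in> wasserstein_ball Cbar N \<rho>" if "\<mu> \<in> wasserstein_ball Cbar N \<rho>" for \<mu>
    proof -
      have \<mu>: "\<mu> \<in> prob_measures (torus N)" and W: "?W \<mu> \<le> Cbar / sqrt (real N)"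
        using that by (simp_all add: wasserstein_ball_def)
      have "?W (transfer_N f h p N \<mu>) \<le> \<kappa> * (Cbar / sqrt (real N)) + (1 - \<kappa>) * (Cbar / sqrt (real N))"
        using step[OF \<mu>] mult_left_mono[OF W kappa_ge_0] by simp
      also have "\<dots> = Cbar / sqrt (real N)"
        by (simp only: distrib_right[symmetric]) simp
      finally show ?thesis
        using transfer_N_prob[OF N \<mu>] by (simp add: wasserstein_ball_def)
    qed
    \<comment> \<open>At an invariant measure the one-step estimate bounds the distance by itself,
      so no convergence of iterates inside the ball is required.\<close>
    have bound: "?W \<mu> \<le> Cbar / sqrt (real N)"
      if "\<mu> \<in> prob_measures (torus N)" "transfer_N f h p N \<mu> = \<mu>" for \<mu>
    proof -
      have "(1 - \<kappa>) * ?W \<mu> \<le> (1 - \<kappa>) * (Cbar / sqrt (real N))"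
        using step[OF that(1)] that(2) by (simp add: left_diff_distrib)
      then show ?thesis
        using kappa_1 by (subst (asm) mult_le_cancel_left_pos) auto
    qed
    have sub_gauss: "sub_gaussian N \<mu>"
      if "\<mu> \<in> prob_measures (torus N)" "transfer_N f h p N \<mu> = \<mu>" for \<mu>
      using kappa_sq unfolding kappa by (rule sub_gaussian_fixed_point[OF N that])
    have in_ball: "\<mu> \<in> wasserstein_ball Cbar N \<rho>"
      if "\<mu> \<in> prob_measures (torus N)" "transfer_N f h p N \<mu> = \<mu>" for \<mu>
      using that(1) bound[OF that] by (simp add: wasserstein_ball_def)
    have "transfer_N f h p N ` wasserstein_ball Cbar N \<rho> \<subseteq> wasserstein_ball Cbar N \<rho>"
      by (rule image_subsetI) (rule ball)
    then show ?thesis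
      by (intro conjI ballI impI transfer_N_fixed_point[OF N] sub_gauss in_ball bound)
  qed
  have contr: "wasserstein1 (self_consistent_transfer f h p \<mu>\<^sub>1) (self_consistent_transfer f h p \<mu>\<^sub>2)
      \<le> \<kappa> * wasserstein1 \<mu>\<^sub>1 \<mu>\<^sub>2"
    if "\<mu>\<^sub>1 \<in> prob_measures borel" "\<mu>\<^sub>2 \<in> prob_measures borel" for \<mu>\<^sub>1 \<mu>\<^sub>2
    unfolding kappa by (rule self_consistent_transfer_contraction[OF that])
  show ?thesis
    using self_consistent_transfer_prob contr
    by (intro conjI[OF _ conjI[OF _ conjI[OF unique]]]) (blast, blast, intro ballI impI allI torus)
qed

end
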